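(* Fix $\alpha,\delta,\kappa\in(0,1)$ and probability measures $P_0,P_1$ on a measurable space $\mathcal X$ with $P_1\ll P_0$, $L:=dP_1/dP_0$, and $0<D<\infty$, where $D:=D_{\mathrm{KL}}(P_1\|P_0)$. With $d_N^*(\mathfrak T;\alpha,\delta,\kappa)$, $\mathfrak T_{\rm raw}$, $\mathfrak T_{\rm rand}$ and $I_N(\kappa)$ as defined in the context: 1. $$\liminf_{N\to\infty}\frac{d_N^*(\mathfrak T_{\rm raw};\alpha,\delta,\kappa)}{\log N}\ge\frac1D,\qquad \liminf_{N\to\infty}\frac{d_N^*(\mathfrak T_{\rm rand};\alpha,\delta,\kappa)}{\log N}\ge\frac1D.$$ 2. Suppose additionally that the CDF $F_{s^*,P_0}$ of $s^*(X)$ under $X\sim P_0$, where $s^*(x):=L(x)$, is continuous. Let $H$ be the law of $F_{s^*,P_0}(s^*(X))$ under $X\sim P_1$ and $U$ the uniform law on $[0,1]$, and suppose (local KL support of the betting pair $(\mathcal F,\Pi)$) that $H\ll U$ with $h:=dH/dU$ and $D_{\mathrm{KL}}(H\|U)\in(0,\infty)$, that $\log h$ is bounded and Lipschitz, and that there are constants $a,c_0\ge0$ such that for every $r\ge1$ and all $z_1,\dots,z_r\in[0,1]$, $$\log\int_\Theta\prod_{i=1}^rf_\theta(z_i)\,d\Pi(\theta)\ge\sum_{i=1}^r\log h(z_i)-a\log r-c_0.$$ Choose a fixed $0<\bar\alpha\le\alpha$ with $\bar\alpha<\delta$, and let $w_k:=c_{\mathrm{nh}}[k\{\log(e+k)\}^2]^{-1}$,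 where $c_{\mathrm{nh}}^{-1}:=\sum_{\ell=1}^\infty[\ell\{\log(e+\ell)\}^2]^{-1}$. Let $\tau\in\{\tau_{Z,w}(1/\bar\alpha),\tau_{S,w}(1/\bar\alpha)\}$ be either the weighted maximum or the weighted sum conformal restart rule computed with the score $s^*$, these weights and threshold $1/\bar\alpha$. Then $\mathbb P_{P_0,\infty}(\tau<\infty)\le\bar\alpha$ and, for every $c>1/D$, $$\sup_{T\in I_N(\kappa)}\mathbb P_{P_0,T,P_1}\{\tau>T+\lceil c\log N\rceil\}\longrightarrow0\quad(N\to\infty).$$ It follows that $$\frac{d_N^*(\mathfrak T_{\rm rand};\alpha,\delta,\kappa)}{\log N}\longrightarrow\frac1D,$$ and the procedure $\tau$ attains this lower bound to first order, i.e. $\frac1{\log N}\min\{r\in\mathbb N:\inf_{T\in I_N(\kappa)}\mathbb P_{P_0,T,P_1}\{T<\tau\le T+r\}\ge1-\delta\}\to\frac1D$.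
   Context: Under $\mathbb P_{P_0,T,P_1}$ the $\mathcal X$-valued observations are independent with $X_1,\dots,X_T\sim P_0$ and $X_{T+1},X_{T+2},\dots\sim P_1$; under $\mathbb P_{P_0,\infty}$ they are iid $P_0$. External randomizers $\lambda_1,\lambda_2,\dots$ are iid $U(0,1)$ independent of the data, with the same law under all these measures. $\mathfrak T_{\rm raw}$ (resp. $\mathfrak T_{\rm rand}$) is the set of all stopping times for $\mathcal A_t:=\sigma(X_1,\dots,X_t)$ (resp. $\mathcal H_t:=\sigma(X_1,\dots,X_t,\lambda_1,\dots,\lambda_t)$). $I_N(\kappa):=\{\lceil\kappa N\rceil,\dots,N\}$. For $\mathfrak T\in\{\mathfrak T_{\rm raw},\mathfrak T_{\rm rand}\}$, $$d_N^*(\mathfrak T;\alpha,\delta,\kappa):=\inf_{\tau\in\mathfrak T:\ \mathbb P_{P_0,\infty}(\tau<\infty)\le\alpha}\ \min\Big\{r\in\mathbb N:\inf_{T\in I_N(\kappa)}\mathbb P_{P_0,T,P_1}\{T<\tau\le T+r\}\ge1-\delta\Big\},$$ with $\min\varnothing=\infty$. Conformal restart rules with score $s^*$: put $Z_i:=s^*(X_i)$, $p_t:=\frac1t\big(\sum_{i\le t}\mathbf 1\{Z_i<Z_t\}+\lambda_t\sum_{i\le t}\mathbf 1\{Z_i=Z_t\}\big)$. $\mathcal F=\{f_\theta:\theta\in\Theta\}$ is a jointly measurable family of probability densities on $[0,1]$, $\Pi$ a probability measure on $\Theta$; $M_{k,t}:=\int_\Theta\prod_{j=k}^tf_\theta(p_j)\,d\Pi(\theta)$;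 $\tau_{S,w}(b):=\inf\{t\ge1:\sum_{k=1}^tw_kM_{k,t}\ge b\}$, $\tau_{Z,w}(b):=\inf\{t\ge1:\max_{1\le k\le t}w_kM_{k,t}\ge b\}$, $\inf\varnothing=\infty$. *)

theory Defs
  imports "HOL-Probability.Probability"
begin

section \<open>The change-point model\<close>

text \<open>Lebesgue measure on the measurable space \<open>[0,1]\<close> itself (not on the whole real line), so that
  coordinates with this law lie in \<open>[0,1]\<close> at every point and not just almost surely. It is the law
  of the randomizers (\<open>U(0,1)\<close>, the end points being null) and the reference measure for densities.\<close>

definition unif01 :: "real measure" where
  "unif01 = restrict_space lborel {0..1}"

text \<open>Canonical space: an outcome is a pair \<open>(x, l)\<close> of sequences indexed by \<open>1, 2, \<dots>\<close>, with
  \<open>X\<^sub>i = x i\<close> and \<open>\<lambda>\<^sub>i = l i\<close>. The law with change point \<open>T\<close>; \<open>T = \<infinity>\<close> means no change. When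
  \<open>P0\<close> and \<open>P1\<close> have the same measurable sets, so do all the laws, whatever \<open>T\<close> is.\<close>

type_synonym 'a outcome = "(nat \<Rightarrow> 'a) \<times> (nat \<Rightarrow> real)"

definition cp_law :: "'a measure \<Rightarrow> 'a measure \<Rightarrow> enat \<Rightarrow> 'a outcome measure" where
  "cp_law P0 P1 T =
     (\<Pi>\<^sub>M i\<in>{1..}. if enat i \<le> T then P0 else P1) \<Otimes>\<^sub>M (\<Pi>\<^sub>M i\<in>{1..}. unif01)"

definition outcomes :: "'a measure \<Rightarrow> 'a outcome set" where
  "outcomes P0 = space ((\<Pi>\<^sub>M i\<in>{1::nat..}. P0) \<Otimes>\<^sub>M (\<Pi>\<^sub>M i\<in>{1::nat..}. unif01))"

text \<open>The filtrations are indexed by \<^typ>\<open>enat\<close> because the library requires a stopping time to have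
  the type of the index; the condition at index \<open>\<infinity>\<close> is void.\<close>

definition obs_events :: "'a measure \<Rightarrow> enat \<Rightarrow> 'a outcome set set" where
  "obs_events P0 t =
     {{\<omega> \<in> outcomes P0. fst \<omega> i \<in> A} | i A. 1 \<le> i \<and> enat i \<le> t \<and> A \<in> sets P0}"

definition rnd_events :: "'a measure \<Rightarrow> enat \<Rightarrow> 'a outcome set set" where
  "rnd_events P0 t =
     {{\<omega> \<in> outcomes P0. snd \<omega> i \<in> B} | i B. 1 \<le> i \<and> enat i \<le> t \<and> B \<in> sets unif01}"

definition raw_filtration :: "'a measure \<Rightarrow> enat \<Rightarrow> 'a outcome measure" where
  "raw_filtration P0 t = sigma (outcomes P0) (obs_events P0 t)"

definition rand_filtration :: "'a measure \<Rightarrow> enat \<Rightarrow> 'a outcome measure" where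
  "rand_filtration P0 t = sigma (outcomes P0) (obs_events P0 t \<union> rnd_events P0 t)"

definition raw_times :: "'a measure \<Rightarrow> ('a outcome \<Rightarrow> enat) set" where
  "raw_times P0 = {\<tau>. stopping_time (raw_filtration P0) \<tau>}"

definition rand_times :: "'a measure \<Rightarrow> ('a outcome \<Rightarrow> enat) set" where
  "rand_times P0 = {\<tau>. stopping_time (rand_filtration P0) \<tau>}"

section \<open>Detection delay\<close>

definition cp_window :: "real \<Rightarrow> nat \<Rightarrow> nat set" where
  "cp_window \<kappa> N = {nat \<lceil>\<kappa> * real N\<rceil>..N}"

definition false_alarm :: "'a measure \<Rightarrow> 'a measure \<Rightarrow> ('a outcome \<Rightarrow> enat) \<Rightarrow> real" where
  "false_alarm P0 P1 \<tau> = \<P>(\<omega> in cp_law P0 P1 \<infinity>. \<tau> \<omega> < \<infinity>)"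

text \<open>In \<^typ>\<open>enat\<close> the infimum of a nonempty set is its minimum, and that of the empty set is \<open>\<infinity>\<close>.\<close>

definition detection_delay ::
  "'a measure \<Rightarrow> 'a measure \<Rightarrow> real \<Rightarrow> real \<Rightarrow> nat \<Rightarrow> ('a outcome \<Rightarrow> enat) \<Rightarrow> enat" where
  "detection_delay P0 P1 \<delta> \<kappa> N \<tau> =
     Inf {enat r | r. (INF T\<in>cp_window \<kappa> N.
            \<P>(\<omega> in cp_law P0 P1 (enat T). enat T < \<tau> \<omega> \<and> \<tau> \<omega> \<le> enat (T + r))) \<ge> 1 - \<delta>}"

definition optimal_delay ::
  "'a measure \<Rightarrow> 'a measure \<Rightarrow> ('a outcome \<Rightarrow> enat) set \<Rightarrow> real \<Rightarrow> real \<Rightarrow> real \<Rightarrow> nat \<Rightarrow> enat" where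
  "optimal_delay P0 P1 \<TT> \<alpha> \<delta> \<kappa> N =
     (INF \<tau>\<in>{\<tau>\<in>\<TT>. false_alarm P0 P1 \<tau> \<le> \<alpha>}. detection_delay P0 P1 \<delta> \<kappa> N \<tau>)"

section \<open>Conformal restart rules\<close>

definition conformal_p :: "('a \<Rightarrow> real) \<Rightarrow> 'a outcome \<Rightarrow> nat \<Rightarrow> real" where
  "conformal_p s \<omega> t =
     (real (card {i\<in>{1..t}. s (fst \<omega> i) < s (fst \<omega> t)})
      + snd \<omega> t * real (card {i\<in>{1..t}. s (fst \<omega> i) = s (fst \<omega> t)})) / real t"

text \<open>The parameter set \<open>\<Theta>\<close> is the underlying space of the mixing probability measure \<open>\<mu>\<close>.\<close>

definition betting_pair :: "('b \<Rightarrow> real \<Rightarrow> real) \<Rightarrow> 'b measure \<Rightarrow> bool" where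
  "betting_pair f \<mu> \<longleftrightarrow>
     prob_space \<mu> \<and>
     (\<lambda>(\<theta>, z). f \<theta> z) \<in> borel_measurable (\<mu> \<Otimes>\<^sub>M unif01) \<and>
     (\<forall>\<theta>\<in>space \<mu>. (\<forall>z\<in>{0..1}. 0 \<le> f \<theta> z) \<and> (\<integral>\<^sup>+z. ennreal (f \<theta> z) \<partial>unif01) = 1)"

definition mixture :: "('b \<Rightarrow> real \<Rightarrow> real) \<Rightarrow> 'b measure \<Rightarrow> nat set \<Rightarrow> (nat \<Rightarrow> real) \<Rightarrow> ennreal" where
  "mixture f \<mu> J z = (\<integral>\<^sup>+\<theta>. ennreal (\<Prod>j\<in>J. f \<theta> (z j)) \<partial>\<mu>)"

definition restart_mart ::
  "('a \<Rightarrow> real) \<Rightarrow> ('b \<Rightarrow> real \<Rightarrow> real) \<Rightarrow> 'b measure \<Rightarrow> nat \<Rightarrow> nat \<Rightarrow> 'a outcome \<Rightarrow> ennreal" where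
  "restart_mart s f \<mu> k t \<omega> = mixture f \<mu> {k..t} (conformal_p s \<omega>)"

definition restart_sum ::
  "('a \<Rightarrow> real) \<Rightarrow> ('b \<Rightarrow> real \<Rightarrow> real) \<Rightarrow> 'b measure \<Rightarrow> (nat \<Rightarrow> real) \<Rightarrow> real \<Rightarrow> 'a outcome \<Rightarrow> enat" where
  "restart_sum s f \<mu> w b \<omega> =
     Inf {enat t | t. 1 \<le> t \<and> (\<Sum>k=1..t. ennreal (w k) * restart_mart s f \<mu> k t \<omega>) \<ge> ennreal b}"

definition restart_max ::
  "('a \<Rightarrow> real) \<Rightarrow> ('b \<Rightarrow> real \<Rightarrow> real) \<Rightarrow> 'b measure \<Rightarrow> (nat \<Rightarrow> real) \<Rightarrow> real \<Rightarrow> 'a outcome \<Rightarrow> enat" where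
  "restart_max s f \<mu> w b \<omega> =
     Inf {enat t | t. 1 \<le> t \<and> (MAX k\<in>{1..t}. ennreal (w k) * restart_mart s f \<mu> k t \<omega>) \<ge> ennreal b}"

definition nh_const :: real where
  "nh_const = inverse (\<Sum>l. inverse (real (Suc l) * (ln (exp 1 + real (Suc l)))\<^sup>2))"

definition nh_weight :: "nat \<Rightarrow> real" where
  "nh_weight k = nh_const * inverse (real k * (ln (exp 1 + real k))\<^sup>2)"

section \<open>Divergence and local KL support\<close>

text \<open>\<open>D\<^sub>K\<^sub>L(Q \<parallel> P)\<close> is \<open>KL_divergence (exp 1) P Q\<close> (the reference measure comes first). The library
  value is a Bochner integral, which is \<open>0\<close> when the integrand is not integrable, so finiteness of the
  divergence has to be required separately.\<close>

definition KL_pos_finite :: "'a measure \<Rightarrow> 'a measure \<Rightarrow> bool" where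
  "KL_pos_finite P Q \<longleftrightarrow>
     absolutely_continuous P Q \<and> integrable Q (entropy_density (exp 1) P Q) \<and>
     0 < KL_divergence (exp 1) P Q"

text \<open>Logarithm with \<open>log 0 = -\<infinity>\<close> and \<open>log \<infinity> = \<infinity>\<close>; a mixture may take both values.\<close>

definition elog :: "ennreal \<Rightarrow> ereal" where
  "elog x = (if x = 0 then -\<infinity> else if x = \<infinity> then \<infinity> else ereal (ln (enn2real x)))"

definition score_law :: "'a measure \<Rightarrow> 'a measure \<Rightarrow> ('a \<Rightarrow> real) \<Rightarrow> real measure" where
  "score_law P0 P1 s = distr P1 unif01 (\<lambda>x. cdf (distr P0 borel s) (s x))"

definition local_KL_support ::
  "('b \<Rightarrow> real \<Rightarrow> real) \<Rightarrow> 'b measure \<Rightarrow> real measure \<Rightarrow> (real \<Rightarrow> real) \<Rightarrow> bool" where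
  "local_KL_support f \<mu> H h \<longleftrightarrow>
     KL_pos_finite unif01 H \<and>
     h \<in> borel_measurable unif01 \<and> (\<forall>z\<in>{0..1}. 0 < h z) \<and> H = density unif01 (\<lambda>z. ennreal (h z)) \<and>
     bounded ((\<lambda>z. ln (h z)) ` {0..1}) \<and> (\<exists>C. C-lipschitz_on {0..1} (\<lambda>z. ln (h z))) \<and>
     (\<exists>a\<ge>0. \<exists>c0\<ge>0. \<forall>r\<ge>1. \<forall>z. (\<forall>i\<in>{1..r}. z i \<in> {0..1}) \<longrightarrow>
        elog (mixture f \<mu> {1..r} z) \<ge> ereal ((\<Sum>i=1..r. ln (h (z i))) - a * ln (real r) - c0))"

end

theory Submission
  imports Defs "HOL-Real_Asymp.Real_Asymp" "HOL-Combinatorics.Transposition"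
begin

text \<open>Lower bound: if a rule detects with probability \<open>1 - \<delta>\<close> within \<open>r < log N / D\<close> steps of every
  change point in the window, then changing measure to the no-change law costs at most a factor
  \<open>exp (r (D + \<eta>)) = o(N / log N)\<close> by the weak law for the log-likelihood ratio. But the window holds
  about \<open>N / log N\<close> disjoint intervals of length \<open>r\<close>, on which the false alarm probabilities sum to at most
  \<open>1\<close>.

  Upper bound: without a change the p-values are independent and uniform, by exchangeability, and Ville's
  inequality controls the false alarms. After a change at \<open>T\<close>, the p-value of an observation \<open>x\<close>
  is \<open>F (L x)\<close> up to an error of order \<open>1 / sqrt T + r / T\<close>, and \<open>h (F (L x)) = L x\<close> almost surely
  because the likelihood ratio is sufficient. So the factor restarted at \<open>T + 1\<close> grows like \<open>exp (D r)\<close>, and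
  has to overcome the weight, which is \<open>N\<close> to the power \<open>- 1 + o(1)\<close>.\<close>

section \<open>Product measures and the weak law\<close>

text \<open>Nothing beyond integrability of \<open>ln L\<close> under \<open>P1\<close> is
  available, so the weak law must do without a variance; it also has to be uniform in the change
  point, and its sample size depends only on \<open>P1\<close> and the tolerances. After the change
  the p-values are dependent: they share the pre-change sample, and post-change observations enter
  each other's ranks. No concentration inequality for them is needed. Because \<open>ln h\<close> is
  Lipschitz, replacing each p-value by \<open>F (L x)\<close> changes the logarithm of the restarted
  factor by at most a constant times the sum of the errors, and Markov's inequality controls that
  sum: the score of an observation at t > T is independent of the T pre-change scores, and at a
  fixed threshold the rank counts are sums of iid indicators. As T is at least \<kappa> N and r is
  of order log N, the total error is o(r), negligible against D r. The failure probability \<delta>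
  is split into \<beta> for alarms up to the change, which have the same probability as without a
  change, and \<delta> - \<beta> for late detection.\<close>

lemma measurable_coordinate:
  assumes "i \<in> I" "g \<in> M i \<rightarrow>\<^sub>M N"
  shows "(\<lambda>x. g (x i)) \<in> PiM I M \<rightarrow>\<^sub>M N"
  by (rule measurable_compose[where N="M i"]) (use assms in auto)

text \<open>The integrand sees only the finitely many coordinates in \<open>J\<close>. Restriction
  to \<open>J\<close> pushes the possibly infinite product forward to a finite one, where Fubini
  splits the integral.\<close>

lemma (in product_prob_space) nn_integral_PiM_prod:
  assumes J: "finite J" "J \<subseteq> I" and f: "\<And>i. i \<in> J \<Longrightarrow> f i \<in> borel_measurable (M i)"
  shows "(\<integral>\<^sup>+x. (\<Prod>i\<in>J. f i (x i)) \<partial>PiM I M) = (\<Prod>i\<in>J. \<integral>\<^sup>+x. f i x \<partial>M i)"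
proof -
  have meas: "(\<lambda>x. \<Prod>i\<in>J. f i (x i)) \<in> borel_measurable (PiM J M)"
    by (intro borel_measurable_prod_ennreal)
       (metis f measurable_compose measurable_component_singleton)
  have "(\<integral>\<^sup>+x. (\<Prod>i\<in>J. f i (x i)) \<partial>PiM I M)
      = (\<integral>\<^sup>+x. (\<Prod>i\<in>J. f i (x i)) \<partial>distr (PiM I M) (PiM J M) (\<lambda>x. restrict x J))"
    using J meas by (subst nn_integral_distr) (auto intro!: nn_integral_cong measurable_restrict_subset)
  also have "\<dots> = (\<integral>\<^sup>+x. (\<Prod>i\<in>J. f i (x i)) \<partial>PiM J M)"
    using J by (simp add: distr_PiM_restrict_finite)
  also have "\<dots> = (\<Prod>i\<in>J. \<integral>\<^sup>+x. f i x \<partial>M i)"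
    using J f by (intro product_nn_integral_prod) auto
  finally show ?thesis .
qed

lemma (in product_prob_space) indep_vars_coordinates:
  assumes J: "J \<subseteq> I" and g: "\<And>i. i \<in> J \<Longrightarrow> g i \<in> borel_measurable (M i)"
  shows "P.indep_vars (\<lambda>_. borel) (\<lambda>i x. g i (x i)) J"
proof (cases "J = {}")
  case True
  then show ?thesis by (simp add: P.indep_vars_def P.indep_sets_def)
next
  case False
  have "P.indep_vars M (\<lambda>i x. x i) J"
  proof (subst P.indep_vars_iff_distr_eq_PiM'[OF False])
    show "(\<lambda>x. x i) \<in> PiM I M \<rightarrow>\<^sub>M M i" if "i \<in> J" for i
      using that J by auto
    have "distr (PiM I M) (PiM J M) (\<lambda>x. \<lambda>i\<in>J. x i) = PiM J M"
      using distr_PiM_reindex[of I M "\<lambda>i. i" J] J prob_space by auto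
    also have "\<dots> = PiM J (\<lambda>i. distr (PiM I M) (M i) (\<lambda>x. x i))"
      using J by (intro PiM_cong refl) (auto simp: PiM_component)
    finally show "distr (PiM I M) (PiM J M) (\<lambda>x. \<lambda>i\<in>J. x i) = PiM J (\<lambda>i. distr (PiM I M) (M i) (\<lambda>x. x i))" .
  qed
  from P.indep_vars_compose2[OF this g] show ?thesis by simp
qed

text \<open>Variances add: after centring, the cross terms vanish by independence, and each diagonal
  term is at most the raw second moment. Only the mean and the bound of \<open>g\<close> tie the
  factors together, so the lemma applies inside products that mix \<open>P0\<close> and
  \<open>P1\<close>.\<close>

lemma (in product_prob_space) second_moment_sum_le:
  fixes g :: "'a \<Rightarrow> real" and B m :: real
  assumes J: "finite J" "J \<subseteq> I" and g: "\<And>i. i \<in> J \<Longrightarrow> g \<in> borel_measurable (M i)"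
    and B: "\<And>i x. i \<in> J \<Longrightarrow> x \<in> space (M i) \<Longrightarrow> \<bar>g x\<bar> \<le> B"
    and m: "\<And>i. i \<in> J \<Longrightarrow> (\<integral>x. g x \<partial>M i) = m"
  shows "integrable (PiM I M) (\<lambda>x. ((\<Sum>i\<in>J. g (x i)) - card J * m)\<^sup>2)"
    and "(\<integral>x. ((\<Sum>i\<in>J. g (x i)) - card J * m)\<^sup>2 \<partial>PiM I M) \<le> card J * B\<^sup>2"
proof -
  define Y where "Y i x = g (x i) - m" for i and x :: "'i \<Rightarrow> 'a"
  have sp: "x i \<in> space (M i)" if "x \<in> space (PiM I M)" "i \<in> J" for x i
    using that J by (auto simp: space_PiM)
  have gm[measurable]: "(\<lambda>x. g (x i)) \<in> borel_measurable (PiM I M)" if "i \<in> J" for i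
    proof (rule measurable_compose[where N="M i"])
    show "(\<lambda>x. x i) \<in> PiM I M \<rightarrow>\<^sub>M M i" using that J by auto
  qed (rule g[OF that])
  have Ym: "Y i \<in> borel_measurable (PiM I M)" if "i \<in> J" for i
    using that unfolding Y_def by measurable
  have gint: "integrable (M i) g" if "i \<in> J" for i
    using that B g by (intro M.integrable_const_bound[where B=B]) auto
  have Yb: "\<bar>Y i x\<bar> \<le> B + \<bar>m\<bar>" if "x \<in> space (PiM I M)" "i \<in> J" for x i
    using B[OF that(2) sp[OF that]] unfolding Y_def by linarith
  have YY: "integrable (PiM I M) (\<lambda>x. Y i x * Y j x)" if "i \<in> J" "j \<in> J" for i j
  proof (rule P.integrable_const_bound[where B="(B + \<bar>m\<bar>) * (B + \<bar>m\<bar>)"])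
    show "AE x in PiM I M. norm (Y i x * Y j x) \<le> (B + \<bar>m\<bar>) * (B + \<bar>m\<bar>)"
    proof (intro AE_I2)
      fix x assume x: "x \<in> space (PiM I M)"
      have "\<bar>Y i x\<bar> * \<bar>Y j x\<bar> \<le> (B + \<bar>m\<bar>) * (B + \<bar>m\<bar>)"
        using Yb[OF x that(1)] Yb[OF x that(2)] by (intro mult_mono) auto
      then show "norm (Y i x * Y j x) \<le> (B + \<bar>m\<bar>) * (B + \<bar>m\<bar>)" by (simp add: abs_mult)
    qed
    show "(\<lambda>x. Y i x * Y j x) \<in> borel_measurable (PiM I M)"
      using Ym that by (intro borel_measurable_times) auto
  qed
  have gcoord: "(\<integral>x. k (x i) \<partial>PiM I M) = (\<integral>x. k x \<partial>M i)"
    if "i \<in> J" "k \<in> borel_measurable (M i)" for i and k :: "'a \<Rightarrow> real"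
  proof -
    have "(\<integral>x. k x \<partial>distr (PiM I M) (M i) (\<lambda>x. x i)) = (\<integral>x. k (x i) \<partial>PiM I M)"
      using J that by (intro integral_distr) auto
    then show ?thesis using PiM_component[of i] J that(1) by auto
  qed
  have cross: "(\<integral>x. Y i x * Y j x \<partial>PiM I M) = 0" if ij: "i \<in> J" "j \<in> J" "i \<noteq> j" for i j
  proof -
    have "P.indep_vars (\<lambda>_. borel) (\<lambda>i x. g (x i) - m) J"
      using g J by (intro indep_vars_coordinates) auto
    then have "P.indep_vars (\<lambda>_. borel) Y {i, j}"
      unfolding Y_def using P.indep_vars_subset[of _ _ J "{i,j}"] ij by auto
    moreover have "integrable (PiM I M) (Y k)" if "k \<in> J" for k
      using Yb Ym that by (intro P.integrable_const_bound[where B="B + \<bar>m\<bar>"]) auto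
    ultimately have "(\<integral>x. (\<Prod>k\<in>{i,j}. Y k x) \<partial>PiM I M) = (\<Prod>k\<in>{i,j}. \<integral>x. Y k x \<partial>PiM I M)"
      using ij by (intro P.indep_vars_lebesgue_integral) auto
    moreover have "(\<integral>x. Y i x \<partial>PiM I M) = 0"
      using gcoord[of i "\<lambda>x. g x - m"] ij g gint m unfolding Y_def by (simp add: M.prob_space)
    ultimately show ?thesis using ij by simp
  qed
  have diag: "(\<integral>x. Y i x * Y i x \<partial>PiM I M) \<le> B\<^sup>2" if "i \<in> J" for i
  proof -
    have sq: "(g x)\<^sup>2 \<le> B\<^sup>2" if "x \<in> space (M i)" for x
      using B[OF \<open>i \<in> J\<close> that] abs_le_square_iff[of "g x" B] by linarith
    have g2: "integrable (M i) (\<lambda>x. (g x)\<^sup>2)"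
      using sq g[OF that] by (intro M.integrable_const_bound[where B="B\<^sup>2"]) auto
    have "(\<integral>x. Y i x * Y i x \<partial>PiM I M) = (\<integral>x. (g x - m)\<^sup>2 \<partial>M i)"
      using gcoord[OF that, of "\<lambda>x. (g x - m)\<^sup>2"] g[OF that] unfolding Y_def by (simp add: power2_eq_square)
    also have "\<dots> = (\<integral>x. (g x)\<^sup>2 \<partial>M i) - m\<^sup>2"
      using M.variance_eq[OF gint[OF that] g2] m[OF that] by simp
    also have "\<dots> \<le> (\<integral>x. (g x)\<^sup>2 \<partial>M i)" by simp
    also have "\<dots> \<le> (\<integral>x. B\<^sup>2 \<partial>M i)"
      using g2 sq by (intro integral_mono) auto
    finally show ?thesis by (simp add: M.prob_space)
  qed
  have eq: "(\<lambda>x. ((\<Sum>i\<in>J. g (x i)) - card J * m)\<^sup>2) = (\<lambda>x. \<Sum>i\<in>J. \<Sum>j\<in>J. Y i x * Y j x)"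
    unfolding Y_def by (simp add: power2_eq_square sum_product[symmetric] sum_subtractf)
  show "integrable (PiM I M) (\<lambda>x. ((\<Sum>i\<in>J. g (x i)) - card J * m)\<^sup>2)"
    unfolding eq using YY by auto
  have "(\<integral>x. (\<Sum>i\<in>J. \<Sum>j\<in>J. Y i x * Y j x) \<partial>PiM I M) = (\<Sum>i\<in>J. \<Sum>j\<in>J. \<integral>x. Y i x * Y j x \<partial>PiM I M)"
    using YY by simp
  also have "\<dots> \<le> (\<Sum>i\<in>J. \<Sum>j\<in>J. if i = j then B\<^sup>2 else 0)"
    using cross diag by (intro sum_mono) auto
  also have "\<dots> = card J * B\<^sup>2" using J by simp
  finally show "(\<integral>x. ((\<Sum>i\<in>J. g (x i)) - card J * m)\<^sup>2 \<partial>PiM I M) \<le> card J * B\<^sup>2"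
    unfolding eq .
qed

text \<open>Fubini for one coordinate against all others, in both orders. The first form integrates
  a new p-value out of the mixture martingale; the second freezes one observation as a threshold and
  averages over the rest.\<close>

lemma nn_integral_PiM_update:
  assumes M: "\<And>i. prob_space (M i)" and n: "n \<in> I" and F: "F \<in> borel_measurable (PiM I M)"
  shows "(\<integral>\<^sup>+x. F x \<partial>PiM I M) = (\<integral>\<^sup>+X. \<integral>\<^sup>+v. F (X(n := v)) \<partial>M n \<partial>PiM (I - {n}) M)"
    and "(\<integral>\<^sup>+x. F x \<partial>PiM I M) = (\<integral>\<^sup>+v. \<integral>\<^sup>+X. F (X(n := v)) \<partial>PiM (I - {n}) M \<partial>M n)"
proof -
  let ?R = "PiM (I - {n}) M"
  interpret R: prob_space ?R by (intro prob_space_PiM M)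
  interpret u: prob_space "M n" by (rule M)
  interpret pair_sigma_finite "M n" ?R ..
  have ins: "insert n (I - {n}) = I" using n by auto
  have d: "distr (M n \<Otimes>\<^sub>M ?R) (PiM I M) (\<lambda>(x, X). X(n := x)) = PiM I M"
    using distr_pair_PiM_eq_PiM[of "I - {n}" M n] M unfolding ins by simp
  have m: "(\<lambda>(x, X). X(n := x)) \<in> M n \<Otimes>\<^sub>M ?R \<rightarrow>\<^sub>M PiM I M"
  proof -
    have "(\<lambda>y. case (case y of (x, X) \<Rightarrow> (X, x)) of (X, x) \<Rightarrow> X(n := x)) \<in> M n \<Otimes>\<^sub>M ?R \<rightarrow>\<^sub>M PiM (insert n (I - {n})) M"
      by (rule measurable_compose[OF measurable_pair_swap' measurable_add_dim])
    then show ?thesis unfolding ins by (simp only: case_prod_beta' fst_conv snd_conv)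
  qed
  have "(\<integral>\<^sup>+x. F x \<partial>PiM I M) = (\<integral>\<^sup>+x. F x \<partial>distr (M n \<Otimes>\<^sub>M ?R) (PiM I M) (\<lambda>(x, X). X(n := x)))"
    unfolding d ..
  also have "\<dots> = (\<integral>\<^sup>+y. F (case y of (x, X) \<Rightarrow> X(n := x)) \<partial>(M n \<Otimes>\<^sub>M ?R))"
    using F by (intro nn_integral_distr m) auto
  finally have eq: "(\<integral>\<^sup>+x. F x \<partial>PiM I M) = (\<integral>\<^sup>+y. F (case y of (x, X) \<Rightarrow> X(n := x)) \<partial>(M n \<Otimes>\<^sub>M ?R))" .
  show "(\<integral>\<^sup>+x. F x \<partial>PiM I M) = (\<integral>\<^sup>+X. \<integral>\<^sup>+v. F (X(n := v)) \<partial>M n \<partial>?R)"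
    unfolding eq using nn_integral_snd[OF measurable_compose[OF m F]] by simp
  show "(\<integral>\<^sup>+x. F x \<partial>PiM I M) = (\<integral>\<^sup>+v. \<integral>\<^sup>+X. F (X(n := v)) \<partial>?R \<partial>M n)"
    unfolding eq using R.nn_integral_fst[OF measurable_compose[OF m F]] by simp
qed

lemma prob_ge_le_second_moment:
  fixes f :: "'a \<Rightarrow> real" and a v :: real
  assumes M: "prob_space M" and f: "f \<in> borel_measurable M" "integrable M (\<lambda>x. (f x)\<^sup>2)"
    and v: "(\<integral>x. (f x)\<^sup>2 \<partial>M) \<le> v" and a: "0 < a"
  shows "measure M {x\<in>space M. a \<le> f x} \<le> v / a\<^sup>2"
proof -
  interpret prob_space M by fact
  have "measure M {x\<in>space M. a \<le> f x} \<le> measure M {x\<in>space M. a\<^sup>2 \<le> (f x)\<^sup>2}"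
    using f a by (intro finite_measure_mono) (auto intro!: power_mono)
  also have "\<dots> \<le> (\<integral>x. (f x)\<^sup>2 \<partial>M) / a\<^sup>2"
    using f a by (intro integral_Markov_inequality_measure[where A="{}"]) auto
  also have "\<dots> \<le> v / a\<^sup>2" using v a by (intro divide_right_mono) auto
  finally show ?thesis .
qed

text \<open>Weak law without second moments: clip at level \<open>K\<close>, apply Chebyshev's inequality to the
  clipped variables and Markov's inequality to the remainder.\<close>

lemma weak_law_upper_tail:
  fixes X :: "'a \<Rightarrow> real" and m \<eta> \<epsilon> :: real
  assumes Q: "prob_space Q" and X: "integrable Q X" and m: "(\<integral>x. X x \<partial>Q) = m"
    and \<eta>: "0 < \<eta>" and \<epsilon>: "0 < \<epsilon>"
  obtains n0 :: nat where "0 < n0"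
    and "\<And>(M :: 'i \<Rightarrow> 'a measure) I J. product_prob_space M \<Longrightarrow> finite J \<Longrightarrow> J \<subseteq> I \<Longrightarrow> (\<And>i. i \<in> J \<Longrightarrow> M i = Q) \<Longrightarrow>
      n0 \<le> card J \<Longrightarrow>
      measure (PiM I M) {x\<in>space (PiM I M). card J * (m + \<eta>) \<le> (\<Sum>i\<in>J. X (x i))} \<le> \<epsilon>"
proof -
  interpret Q: prob_space Q by fact
  define clip where "clip K x = max (- real K) (min (real K) (X x))" for K :: nat and x
  have Xm[measurable]: "X \<in> borel_measurable Q" using X by auto
  have clipm[measurable]: "clip K \<in> borel_measurable Q" for K unfolding clip_def by measurable
  let ?d = "\<lambda>K. \<integral>x. \<bar>X x - clip K x\<bar> \<partial>Q"
  have "?d \<longlonglongrightarrow> (\<integral>x. 0 \<partial>Q)"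
  proof (rule integral_dominated_convergence[where w="\<lambda>x. \<bar>X x\<bar>"])
    show "AE x in Q. (\<lambda>K. \<bar>X x - clip K x\<bar>) \<longlonglongrightarrow> 0"
    proof (intro AE_I2 tendsto_eventually)
      fix x
      obtain K0 :: nat where "\<bar>X x\<bar> \<le> K0" using real_arch_simple by blast
      then show "\<forall>\<^sub>F K in sequentially. \<bar>X x - clip K x\<bar> = 0"
        by (intro eventually_sequentiallyI[of K0]) (auto simp: clip_def)
    qed
    show "AE x in Q. norm \<bar>X x - clip K x\<bar> \<le> \<bar>X x\<bar>" for K
      by (intro AE_I2) (auto simp: clip_def)
  qed (use X in auto)
  then have "\<forall>\<^sub>F K in sequentially. ?d K < \<epsilon> * \<eta> / 8 \<and> ?d K < \<eta> / 4"
    using \<eta> \<epsilon> by (intro eventually_conj order_tendstoD(2)) auto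
  \<comment> \<open>One clipping level serves two purposes: the bound \<open>\<eta> / 4\<close>
    limits the shift of the mean, and \<open>\<epsilon> * \<eta> / 8\<close> is half of \<epsilon>
    times the Markov level \<open>\<eta> / 4\<close> for the remainder. Clipped deviation, remainder
    and shift together use three quarters of \<eta>.\<close>
  then obtain K where K: "?d K < \<epsilon> * \<eta> / 8" "?d K < \<eta> / 4"
    by (auto simp: eventually_sequentially)
  have clip_abs: "\<bar>clip K x\<bar> \<le> K" for x unfolding clip_def by auto
  have clip_int: "integrable Q (clip K)"
    using clip_abs by (intro Q.integrable_const_bound[where B="real K"]) auto
  define m' where "m' = (\<integral>x. clip K x \<partial>Q)"
  have m': "m' \<le> m + \<eta> / 4"
  proof -
    have "m' - m = (\<integral>x. clip K x - X x \<partial>Q)" using clip_int X m unfolding m'_def by simp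
    also have "\<dots> \<le> ?d K"
      using clip_int X by (intro integral_mono) auto
    finally show ?thesis using K(2) by linarith
  qed
  \<comment> \<open>Solves Chebyshev's bound
    \<open>K^2 * 16 / (\<eta>^2 * n) \<le> \<epsilon> / 2\<close> for n. The choice precedes
    \<open>M\<close>, \<open>I\<close> and \<open>J\<close>, which makes the weak law uniform over
    change points.\<close>
  obtain n1 :: nat where n1: "(real K)\<^sup>2 * 16 / \<eta>\<^sup>2 * 2 / \<epsilon> \<le> n1" using real_arch_simple by blast
  define n0 where "n0 = Suc n1"
  show thesis
  proof (rule that[of n0])
    show "0 < n0" by (simp add: n0_def)
    fix M :: "'i \<Rightarrow> 'a measure" and I J
    assume "product_prob_space M" and J: "finite J" "J \<subseteq> I" and MQ: "\<And>i. i \<in> J \<Longrightarrow> M i = Q"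
      and n: "n0 \<le> card J"
    interpret product_prob_space M I by fact
    let ?n = "real (card J)"
    have npos: "0 < ?n" using n by (simp add: n0_def)
    have coord: "(\<lambda>x. k (x i)) \<in> borel_measurable (PiM I M)"
      if "i \<in> J" "k \<in> borel_measurable Q" for i and k :: "'a \<Rightarrow> real"
    proof (rule measurable_compose[where N="M i"])
      show "(\<lambda>x. x i) \<in> PiM I M \<rightarrow>\<^sub>M M i" using that J by auto
      show "k \<in> borel_measurable (M i)" using that MQ by auto
    qed
    have Xcm: "(\<lambda>x. \<Sum>i\<in>J. clip K (x i)) \<in> borel_measurable (PiM I M)"
      "(\<lambda>x. \<Sum>i\<in>J. \<bar>X (x i) - clip K (x i)\<bar>) \<in> borel_measurable (PiM I M)"
      "(\<lambda>x. \<Sum>i\<in>J. X (x i)) \<in> borel_measurable (PiM I M)"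
      by (intro borel_measurable_sum coord borel_measurable_abs borel_measurable_diff Xm clipm; assumption)+
    note [measurable] = Xcm
    define A where "A = {x\<in>space (PiM I M). ?n * \<eta> / 4 \<le> (\<Sum>i\<in>J. clip K (x i)) - ?n * m'}"
    define B where "B = {x\<in>space (PiM I M). ?n * \<eta> / 4 \<le> (\<Sum>i\<in>J. \<bar>X (x i) - clip K (x i)\<bar>)}"
    have Am: "A \<in> sets (PiM I M)" and Bm: "B \<in> sets (PiM I M)"
      unfolding A_def B_def by measurable
    have "P.prob A \<le> (?n * (real K)\<^sup>2) / (?n * \<eta> / 4)\<^sup>2"
      unfolding A_def
    proof (rule prob_ge_le_second_moment)
      show "integrable (PiM I M) (\<lambda>x. ((\<Sum>i\<in>J. clip K (x i)) - ?n * m')\<^sup>2)"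
        using J MQ clip_abs by (intro second_moment_sum_le[where B=K]) (auto simp: m'_def)
      show "(\<integral>x. ((\<Sum>i\<in>J. clip K (x i)) - ?n * m')\<^sup>2 \<partial>PiM I M) \<le> ?n * (real K)\<^sup>2"
        using J MQ clip_abs by (intro second_moment_sum_le[where B=K]) (auto simp: m'_def)
    qed (use npos \<eta> P.prob_space_axioms Xcm in auto)
    also have "\<dots> = ((real K)\<^sup>2 * 16 / \<eta>\<^sup>2 * 2 / \<epsilon>) * \<epsilon> / (2 * ?n)"
      using npos \<eta> \<epsilon> by (simp add: field_simps power2_eq_square)
    also have "\<dots> \<le> ?n * \<epsilon> / (2 * ?n)"
      using n1 n \<epsilon> by (intro divide_right_mono mult_right_mono) (auto simp: n0_def)
    also have "\<dots> = \<epsilon> / 2" using npos by simp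
    finally have PA: "P.prob A \<le> \<epsilon> / 2" .
    have dint: "integrable (PiM I M) (\<lambda>x. \<bar>X (x i) - clip K (x i)\<bar>)"
      and dval: "(\<integral>x. \<bar>X (x i) - clip K (x i)\<bar> \<partial>PiM I M) = ?d K" if i: "i \<in> J" for i
    proof -
      have d: "distr (PiM I M) Q (\<lambda>x. x i) = Q"
        using PiM_component[of i] MQ[OF i] J i by auto
      have meas: "(\<lambda>x. x i) \<in> PiM I M \<rightarrow>\<^sub>M Q"
        using measurable_component_singleton[of i I M] MQ[OF i] J i by auto
      have "integrable Q (\<lambda>x. \<bar>X x - clip K x\<bar>)" using X clip_int by auto
      then show "integrable (PiM I M) (\<lambda>x. \<bar>X (x i) - clip K (x i)\<bar>)"
        using integrable_distr_eq[OF meas, of "\<lambda>x. \<bar>X x - clip K x\<bar>"] unfolding d by simp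
      show "(\<integral>x. \<bar>X (x i) - clip K (x i)\<bar> \<partial>PiM I M) = ?d K"
        using integral_distr[OF meas, of "\<lambda>x. \<bar>X x - clip K x\<bar>"] unfolding d by simp
    qed
    have "P.prob B \<le> (\<integral>x. (\<Sum>i\<in>J. \<bar>X (x i) - clip K (x i)\<bar>) \<partial>PiM I M) / (?n * \<eta> / 4)"
      unfolding B_def using dint npos \<eta>
      by (intro integral_Markov_inequality_measure[where A="{}"]) (auto intro!: sum_nonneg)
    also have "\<dots> = (?n * ?d K) / (?n * \<eta> / 4)"
      using dint dval by simp
    also have "\<dots> \<le> (?n * (\<epsilon> * \<eta> / 8)) / (?n * \<eta> / 4)"
      using K(1) npos \<eta> by (intro divide_right_mono mult_left_mono) auto
    also have "\<dots> = \<epsilon> / 2" using npos \<eta> by simp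
    finally have PB: "P.prob B \<le> \<epsilon> / 2" .
    have "{x\<in>space (PiM I M). ?n * (m + \<eta>) \<le> (\<Sum>i\<in>J. X (x i))} \<subseteq> A \<union> B"
    proof safe
      fix x assume x: "x \<in> space (PiM I M)" "?n * (m + \<eta>) \<le> (\<Sum>i\<in>J. X (x i))" "x \<notin> B"
      have "(\<Sum>i\<in>J. X (x i)) \<le> (\<Sum>i\<in>J. clip K (x i) + \<bar>X (x i) - clip K (x i)\<bar>)"
        by (intro sum_mono) auto
      then have "(\<Sum>i\<in>J. X (x i)) \<le> (\<Sum>i\<in>J. clip K (x i)) + ?n * \<eta> / 4"
        using x unfolding B_def by (auto simp: sum.distrib)
      moreover have "?n * m' \<le> ?n * (m + \<eta> / 4)" using m' npos by (intro mult_left_mono) auto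
      moreover have "0 \<le> ?n * \<eta>" using npos \<eta> by simp
      ultimately show "x \<in> A" using x unfolding A_def by (simp add: ring_distribs)
    qed
    then have "P.prob {x\<in>space (PiM I M). ?n * (m + \<eta>) \<le> (\<Sum>i\<in>J. X (x i))} \<le> P.prob (A \<union> B)"
      using Am Bm by (intro P.finite_measure_mono) auto
    also have "\<dots> \<le> P.prob A + P.prob B" by (intro measure_Un_le Am Bm)
    finally show "P.prob {x\<in>space (PiM I M). ?n * (m + \<eta>) \<le> (\<Sum>i\<in>J. X (x i))} \<le> \<epsilon>"
      using PA PB by linarith
  qed
qed

section \<open>Filtrations and change of measure\<close>

lemma space_unif01 [simp]: "space unif01 = {0..1}"
  by (simp add: unif01_def space_restrict_space)

lemma prob_space_unif01: "prob_space unif01"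
  by (rule prob_spaceI) (simp add: unif01_def emeasure_restrict_space space_restrict_space)

lemma measurable_unif01_borel: "f \<in> borel_measurable borel \<Longrightarrow> f \<in> borel_measurable unif01"
  unfolding unif01_def by (intro measurable_restrict_space1) simp

lemma sets_unif01D: "A \<in> sets unif01 \<Longrightarrow> A \<in> sets borel"
  unfolding unif01_def by (subst (asm) sets_restrict_space_iff) auto

abbreviation unifs :: "(nat \<Rightarrow> real) measure" where
  "unifs \<equiv> \<Pi>\<^sub>M i\<in>{1..}. unif01"

lemma prob_space_unifs: "prob_space unifs"
  by (intro prob_space_PiM prob_space_unif01)

lemma product_prob_space_unif01: "product_prob_space (\<lambda>i::nat. unif01)"
  by (intro product_prob_spaceI prob_space_unif01)

lemma sets_pair_cong: "sets M = sets M' \<Longrightarrow> sets (M \<Otimes>\<^sub>M N) = sets (M' \<Otimes>\<^sub>M N)"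
  by (intro sets_pair_measure_cong) auto

section \<open>Outcome space and filtrations\<close>

locale base_measure =
  fixes P0 :: "'a measure"
  assumes prob_P0: "prob_space P0"
begin

abbreviation PX :: "(nat \<Rightarrow> 'a) measure" where
  "PX \<equiv> PiM {1..} (\<lambda>_. P0)"

abbreviation \<Omega> :: "'a outcome measure" where
  "\<Omega> \<equiv> PX \<Otimes>\<^sub>M unifs"

lemma outcomes_eq: "outcomes P0 = space \<Omega>"
  by (simp add: outcomes_def)

lemma outcome_space: "\<omega> \<in> space \<Omega> \<Longrightarrow> 1 \<le> i \<Longrightarrow> fst \<omega> i \<in> space P0"
  by (auto simp: space_pair_measure space_PiM)

lemma randomizer_space: "\<omega> \<in> space \<Omega> \<Longrightarrow> 1 \<le> i \<Longrightarrow> snd \<omega> i \<in> {0..1}"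
  by (auto simp: space_pair_measure space_PiM dest: PiE_mem[where x=i])

lemma obs_events_Pow: "obs_events P0 t \<subseteq> Pow (outcomes P0)"
  and rnd_events_Pow: "rnd_events P0 t \<subseteq> Pow (outcomes P0)"
  by (auto simp: obs_events_def rnd_events_def)

lemma space_rand_filtration [simp]: "space (rand_filtration P0 t) = space \<Omega>"
  unfolding rand_filtration_def using obs_events_Pow rnd_events_Pow
  by (subst space_measure_of) (auto simp: outcomes_eq)

lemma space_raw_filtration [simp]: "space (raw_filtration P0 t) = space \<Omega>"
  unfolding raw_filtration_def using obs_events_Pow
  by (subst space_measure_of) (auto simp: outcomes_eq)

lemma sets_rand_filtration:
  "sets (rand_filtration P0 t) = sigma_sets (outcomes P0) (obs_events P0 t \<union> rnd_events P0 t)"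
  unfolding rand_filtration_def using obs_events_Pow rnd_events_Pow
  by (subst sets_measure_of) auto

lemma sets_raw_filtration:
  "sets (raw_filtration P0 t) = sigma_sets (outcomes P0) (obs_events P0 t)"
  unfolding raw_filtration_def using obs_events_Pow by (subst sets_measure_of) auto

text \<open>The raw sigma-algebras are contained in the randomized ones, so a lower bound over
  randomized times covers the raw ones.\<close>

lemma raw_times_subset: "raw_times P0 \<subseteq> rand_times P0"
proof -
  have "sets (raw_filtration P0 t) \<subseteq> sets (rand_filtration P0 t)" for t
    unfolding sets_raw_filtration sets_rand_filtration by (intro sigma_sets_mono') auto
  then have "f \<in> rand_filtration P0 t \<rightarrow>\<^sub>M N" if "f \<in> raw_filtration P0 t \<rightarrow>\<^sub>M N" for f N t
    using that unfolding measurable_def by auto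
  then show ?thesis unfolding raw_times_def rand_times_def stopping_time_def by blast
qed

lemma measurable_obs:
  assumes "1 \<le> i" "enat i \<le> t"
  shows "(\<lambda>\<omega>. fst \<omega> i) \<in> rand_filtration P0 t \<rightarrow>\<^sub>M P0"
proof (rule measurableI)
  fix A assume A: "A \<in> sets P0"
  have "(\<lambda>\<omega>. fst \<omega> i) -` A \<inter> space (rand_filtration P0 t) = {\<omega> \<in> outcomes P0. fst \<omega> i \<in> A}"
    by (auto simp: outcomes_eq)
  also have "\<dots> \<in> sets (rand_filtration P0 t)"
    unfolding sets_rand_filtration using A assms
    by (intro sigma_sets.Basic) (auto simp: obs_events_def)
  finally show "(\<lambda>\<omega>. fst \<omega> i) -` A \<inter> space (rand_filtration P0 t) \<in> sets (rand_filtration P0 t)" .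
qed (use assms outcome_space in simp)

lemma measurable_randomizer:
  assumes "1 \<le> i" "enat i \<le> t"
  shows "(\<lambda>\<omega>. snd \<omega> i) \<in> rand_filtration P0 t \<rightarrow>\<^sub>M unif01"
proof (rule measurableI)
  fix A assume A: "A \<in> sets unif01"
  have "(\<lambda>\<omega>. snd \<omega> i) -` A \<inter> space (rand_filtration P0 t) = {\<omega> \<in> outcomes P0. snd \<omega> i \<in> A}"
    by (auto simp: outcomes_eq)
  also have "\<dots> \<in> sets (rand_filtration P0 t)"
    unfolding sets_rand_filtration using A assms
    by (intro sigma_sets.Basic) (auto simp: rnd_events_def)
  finally show "(\<lambda>\<omega>. snd \<omega> i) -` A \<inter> space (rand_filtration P0 t) \<in> sets (rand_filtration P0 t)" .
qed (use assms randomizer_space in simp)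

lemma filtration_generatorE:
  assumes "E \<in> obs_events P0 t \<union> rnd_events P0 t"
  obtains (obs) i A where "1 \<le> i" "enat i \<le> t" "A \<in> sets P0" "E = {\<omega> \<in> space \<Omega>. fst \<omega> i \<in> A}"
    | (rnd) i A where "1 \<le> i" "enat i \<le> t" "A \<in> sets unif01" "E = {\<omega> \<in> space \<Omega>. snd \<omega> i \<in> A}"
  using assms by (auto simp: obs_events_def rnd_events_def outcomes_eq)

lemma rand_filtration_subset: "sets (rand_filtration P0 t) \<subseteq> sets \<Omega>"
proof -
  have "obs_events P0 t \<union> rnd_events P0 t \<subseteq> sets \<Omega>"
  proof
    fix E assume "E \<in> obs_events P0 t \<union> rnd_events P0 t"
    then show "E \<in> sets \<Omega>"
    proof (cases rule: filtration_generatorE)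
      case (obs i A)
      have "(\<lambda>\<omega>. fst \<omega> i) \<in> \<Omega> \<rightarrow>\<^sub>M P0"
        using obs by (intro measurable_compose[OF measurable_fst measurable_component_singleton]) auto
      from measurable_sets[OF this obs(3)] show ?thesis by (simp add: obs(4) vimage_def Int_def conj_commute)
    next
      case (rnd i A)
      have "(\<lambda>\<omega>. snd \<omega> i) \<in> \<Omega> \<rightarrow>\<^sub>M unif01"
        using rnd by (intro measurable_compose[OF measurable_snd measurable_component_singleton]) auto
      from measurable_sets[OF this rnd(3)] show ?thesis by (simp add: rnd(4) vimage_def Int_def conj_commute)
    qed
  qed
  then show ?thesis
    unfolding sets_rand_filtration outcomes_eq by (rule sets.sigma_sets_subset)
qed

text \<open>Events at time n are preimages under the projection \<open>\<pi>\<close> to the first n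
  observations and randomizers; it suffices to check this on generators. The image law under
  \<open>\<pi>\<close> involves only the factors with index up to n.\<close>

lemma law_cong_filtration:
  assumes M: "\<And>i. prob_space (M i)" "\<And>i. sets (M i) = sets P0"
    and M': "\<And>i. prob_space (M' i)" "\<And>i. sets (M' i) = sets P0"
    and eq: "\<And>i. 1 \<le> i \<Longrightarrow> i \<le> n \<Longrightarrow> M i = M' i"
    and E: "E \<in> sets (rand_filtration P0 (enat n))"
  shows "emeasure (PiM {1..} M \<Otimes>\<^sub>M unifs) E = emeasure (PiM {1..} M' \<Otimes>\<^sub>M unifs) E"
proof -
  let ?L = "\<lambda>M :: nat \<Rightarrow> 'a measure. PiM {1..} M \<Otimes>\<^sub>M unifs"
  let ?K = "\<lambda>M :: nat \<Rightarrow> 'a measure. PiM {1..n} M \<Otimes>\<^sub>M PiM {1..n} (\<lambda>_. unif01)"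
  let ?N = "PiM {1..n} (\<lambda>_. P0) \<Otimes>\<^sub>M PiM {1..n} (\<lambda>_. unif01)"
  define \<pi> :: "'a outcome \<Rightarrow> 'a outcome" where "\<pi> = (\<lambda>(x, l). (restrict x {1..n}, restrict l {1..n}))"
  have \<pi>m: "\<pi> \<in> \<Omega> \<rightarrow>\<^sub>M ?N"
    unfolding \<pi>_def by measurable
  have sv: "sets (vimage_algebra (space \<Omega>) \<pi> ?N) = {\<pi> -` B \<inter> space \<Omega> |B. B \<in> sets ?N}"
    using measurable_space[OF \<pi>m] by (intro sets_vimage_algebra2) auto
  have "sets (rand_filtration P0 (enat n)) \<subseteq> sets (vimage_algebra (space \<Omega>) \<pi> ?N)"
    unfolding sets_rand_filtration outcomes_eq
  proof (intro sets.sigma_sets_subset[of _ "vimage_algebra (space \<Omega>) \<pi> ?N", unfolded space_vimage_algebra] subsetI)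
    fix E assume "E \<in> obs_events P0 (enat n) \<union> rnd_events P0 (enat n)"
    then show "E \<in> sets (vimage_algebra (space \<Omega>) \<pi> ?N)"
    proof (cases rule: filtration_generatorE)
      case (obs i A)
      have "(\<lambda>\<omega>. fst \<omega> i) \<in> ?N \<rightarrow>\<^sub>M P0"
        using obs by (intro measurable_compose[OF measurable_fst measurable_component_singleton]) auto
      from measurable_sets[OF this obs(3)]
      have "{y\<in>space ?N. fst y i \<in> A} \<in> sets ?N" by (simp add: vimage_def Int_def conj_commute)
      moreover have "E = \<pi> -` {y\<in>space ?N. fst y i \<in> A} \<inter> space \<Omega>"
        using measurable_space[OF \<pi>m] obs by (auto simp: \<pi>_def split: prod.splits)
      ultimately show ?thesis unfolding sv by blast
    next
      case (rnd i A)
      have "(\<lambda>\<omega>. snd \<omega> i) \<in> ?N \<rightarrow>\<^sub>M unif01"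
        using rnd by (intro measurable_compose[OF measurable_snd measurable_component_singleton]) auto
      from measurable_sets[OF this rnd(3)]
      have "{y\<in>space ?N. snd y i \<in> A} \<in> sets ?N" by (simp add: vimage_def Int_def conj_commute)
      moreover have "E = \<pi> -` {y\<in>space ?N. snd y i \<in> A} \<inter> space \<Omega>"
        using measurable_space[OF \<pi>m] rnd by (auto simp: \<pi>_def split: prod.splits)
      ultimately show ?thesis unfolding sv by blast
    qed
  qed
  with E obtain B where B: "B \<in> sets ?N" "E = \<pi> -` B \<inter> space \<Omega>"
    unfolding sv by blast
  have law: "emeasure (?L M) E = emeasure (?K M) B"
    if M: "\<And>i. prob_space (M i)" "\<And>i. sets (M i) = sets P0" for M
  proof -
    have s: "sets (?L M) = sets \<Omega>"
      using M by (intro sets_pair_cong sets_PiM_cong) auto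
    note sp = sets_eq_imp_space_eq[OF s]
    have sN: "sets (?K M) = sets ?N"
      using M by (intro sets_pair_cong sets_PiM_cong) auto
    have \<pi>m': "\<pi> \<in> ?L M \<rightarrow>\<^sub>M ?K M"
      using \<pi>m measurable_cong_sets[OF s sN] by auto
    have r1: "distr (PiM {1..} M) (PiM {1..n} M) (\<lambda>x. restrict x {1..n}) = PiM {1..n} M"
      using distr_PiM_reindex[of "{1..}" M "\<lambda>i. i" "{1..n}"] M by (auto simp: restrict_def)
    have r2: "distr unifs (PiM {1..n} (\<lambda>_. unif01)) (\<lambda>x. restrict x {1..n}) = PiM {1..n} (\<lambda>_. unif01)"
      using distr_PiM_reindex[of "{1..}" "\<lambda>_. unif01" "\<lambda>i. i" "{1..n}"] prob_space_unif01
      by (auto simp: restrict_def)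
    have sf: "sigma_finite_measure (PiM {1..n} (\<lambda>_. unif01))"
      by (intro prob_space_imp_sigma_finite prob_space_PiM prob_space_unif01)
    have "distr (?L M) (?K M) \<pi>
      = ?K M"
      unfolding \<pi>_def
      using pair_measure_distr[of "\<lambda>x. restrict x {1..n}" "PiM {1..} M" "PiM {1..n} M"
          "\<lambda>x. restrict x {1..n}" unifs "PiM {1..n} (\<lambda>_. unif01)"] sf
      unfolding r1 r2 by (auto intro!: measurable_restrict_subset)
    then have "emeasure (?K M) B
      = emeasure (distr (?L M) (?K M) \<pi>) B"
      by simp
    also have "\<dots> = emeasure (?L M) E"
      using B sN sp by (subst emeasure_distr[OF \<pi>m']) auto
    finally show ?thesis by simp
  qed
  have "PiM {1..n} M = PiM {1..n} M'" using eq by (intro PiM_cong) auto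
  then show ?thesis using law[OF M] law[OF M'] by simp
qed

end

section \<open>Likelihood ratio between the change-point laws\<close>

locale change_point = base_measure P0 for P0 :: "'a measure" +
  fixes P1 :: "'a measure" and L :: "'a \<Rightarrow> real"
  assumes prob_P1: "prob_space P1" and sets_P1: "sets P1 = sets P0"
    and L_meas: "L \<in> borel_measurable P0" and L_nonneg: "\<And>x. x \<in> space P0 \<Longrightarrow> 0 \<le> L x"
    and P1_density: "P1 = density P0 (\<lambda>x. ennreal (L x))"
begin

abbreviation obs_law :: "enat \<Rightarrow> (nat \<Rightarrow> 'a) measure" where
  "obs_law T \<equiv> \<Pi>\<^sub>M i\<in>{1..}. if enat i \<le> T then P0 else P1"

abbreviation law :: "enat \<Rightarrow> 'a outcome measure" where
  "law T \<equiv> cp_law P0 P1 T"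

lemma law_def: "law T = obs_law T \<Otimes>\<^sub>M unifs"
  by (simp add: cp_law_def)

lemma space_P1: "space P1 = space P0"
  by (rule sets_eq_imp_space_eq[OF sets_P1])

lemma sets_obs_law: "sets (obs_law T) = sets PX"
  by (intro sets_PiM_cong) (auto simp: sets_P1)

lemma sets_law: "sets (law T) = sets \<Omega>"
  unfolding law_def by (intro sets_pair_cong sets_obs_law)

lemma space_law: "space (law T) = space \<Omega>"
  by (rule sets_eq_imp_space_eq[OF sets_law])

lemma space_obs_law: "space (obs_law T) = space PX"
  by (rule sets_eq_imp_space_eq[OF sets_obs_law])

lemma product_prob_space_mix: "product_prob_space (\<lambda>i. if enat i \<le> T then P0 else P1)"
  using prob_P0 prob_P1 by (intro product_prob_spaceI) auto

lemma prob_obs_law: "prob_space (obs_law T)"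
  using prob_P0 prob_P1 by (intro prob_space_PiM) auto

lemma pair_prob_law: "pair_prob_space (obs_law T) unifs"
  using prob_obs_law[of T] prob_space_unifs
  by (simp add: pair_prob_space_def pair_sigma_finite_def prob_space_imp_sigma_finite)

lemma prob_law: "prob_space (law T)"
proof -
  interpret pair_prob_space "obs_law T" unifs by (rule pair_prob_law)
  show ?thesis unfolding law_def by (rule P.prob_space_axioms)
qed

lemma law_infinity: "law \<infinity> = \<Omega>"
  unfolding law_def by simp

lemma rand_filtration_law: "E \<in> sets (rand_filtration P0 t) \<Longrightarrow> E \<in> sets (law T)"
  using rand_filtration_subset by (auto simp: sets_law)

text \<open>Measures on the product are determined by finite boxes. On a box over \<open>K\<close>,
  the integral factorizes over \<open>J \<union> K\<close>: a factor of \<open>J\<close> outside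
  \<open>K\<close> integrates \<open>L\<close> to 1, and a factor in both turns into the
  \<open>P1\<close>-measure of the side.\<close>

lemma density_PiM:
  fixes J :: "nat set"
  assumes J: "finite J" "J \<subseteq> {1..}"
  shows "density PX (\<lambda>x. \<Prod>i\<in>J. ennreal (L (x i)))
    = (\<Pi>\<^sub>M i\<in>{1..}. if i \<in> J then P1 else P0)" (is "?l = PiM _ ?M")
proof (rule product_prob_space.PiM_eq)
  show "product_prob_space ?M"
    using prob_P0 prob_P1 by (intro product_prob_spaceI) auto
  show "sets ?l = sets (PiM {1..} ?M)"
    unfolding sets_density by (intro sets_PiM_cong) (auto simp: sets_P1)
  fix K F assume K: "finite K" "K \<subseteq> {1..}" and F: "\<And>j. j \<in> K \<Longrightarrow> F j \<in> sets (?M j)"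
  then have F0: "F j \<in> sets P0" if "j \<in> K" for j
    using F[OF that] sets_P1 by (auto split: if_splits)
  interpret product_prob_space "\<lambda>_. P0" "{1::nat..}"
    using prob_P0 by (intro product_prob_spaceI) auto
  let ?E = "prod_emb {1..} ?M K (Pi\<^sub>E K F)"
  have E: "?E = {x\<in>space PX. \<forall>i\<in>K. x i \<in> F i}"
    using K F0[THEN sets.sets_into_space]
    by (auto simp: prod_emb_def space_PiM PiE_iff space_P1 extensional_def split: if_splits)
  have Es: "?E \<in> sets PX"
  proof -
    have "?E \<in> sets (PiM {1..} ?M)" using K F by (intro sets_PiM_I) auto
    also have "sets (PiM {1..} ?M) = sets PX"
      by (intro sets_PiM_cong) (auto simp: sets_P1)
    finally show ?thesis .
  qed
  have Lm: "(\<lambda>x. \<Prod>i\<in>J. ennreal (L (x i))) \<in> borel_measurable PX"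
    using J L_meas by (intro borel_measurable_prod_ennreal measurable_coordinate[where M="\<lambda>_. P0"]) auto
  define f where "f i x = (if i \<in> J then ennreal (L x) else 1) * (if i \<in> K then indicator (F i) x else 1)" for i :: nat and x
  have "emeasure ?l ?E = (\<integral>\<^sup>+x. (\<Prod>i\<in>J. ennreal (L (x i))) * indicator ?E x \<partial>PX)"
    by (rule emeasure_density[OF Lm Es])
  also have "\<dots> = (\<integral>\<^sup>+x. (\<Prod>i\<in>J \<union> K. f i (x i)) \<partial>PX)"
  proof (rule nn_integral_cong)
    fix x :: "nat \<Rightarrow> 'a" assume x: "x \<in> space PX"
    have "indicator ?E x = (\<Prod>i\<in>K. indicator (F i) (x i) :: ennreal)"
      unfolding E using x K by (auto simp: indicator_def prod_eq_1_iff intro!: prod_zero[symmetric])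
    moreover have "(\<Prod>i\<in>J. ennreal (L (x i))) = (\<Prod>i\<in>J \<union> K. if i \<in> J then ennreal (L (x i)) else 1)"
      using J K by (intro prod.mono_neutral_cong_left) auto
    moreover have "(\<Prod>i\<in>K. indicator (F i) (x i) :: ennreal) = (\<Prod>i\<in>J \<union> K. if i \<in> K then indicator (F i) (x i) else 1)"
      using J K by (intro prod.mono_neutral_cong_left) auto
    ultimately show "(\<Prod>i\<in>J. ennreal (L (x i))) * indicator ?E x = (\<Prod>i\<in>J \<union> K. f i (x i))"
      by (simp add: f_def prod.distrib)
  qed
  also have "\<dots> = (\<Prod>i\<in>J \<union> K. \<integral>\<^sup>+x. f i x \<partial>P0)"
  proof (rule nn_integral_PiM_prod)
    show "f i \<in> borel_measurable P0" if "i \<in> J \<union> K" for i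
      using F0[of i] L_meas unfolding f_def by (cases "i \<in> K") auto
  qed (use J K in auto)
  also have "\<dots> = (\<Prod>i\<in>J \<union> K. if i \<in> K then emeasure (?M i) (F i) else 1)"
  proof (rule prod.cong[OF refl])
    fix i assume "i \<in> J \<union> K"
    have "(\<integral>\<^sup>+x. ennreal (L x) \<partial>P0) = 1"
    proof -
      have "(\<integral>\<^sup>+x. ennreal (L x) \<partial>P0) = emeasure P1 (space P0)"
        unfolding P1_density using L_meas
        by (subst emeasure_density) (auto intro!: nn_integral_cong)
      then show ?thesis using prob_P1 by (simp add: prob_space.emeasure_space_1 flip: space_P1)
    qed
    moreover have "(\<integral>\<^sup>+x. ennreal (L x) * indicator (F i) x \<partial>P0) = emeasure P1 (F i)" if "i \<in> K"
      unfolding P1_density using L_meas F0[OF that] by (subst emeasure_density) auto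
    ultimately show "(\<integral>\<^sup>+x. f i x \<partial>P0) = (if i \<in> K then emeasure (?M i) (F i) else 1)"
      using F0[of i] M.emeasure_space_1 by (auto simp: f_def)
  qed
  also have "\<dots> = (\<Prod>i\<in>K. emeasure (?M i) (F i))"
    using J K by (intro prod.mono_neutral_cong_right) auto
  finally show "emeasure ?l ?E = (\<Prod>i\<in>K. emeasure (?M i) (F i))" .
qed

text \<open>An event at time n cannot distinguish the law with change at T from the law in which
  only the coordinates in \<open>{T<..n}\<close> follow \<open>P1\<close>. The latter modifies
  finitely many coordinates and hence has a product density; the randomizers keep density 1.\<close>

theorem change_of_measure:
  assumes E: "E \<in> sets (rand_filtration P0 (enat n))" and T: "T \<le> n"
  shows "emeasure (law (enat T)) E
    = (\<integral>\<^sup>+\<omega>. (\<Prod>i\<in>{T<..n}. ennreal (L (fst \<omega> i))) * indicator E \<omega> \<partial>law \<infinity>)"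
proof -
  let ?g = "\<lambda>x. \<Prod>i\<in>{T<..n}. ennreal (L (x i))"
  have gm: "?g \<in> borel_measurable PX"
    using L_meas by (intro borel_measurable_prod_ennreal measurable_coordinate[where M="\<lambda>_. P0"]) auto
  have "emeasure (law (enat T)) E = emeasure ((\<Pi>\<^sub>M i\<in>{1..}. if i \<in> {T<..n} then P1 else P0) \<Otimes>\<^sub>M unifs) E"
    unfolding law_def
    by (rule law_cong_filtration[OF _ _ _ _ _ E]) (auto simp: prob_P0 prob_P1 sets_P1)
  also have "(\<Pi>\<^sub>M i\<in>{1..}. if i \<in> {T<..n} then P1 else P0) = density PX ?g"
    by (rule density_PiM[symmetric]) auto
  also have "density PX ?g \<Otimes>\<^sub>M unifs = density PX ?g \<Otimes>\<^sub>M density unifs (\<lambda>_. 1)"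
    by (simp add: density_1)
  also have "\<dots> = density \<Omega> (\<lambda>(x, l). ?g x * 1)"
    by (intro pair_measure_density gm)
      (auto simp: density_1 intro!: prob_space_imp_sigma_finite prob_space_PiM prob_space_unif01)
  also have "emeasure \<dots> E = (\<integral>\<^sup>+\<omega>. ?g (fst \<omega>) * indicator E \<omega> \<partial>\<Omega>)"
    using E rand_filtration_subset measurable_compose[OF measurable_fst gm]
    by (subst emeasure_density) (auto simp: case_prod_beta' intro!: nn_integral_cong)
  finally show ?thesis unfolding law_infinity .
qed

text \<open>For n = T the likelihood ratio is an empty product.\<close>

lemma law_eq_before_change:
  assumes "E \<in> sets (rand_filtration P0 (enat T))"
  shows "measure (law (enat T)) E = measure (law \<infinity>) E"
proof -
  have "emeasure (law (enat T)) E = emeasure (law \<infinity>) E"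
    using change_of_measure[OF assms order.refl] rand_filtration_law[OF assms, of \<infinity>] by simp
  then show ?thesis by (simp add: measure_def)
qed

lemma change_of_measure_le:
  assumes E: "E \<in> sets (rand_filtration P0 (enat n))" and T: "T \<le> n" and K: "0 \<le> K"
    and LR: "\<And>\<omega>. \<omega> \<in> E \<Longrightarrow> (\<Prod>i\<in>{T<..n}. L (fst \<omega> i)) \<le> K"
  shows "measure (law (enat T)) E \<le> K * measure (law \<infinity>) E"
proof -
  interpret p: prob_space "law (enat T)" by (rule prob_law)
  interpret p0: prob_space "law \<infinity>" by (rule prob_law)
  have "emeasure (law (enat T)) E
      = (\<integral>\<^sup>+\<omega>. (\<Prod>i\<in>{T<..n}. ennreal (L (fst \<omega> i))) * indicator E \<omega> \<partial>law \<infinity>)"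
    by (rule change_of_measure[OF E T])
  also have "\<dots> \<le> (\<integral>\<^sup>+\<omega>. ennreal K * indicator E \<omega> \<partial>law \<infinity>)"
  proof (rule nn_integral_mono)
    fix \<omega> assume "\<omega> \<in> space (law \<infinity>)"
    then have "\<forall>i\<in>{T<..n}. 0 \<le> L (fst \<omega> i)"
      using outcome_space[of \<omega>] L_nonneg by (auto simp: space_law)
    then have "(\<Prod>i\<in>{T<..n}. ennreal (L (fst \<omega> i))) = ennreal (\<Prod>i\<in>{T<..n}. L (fst \<omega> i))"
      by (intro prod_ennreal) auto
    then show "(\<Prod>i\<in>{T<..n}. ennreal (L (fst \<omega> i))) * indicator E \<omega> \<le> ennreal K * indicator E \<omega>"
      using LR[of \<omega>] by (cases "\<omega> \<in> E") (auto intro: ennreal_leI)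
  qed
  also have "\<dots> = ennreal K * emeasure (law \<infinity>) E"
    using rand_filtration_law[OF E] by (simp add: nn_integral_cmult)
  finally have "ennreal (p.prob E) \<le> ennreal (K * p0.prob E)"
    using K by (simp add: p.emeasure_eq_measure p0.emeasure_eq_measure ennreal_mult)
  then show ?thesis using K by (subst (asm) ennreal_le_iff) auto
qed

end

section \<open>The lower bound\<close>

abbreviation log_delay :: "real \<Rightarrow> nat \<Rightarrow> nat" where
  "log_delay c N \<equiv> nat \<lceil>c * ln (real N)\<rceil>"

lemma cp_window_nonempty: "\<kappa> \<le> 1 \<Longrightarrow> cp_window \<kappa> N \<noteq> {}"
proof -
  assume "\<kappa> \<le> 1"
  then have "\<kappa> * real N \<le> 1 * real N" by (intro mult_right_mono) auto
  then show ?thesis by (auto simp: cp_window_def)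
qed

context base_measure
begin

lemma rand_filtration_mono: "s \<le> t \<Longrightarrow> sets (rand_filtration P0 s) \<subseteq> sets (rand_filtration P0 t)"
  unfolding sets_rand_filtration
proof (intro sigma_sets_mono' Un_mono)
  assume st: "s \<le> t"
  show "obs_events P0 s \<subseteq> obs_events P0 t"
    unfolding obs_events_def using order.trans[OF _ st] by blast
  show "rnd_events P0 s \<subseteq> rnd_events P0 t"
    unfolding rnd_events_def using order.trans[OF _ st] by blast
qed

lemma rand_time_le:
  assumes "\<tau> \<in> rand_times P0" "s \<le> t"
  shows "{\<omega>\<in>space \<Omega>. \<tau> \<omega> \<le> s} \<in> sets (rand_filtration P0 t)"
proof -
  have "Measurable.pred (rand_filtration P0 s) (\<lambda>\<omega>. \<tau> \<omega> \<le> s)"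
    using assms(1) by (simp add: rand_times_def stopping_time_def)
  then have "{\<omega>\<in>space \<Omega>. \<tau> \<omega> \<le> s} \<in> sets (rand_filtration P0 s)"
    by (simp add: pred_def)
  then show ?thesis using rand_filtration_mono[OF assms(2)] by blast
qed

lemma rand_time_between:
  assumes "\<tau> \<in> rand_times P0"
  shows "{\<omega>\<in>space \<Omega>. enat T < \<tau> \<omega> \<and> \<tau> \<omega> \<le> enat (T + r)} \<in> sets (rand_filtration P0 (enat (T + r)))"
proof -
  have "{\<omega>\<in>space \<Omega>. enat T < \<tau> \<omega> \<and> \<tau> \<omega> \<le> enat (T + r)}
      = {\<omega>\<in>space \<Omega>. \<tau> \<omega> \<le> enat (T + r)} - {\<omega>\<in>space \<Omega>. \<tau> \<omega> \<le> enat T}"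
    by auto
  then show ?thesis using rand_time_le[OF assms] by (simp add: sets.Diff)
qed

lemma rand_time_finite_sets:
  assumes "\<tau> \<in> rand_times P0"
  shows "{\<omega>\<in>space \<Omega>. \<tau> \<omega> < \<infinity>} \<in> sets \<Omega>"
proof -
  have less_infinity: "x < \<infinity> \<longleftrightarrow> (\<exists>n. x \<le> enat n)" for x :: enat
    by (cases x) auto
  have "{\<omega>\<in>space \<Omega>. \<tau> \<omega> < \<infinity>} = (\<Union>n. {\<omega>\<in>space \<Omega>. \<tau> \<omega> \<le> enat n})"
    using less_infinity by auto
  also have "\<dots> \<in> sets \<Omega>"
    using rand_time_le[OF assms order.refl] rand_filtration_subset by (intro sets.countable_UN) blast
  finally show ?thesis .
qed

end

context change_point
begin

definition detect_prob :: "('a outcome \<Rightarrow> enat) \<Rightarrow> nat \<Rightarrow> nat \<Rightarrow> real" where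
  "detect_prob \<tau> T r = \<P>(\<omega> in law (enat T). enat T < \<tau> \<omega> \<and> \<tau> \<omega> \<le> enat (T + r))"

lemma detect_prob_mono:
  assumes "\<tau> \<in> rand_times P0" "r \<le> s"
  shows "detect_prob \<tau> T r \<le> detect_prob \<tau> T s"
proof -
  interpret prob_space "law (enat T)" by (rule prob_law)
  have "{\<omega>\<in>space (law (enat T)). enat T < \<tau> \<omega> \<and> \<tau> \<omega> \<le> enat (T + s)} \<in> events"
    using rand_filtration_law[OF rand_time_between[OF assms(1)]] by (simp add: space_law)
  then show ?thesis unfolding detect_prob_def
    using assms(2) by (intro finite_measure_mono) (auto intro: order.trans)
qed

text \<open>An infimum in \<open>enat\<close> that is at most \<open>enat m\<close> is finite, hence
  attained at some r up to m, and the detection probability of a stopping time grows with r.\<close>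

lemma detection_delay_leD:
  assumes "\<tau> \<in> rand_times P0" "detection_delay P0 P1 \<delta> \<kappa> N \<tau> \<le> enat m" "T \<in> cp_window \<kappa> N"
  shows "1 - \<delta> \<le> detect_prob \<tau> T m"
proof -
  let ?S = "{enat r | r. (INF T\<in>cp_window \<kappa> N. detect_prob \<tau> T r) \<ge> 1 - \<delta>}"
  have le: "Inf ?S \<le> enat m"
    using assms(2) by (simp add: detection_delay_def detect_prob_def)
  then have "?S \<noteq> {}" by (metis Inf_enat_def infinity_ileE)
  then have "Inf ?S \<in> ?S" unfolding Inf_enat_def by (auto intro: LeastI)
  then obtain r where r: "Inf ?S = enat r" "(INF T\<in>cp_window \<kappa> N. detect_prob \<tau> T r) \<ge> 1 - \<delta>"
    by auto
  have "(INF T\<in>cp_window \<kappa> N. detect_prob \<tau> T r) \<le> detect_prob \<tau> T r"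
    using assms(3) by (intro cINF_lower bdd_belowI[of _ 0]) (auto simp: detect_prob_def)
  then show ?thesis using r le detect_prob_mono[OF assms(1), of r m T] by simp
qed

lemma detection_delay_leI:
  assumes "\<kappa> \<le> 1" "\<And>T. T \<in> cp_window \<kappa> N \<Longrightarrow> 1 - \<delta> \<le> detect_prob \<tau> T m"
  shows "detection_delay P0 P1 \<delta> \<kappa> N \<tau> \<le> enat m"
proof -
  \<comment> \<open>A real-valued infimum over the empty set would carry no information;
    \<open>\<kappa> \<le> 1\<close> keeps the window nonempty.\<close>
  have "1 - \<delta> \<le> (INF T\<in>cp_window \<kappa> N. detect_prob \<tau> T m)"
    using cp_window_nonempty[OF assms(1)] assms(2) by (intro cINF_greatest) auto
  then show ?thesis unfolding detection_delay_def detect_prob_def by (intro Inf_lower) auto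
qed

lemma prob_law_fst:
  assumes "{x\<in>space (obs_law T). Q x} \<in> sets (obs_law T)"
  shows "\<P>(\<omega> in law T. Q (fst \<omega>)) = \<P>(x in obs_law T. Q x)"
proof -
  interpret U: prob_space unifs by (rule prob_space_unifs)
  have "\<P>(x in obs_law T. Q x) = measure (distr (law T) (obs_law T) fst) {x\<in>space (obs_law T). Q x}"
    unfolding law_def by (subst U.distr_pair_fst) (rule refl)
  also have "\<dots> = \<P>(\<omega> in law T. Q (fst \<omega>))"
    unfolding law_def using assms
    by (subst measure_distr) (auto simp: space_pair_measure intro!: arg_cong2[where f=measure])
  finally show ?thesis by simp
qed

text \<open>All coordinates in \<open>{T<..T+m}\<close> have law \<open>P1\<close>, so the weak law
  applies with a sample size common to all T. It serves both bounds: with \<open>ln L\<close> for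
  the lower one and with \<open>loss\<close> for the upper one.\<close>

lemma post_change_sum_tail:
  fixes g :: "'a \<Rightarrow> real" and q \<eta> \<epsilon> :: real
  assumes g: "g \<in> borel_measurable P0" "integrable P1 g" "(\<integral>x. g x \<partial>P1) = q"
    and "0 < \<eta>" "0 < \<epsilon>"
  obtains n0 :: nat where "0 < n0"
    "\<And>T m. n0 \<le> m \<Longrightarrow> \<P>(\<omega> in law (enat T). m * (q + \<eta>) \<le> (\<Sum>i\<in>{T<..T+m}. g (fst \<omega> i))) \<le> \<epsilon>"
proof -
  obtain n0 :: nat where n0: "0 < n0"
    "\<And>(M :: nat \<Rightarrow> 'a measure) I J. product_prob_space M \<Longrightarrow> finite J \<Longrightarrow> J \<subseteq> I \<Longrightarrow> (\<And>i. i \<in> J \<Longrightarrow> M i = P1) \<Longrightarrow>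
      n0 \<le> card J \<Longrightarrow>
      measure (PiM I M) {x\<in>space (PiM I M). card J * (q + \<eta>) \<le> (\<Sum>i\<in>J. g (x i))} \<le> \<epsilon>"
    using weak_law_upper_tail[OF prob_P1 g(2,3) assms(4,5)] by blast
  have "\<P>(\<omega> in law (enat T). m * (q + \<eta>) \<le> (\<Sum>i\<in>{T<..T+m}. g (fst \<omega> i))) \<le> \<epsilon>" if "n0 \<le> m" for T m
  proof -
    have meas: "(\<lambda>x. \<Sum>i\<in>{T<..T+m}. g (x i)) \<in> borel_measurable PX"
      using g(1) by (intro borel_measurable_sum measurable_coordinate[where M="\<lambda>_. P0"]) auto
    have "\<P>(\<omega> in law (enat T). m * (q + \<eta>) \<le> (\<Sum>i\<in>{T<..T+m}. g (fst \<omega> i)))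
      = \<P>(x in obs_law (enat T). m * (q + \<eta>) \<le> (\<Sum>i\<in>{T<..T+m}. g (x i)))"
    proof (rule prob_law_fst)
      show "{x \<in> space (obs_law (enat T)). m * (q + \<eta>) \<le> (\<Sum>i\<in>{T<..T+m}. g (x i))} \<in> sets (obs_law (enat T))"
        unfolding sets_obs_law space_obs_law using meas by measurable
    qed
    also have "\<dots> \<le> \<epsilon>"
      using n0(2)[OF product_prob_space_mix, of "{T<..T+m}" "{1..}" "enat T"] that by (auto simp: subset_eq)
    finally show ?thesis .
  qed
  then show thesis using n0(1) that by blast
qed

lemma false_alarm_windows:
  assumes \<tau>: "\<tau> \<in> rand_times P0"
  shows "(\<Sum>j<q. \<P>(\<omega> in law \<infinity>. enat (a + j * m) < \<tau> \<omega> \<and> \<tau> \<omega> \<le> enat (a + j * m + m))) \<le> 1"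
proof -
  interpret prob_space "law \<infinity>" by (rule prob_law)
  define A where "A j = {\<omega>\<in>space (law \<infinity>). enat (a + j * m) < \<tau> \<omega> \<and> \<tau> \<omega> \<le> enat (a + j * m + m)}" for j
  have "A j \<in> events" for j
    unfolding A_def using rand_filtration_law[OF rand_time_between[OF \<tau>]] by (simp add: space_law)
  moreover have "disjoint_family_on A {..<q}"
  proof -
    have dis: "A i \<inter> A j = {}" if "i < j" for i j
    proof -
      have "a + i * m + m \<le> a + j * m"
        using mult_le_mono1[of "Suc i" j m] that by simp
      then have *: "enat (a + i * m + m) \<le> enat (a + j * m)" by simp
      show ?thesis
      proof (rule ccontr)
        assume "A i \<inter> A j \<noteq> {}"
        then obtain \<omega> where "enat (a + j * m) < \<tau> \<omega>" "\<tau> \<omega> \<le> enat (a + i * m + m)"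
          unfolding A_def by auto
        then show False using * by (meson leD order.trans)
      qed
    qed
    have "A i \<inter> A j = {}" if "i \<noteq> j" for i j
      using dis[of i j] dis[of j i] that by (cases "i < j") auto
    then show ?thesis by (auto simp: disjoint_family_on_def)
  qed
  ultimately have "(\<Sum>j<q. prob (A j)) = prob (\<Union>j<q. A j)"
    by (intro finite_measure_finite_Union[symmetric]) auto
  also have "\<dots> \<le> 1" by (rule prob_le_1)
  finally show ?thesis unfolding A_def .
qed

end

section \<open>Delays below the Kullback-Leibler rate are impossible\<close>

locale change_point_KL = change_point P0 P1 L for P0 :: "'a measure" and P1 L +
  fixes D :: real
  assumes KL: "KL_pos_finite P0 P1" and D_def: "D = KL_divergence (exp 1) P0 P1"
begin

lemma D_pos: "0 < D"
  using KL by (simp add: KL_pos_finite_def D_def)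

text \<open>\<open>entropy_density\<close> is built from \<open>RN_deriv\<close>. Uniqueness of
  densities identifies that derivative with \<open>L\<close> almost everywhere under
  \<open>P0\<close>, hence under \<open>P1\<close>.\<close>

lemma ln_L_integrable: "integrable P1 (\<lambda>x. ln (L x))"
  and ln_L_mean: "(\<integral>x. ln (L x) \<partial>P1) = D"
proof -
  interpret P0: prob_space P0 by (rule prob_P0)
  have "AE x in P0. ennreal (L x) = RN_deriv P0 P1 x"
    using L_meas by (intro P0.RN_deriv_unique) (auto simp: P1_density)
  then have "AE x in P0. ln (L x) = entropy_density (exp 1) P0 P1 x"
    using AE_space
  proof eventually_elim
    case (elim x)
    then show ?case using L_nonneg[OF elim(2)] elim(1)[symmetric]
      by (simp add: entropy_density_def log_def)
  qed
  then have ae: "AE x in P1. ln (L x) = entropy_density (exp 1) P0 P1 x"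
    unfolding P1_density using L_meas by (subst AE_density) auto
  have m: "(\<lambda>x. ln (L x)) \<in> borel_measurable P1" "entropy_density (exp 1) P0 P1 \<in> borel_measurable P1"
    using L_meas measurable_entropy_density[of "exp 1" P0 P1] by (auto simp: measurable_cong_sets[OF sets_P1 refl])
  have i: "integrable P1 (entropy_density (exp 1) P0 P1)" using KL by (simp add: KL_pos_finite_def)
  show "integrable P1 (\<lambda>x. ln (L x))" using integrable_cong_AE[OF m ae] i by simp
  show "(\<integral>x. ln (L x) \<partial>P1) = D" unfolding D_def KL_divergence_def by (rule integral_cong_AE[OF m ae])
qed

text \<open>\<open>c\<close> stands for \<open>D + \<eta>\<close>. The atypical event
  \<open>B\<close> may use up half of the detection probability \<open>1 - \<delta>\<close>, which
  is the origin of the factor 2; on the other half the likelihood ratio is at most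
  \<open>exp (m * c)\<close>. Summing over \<open>q\<close> disjoint windows with
  \<open>q * m \<ge> (1 - \<kappa>) * N - 1\<close> gives the inequality.\<close>

lemma delay_le_imp_count:
  assumes \<tau>: "\<tau> \<in> rand_times P0" and delay: "detection_delay P0 P1 \<delta> \<kappa> N \<tau> \<le> enat m"
    and m: "0 < m" and \<kappa>: "0 \<le> \<kappa>" "\<kappa> \<le> 1"
    and \<delta>: "\<delta> < 1"
    and tail: "\<And>T. \<P>(\<omega> in law (enat T). m * c \<le> (\<Sum>i\<in>{T<..T+m}. ln (L (fst \<omega> i)))) \<le> (1 - \<delta>) / 2"
  shows "((1 - \<kappa>) * N - 1) * (1 - \<delta>) \<le> 2 * m * exp (m * c)"
proof -
  have low: "(1 - \<delta>) / (2 * exp (m * c))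
      \<le> \<P>(\<omega> in law \<infinity>. enat T < \<tau> \<omega> \<and> \<tau> \<omega> \<le> enat (T + m))" if T: "T \<in> cp_window \<kappa> N" for T
  proof -
    interpret p: prob_space "law (enat T)" by (rule prob_law)
    interpret p0: prob_space "law \<infinity>" by (rule prob_law)
    define E where "E = {\<omega>\<in>space \<Omega>. enat T < \<tau> \<omega> \<and> \<tau> \<omega> \<le> enat (T + m)}"
    define B where "B = {\<omega>\<in>space \<Omega>. m * c \<le> (\<Sum>i\<in>{T<..T+m}. ln (L (fst \<omega> i)))}"
    have Es: "E \<in> sets (rand_filtration P0 (enat (T + m)))"
      unfolding E_def by (rule rand_time_between[OF \<tau>])
    have "(\<lambda>\<omega>. \<Sum>i\<in>{T<..T+m}. ln (L (fst \<omega> i))) \<in> borel_measurable (rand_filtration P0 (enat (T + m)))"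
      using L_meas by (intro borel_measurable_sum borel_measurable_ln measurable_compose[OF measurable_obs L_meas]) auto
    then have Bs: "B \<in> sets (rand_filtration P0 (enat (T + m)))"
      unfolding B_def space_rand_filtration[of "enat (T + m)", symmetric] by measurable
    have "1 - \<delta> \<le> p.prob E"
      using detection_delay_leD[OF \<tau> delay T] by (simp add: detect_prob_def E_def space_law)
    also have "\<dots> \<le> p.prob ((E - B) \<union> B)"
      using Es Bs rand_filtration_law by (intro p.finite_measure_mono) auto
    also have "\<dots> \<le> p.prob (E - B) + p.prob B"
      using Es Bs rand_filtration_law by (intro measure_Un_le) auto
    also have "p.prob B \<le> (1 - \<delta>) / 2"
      using tail[of T] by (simp add: B_def space_law)
    also have "p.prob (E - B) \<le> exp (m * c) * p0.prob (E - B)"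
    proof (rule change_of_measure_le)
      fix \<omega> assume \<omega>: "\<omega> \<in> E - B"
      show "(\<Prod>i\<in>{T<..T+m}. L (fst \<omega> i)) \<le> exp (m * c)"
      \<comment> \<open>Since \<open>ln 0 = 0\<close>, a vanishing factor is invisible in the sum of
        logarithms; but then the product itself is 0.\<close>
      proof (cases "\<exists>i\<in>{T<..T+m}. L (fst \<omega> i) = 0")
        case True
        then have "(\<Prod>i\<in>{T<..T+m}. L (fst \<omega> i)) = 0" by (intro prod_zero) auto
        then show ?thesis by (simp only: exp_ge_zero)
      next
        case False
        then have "0 < L (fst \<omega> i)" if "i \<in> {T<..T+m}" for i
        proof -
          have "fst \<omega> i \<in> space P0" using \<omega> that by (intro outcome_space) (auto simp: E_def)
          from L_nonneg[OF this] show ?thesis using False that by (metis order_le_less)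
        qed
        then have "(\<Prod>i\<in>{T<..T+m}. L (fst \<omega> i)) = exp (\<Sum>i\<in>{T<..T+m}. ln (L (fst \<omega> i)))"
          by (simp add: exp_sum)
        also have "\<dots> \<le> exp (m * c)" using \<omega> by (auto simp: E_def B_def)
        finally show ?thesis .
      qed
    qed (use Es Bs in auto)
    also have "p0.prob (E - B) \<le> p0.prob E"
      using Es rand_filtration_law by (intro p0.finite_measure_mono) auto
    finally have "1 - \<delta> \<le> exp (m * c) * p0.prob E + (1 - \<delta>) / 2"
      by (simp add: mult_left_mono)
    then have "(1 - \<delta>) / 2 \<le> exp (m * c) * p0.prob E"
      using field_sum_of_halves[of "1 - \<delta>"] by linarith
    then show ?thesis by (simp add: E_def space_law field_simps)
  qed
  define a where "a = nat \<lceil>\<kappa> * real N\<rceil>"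
  \<comment> \<open>Number of starting points \<open>a\<close>, \<open>a + m\<close>, ... up to N.
    Only the start of a window is a change point and must lie in \<open>cp_window\<close>; the last
    window may reach beyond N.\<close>
  define q where "q = Suc ((N - a) div m)"
  have "\<kappa> * real N \<le> real N" using \<kappa> by (simp add: mult_left_le_one_le)
  then have aN: "a \<le> N" unfolding a_def by (simp add: ceiling_le_iff nat_le_iff)
  have a_le: "real a \<le> \<kappa> * N + 1"
    unfolding a_def using \<kappa> by (simp add: of_nat_nat)
  have win: "a + j * m \<in> cp_window \<kappa> N" if "j < q" for j
  proof -
    have "j * m \<le> (N - a) div m * m" using that by (simp add: q_def)
    also have "\<dots> \<le> N - a" by simp
    finally have "a + j * m \<le> N" using aN by linarith
    then show ?thesis by (simp add: cp_window_def a_def)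
  qed
  have "real (N - a) \<le> real q * real m"
  proof -
    have "N - a \<le> q * m" unfolding q_def using m
      by (metis dividend_less_times_div less_imp_le mult.commute mult_Suc_right)
    then show ?thesis by (metis of_nat_le_iff of_nat_mult)
  qed
  then have qm: "(1 - \<kappa>) * N - 1 \<le> real q * real m"
    using a_le aN by (simp add: of_nat_diff algebra_simps)
  have "real q * ((1 - \<delta>) / (2 * exp (m * c)))
      \<le> (\<Sum>j<q. \<P>(\<omega> in law \<infinity>. enat (a + j * m) < \<tau> \<omega> \<and> \<tau> \<omega> \<le> enat (a + j * m + m)))"
    using sum_mono[of "{..<q}" "\<lambda>_. (1 - \<delta>) / (2 * exp (m * c))"] low[OF win] by simp
  also have "\<dots> \<le> 1" by (rule false_alarm_windows[OF \<tau>])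
  finally have q: "real q * (1 - \<delta>) \<le> 2 * exp (m * c)" by (simp add: field_simps)
  have "((1 - \<kappa>) * N - 1) * (1 - \<delta>) \<le> (real q * real m) * (1 - \<delta>)"
    using qm \<delta> by (intro mult_right_mono) auto
  also have "\<dots> = m * (real q * (1 - \<delta>))" by simp
  also have "\<dots> \<le> m * (2 * exp (m * c))" using q by (intro mult_left_mono) auto
  finally show ?thesis by simp
qed

text \<open>For m the ceiling of c ln N, the counting inequality would bound a linear function of N
  by a multiple of \<open>N powr \<gamma>\<close> times ln N. Taking \<open>D + \<eta>\<close>
  strictly between \<open>D\<close> and \<open>1 / c\<close> makes
  \<open>\<gamma> = c * (D + \<eta>)\<close> less than 1, a contradiction for large N. Rounding up
  costs only the constant \<open>exp (D + \<eta>)\<close> and the summand 1.\<close>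

lemma eventually_delay_greater:
  assumes \<delta>: "\<delta> < 1" and \<kappa>: "0 \<le> \<kappa>" "\<kappa> < 1" and c: "0 < c" "c < 1 / D"
  shows "\<forall>\<^sub>F N in sequentially. \<forall>\<tau>\<in>rand_times P0.
      enat (log_delay c N) < detection_delay P0 P1 \<delta> \<kappa> N \<tau>"
proof -
  have "D < 1 / c" using c D_pos by (simp add: field_simps)
  then obtain e where "D < e" "e < 1 / c" using dense by blast
  moreover define \<eta> where "\<eta> = e - D"
  ultimately have \<eta>: "0 < \<eta>" "D + \<eta> < 1 / c" by auto
  define \<gamma> where "\<gamma> = c * (D + \<eta>)"
  have \<gamma>: "\<gamma> < 1" "0 < \<gamma>"
    using \<eta> c D_pos mult_pos_pos[of c "D + \<eta>"] mult_strict_left_mono[OF \<eta>(2) c(1)] unfolding \<gamma>_def by auto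
  obtain n0 where n0: "0 < n0" "\<And>T m. n0 \<le> m \<Longrightarrow>
      \<P>(\<omega> in law (enat T). m * (D + \<eta>) \<le> (\<Sum>i\<in>{T<..T+m}. ln (L (fst \<omega> i)))) \<le> (1 - \<delta>) / 2"
    using post_change_sum_tail[OF _ ln_L_integrable ln_L_mean \<eta>(1), of "(1 - \<delta>) / 2"] L_meas \<delta> by auto
  have "filterlim (\<lambda>N. c * ln (real N)) at_top sequentially" using c(1) by real_asymp
  then have ev1: "\<forall>\<^sub>F N in sequentially. real n0 \<le> c * ln (real N)"
    by (simp add: filterlim_at_top)
  have "(\<lambda>N. 2 * (c * ln (real N) + 1) * (exp (D + \<eta>) * real N powr \<gamma>) / real N) \<longlonglongrightarrow> 0"
    using \<gamma> c by real_asymp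
  moreover have "(\<lambda>N. ((1 - \<kappa>) * real N - 1) * (1 - \<delta>) / real N) \<longlonglongrightarrow> (1 - \<kappa>) * (1 - \<delta>)"
    by real_asymp
  ultimately have "\<forall>\<^sub>F N in sequentially.
      2 * (c * ln (real N) + 1) * (exp (D + \<eta>) * real N powr \<gamma>) / real N < (1 - \<kappa>) * (1 - \<delta>) / 2
      \<and> (1 - \<kappa>) * (1 - \<delta>) / 2 < ((1 - \<kappa>) * real N - 1) * (1 - \<delta>) / real N"
    using \<kappa> \<delta> by (intro eventually_conj order_tendstoD) auto
  then have ev2: "\<forall>\<^sub>F N in sequentially.
      2 * (c * ln (real N) + 1) * (exp (D + \<eta>) * real N powr \<gamma>) < ((1 - \<kappa>) * real N - 1) * (1 - \<delta>)"
    using eventually_gt_at_top[of 0]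
    by eventually_elim (auto dest: order.strict_trans simp: divide_less_cancel)
  show ?thesis
    using ev1 ev2 eventually_gt_at_top[of 0]
  proof (eventually_elim, safe)
    fix N \<tau> assume N: "real n0 \<le> c * ln (real N)" "0 < N"
      and big: "2 * (c * ln (real N) + 1) * (exp (D + \<eta>) * real N powr \<gamma>) < ((1 - \<kappa>) * real N - 1) * (1 - \<delta>)"
      and \<tau>: "\<tau> \<in> rand_times P0"
    define m where "m = log_delay c N"
    have m: "n0 \<le> m" "real m \<le> c * ln (real N) + 1"
      using N n0(1) unfolding m_def by linarith+
    show "enat m < detection_delay P0 P1 \<delta> \<kappa> N \<tau>"
    proof (rule ccontr)
      assume "\<not> enat m < detection_delay P0 P1 \<delta> \<kappa> N \<tau>"
      then have "((1 - \<kappa>) * N - 1) * (1 - \<delta>) \<le> 2 * m * exp (m * (D + \<eta>))"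
        using n0 m(1) \<kappa> \<delta> by (intro delay_le_imp_count[OF \<tau>]) auto
      also have "\<dots> \<le> 2 * (c * ln (real N) + 1) * exp ((c * ln (real N) + 1) * (D + \<eta>))"
        using m(2) D_pos \<eta> by (intro mult_mono) (auto intro: order.trans[OF of_nat_0_le_iff])
      also have "exp ((c * ln (real N) + 1) * (D + \<eta>)) = exp (D + \<eta>) * real N powr \<gamma>"
        using N by (simp add: powr_def \<gamma>_def exp_add[symmetric] algebra_simps)
      finally show False using big by linarith
    qed
  qed
qed

text \<open>The class of times is left open so that it can be the raw times, the randomized times or
  a single rule; the last case bounds the delay of that rule from below.\<close>

lemma liminf_optimal_delay:
  assumes \<delta>: "\<delta> < 1" and \<kappa>: "0 \<le> \<kappa>" "\<kappa> < 1" and \<TT>: "\<TT> \<subseteq> rand_times P0"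
  shows "liminf (\<lambda>N. ereal_of_enat (optimal_delay P0 P1 \<TT> \<alpha> \<delta> \<kappa> N) / ereal (ln (real N))) \<ge> ereal (1 / D)"
unfolding le_Liminf_iff
proof (intro allI impI)
  fix y assume "y < ereal (1 / D)"
  \<comment> \<open>The rate \<open>c\<close> has to be positive, while y may be negative or minus
    infinity.\<close>
  then have "max y 0 < ereal (1 / D)" using D_pos by auto
  then obtain c where c: "max y 0 < ereal c" "ereal c < ereal (1 / D)" using ereal_dense2 by blast
  then have c': "0 < c" "c < 1 / D" "y < ereal c" by auto
  show "\<forall>\<^sub>F N in sequentially.
      y < ereal_of_enat (optimal_delay P0 P1 \<TT> \<alpha> \<delta> \<kappa> N) / ereal (ln (real N))"
    using eventually_delay_greater[OF \<delta> \<kappa> c'(1,2)] eventually_gt_at_top[of 1]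
  proof eventually_elim
    fix N :: nat
    assume d: "\<forall>\<tau>\<in>rand_times P0. enat (log_delay c N) < detection_delay P0 P1 \<delta> \<kappa> N \<tau>" and N: "1 < N"
    have ln: "0 < ln (real N)" using N by simp
    have "enat (log_delay c N) \<le> optimal_delay P0 P1 \<TT> \<alpha> \<delta> \<kappa> N"
      unfolding optimal_delay_def using d \<TT> by (intro INF_greatest) (auto intro: less_imp_le)
    then have "ereal (real (log_delay c N)) \<le> ereal_of_enat (optimal_delay P0 P1 \<TT> \<alpha> \<delta> \<kappa> N)"
      by (metis ereal_of_enat_le_iff ereal_of_enat_simps(1))
    moreover have "c * ln (real N) \<le> real (log_delay c N)" by linarith
    ultimately have "ereal (ln (real N)) * ereal c \<le> ereal_of_enat (optimal_delay P0 P1 \<TT> \<alpha> \<delta> \<kappa> N)"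
      by (metis ereal_less_eq(3) mult.commute order.trans times_ereal.simps(1))
    then have "ereal c \<le> ereal_of_enat (optimal_delay P0 P1 \<TT> \<alpha> \<delta> \<kappa> N) / ereal (ln (real N))"
      using ln by (subst ereal_le_divide_pos) auto
    then show "y < ereal_of_enat (optimal_delay P0 P1 \<TT> \<alpha> \<delta> \<kappa> N) / ereal (ln (real N))"
      using c'(3) by (rule order.strict_trans2[rotated])
  qed
qed

end

section \<open>Conformal p-values are independent and uniform\<close>

text \<open>The threshold is a separate argument because the score of an observation at t is later
  also ranked among the first T < t observations only.\<close>

definition count_below :: "('a \<Rightarrow> real) \<Rightarrow> (nat \<Rightarrow> 'a) \<Rightarrow> nat \<Rightarrow> real \<Rightarrow> nat" where
  "count_below s x t v = card {i\<in>{1..t}. s (x i) < v}"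

definition count_ties :: "('a \<Rightarrow> real) \<Rightarrow> (nat \<Rightarrow> 'a) \<Rightarrow> nat \<Rightarrow> real \<Rightarrow> nat" where
  "count_ties s x t v = card {i\<in>{1..t}. s (x i) = v}"

lemma conformal_p_eq:
  "conformal_p s \<omega> t = (real (count_below s (fst \<omega>) t (s (fst \<omega> t)))
     + snd \<omega> t * real (count_ties s (fst \<omega>) t (s (fst \<omega> t)))) / real t"
  by (simp add: conformal_p_def count_below_def count_ties_def)

lemma count_sum_le: "count_below s x t v + count_ties s x t v \<le> t"
proof -
  have "count_below s x t v + count_ties s x t v = card ({i\<in>{1..t}. s (x i) < v} \<union> {i\<in>{1..t}. s (x i) = v})"
    unfolding count_below_def count_ties_def by (subst card_Un_disjoint) auto
  also have "\<dots> \<le> card {1..t}" by (intro card_mono) auto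
  finally show ?thesis by simp
qed

lemma count_ties_pos: "j \<in> {1..t} \<Longrightarrow> 0 < count_ties s x t (s (x j))"
  unfolding count_ties_def by (subst card_gt_0_iff) auto

lemma rank_range:
  assumes "1 \<le> t" "l \<in> {0..1}" "a + b \<le> t"
  shows "(real a + l * real b) / real t \<in> {0..1}"
proof -
  have "real a + l * real b \<le> real a + 1 * real b"
    using assms by (intro add_left_mono mult_right_mono) auto
  also have "\<dots> \<le> real t" using assms by simp
  finally show ?thesis using assms by (auto simp: divide_le_eq)
qed

lemma conformal_p_range:
  "1 \<le> t \<Longrightarrow> snd \<omega> t \<in> {0..1} \<Longrightarrow> conformal_p s \<omega> t \<in> {0..1}"
  unfolding conformal_p_eq by (intro rank_range count_sum_le)

lemma measurable_count:
  assumes x: "\<And>i. i \<in> {1..t} \<Longrightarrow> (\<lambda>\<omega>. s (X \<omega> i)) \<in> borel_measurable M"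
    and v: "v \<in> borel_measurable M"
  shows "(\<lambda>\<omega>. real (count_below s (X \<omega>) t (v \<omega>))) \<in> borel_measurable M"
    and "(\<lambda>\<omega>. real (count_ties s (X \<omega>) t (v \<omega>))) \<in> borel_measurable M"
proof -
  have "real (card {i\<in>{1..t}. P i}) = (\<Sum>i\<in>{1..t}. if P i then 1 else 0)" for P
    by (simp add: sum.If_cases Int_def)
  then show "(\<lambda>\<omega>. real (count_below s (X \<omega>) t (v \<omega>))) \<in> borel_measurable M"
    and "(\<lambda>\<omega>. real (count_ties s (X \<omega>) t (v \<omega>))) \<in> borel_measurable M"
    unfolding count_below_def count_ties_def
    using borel_measurable_less[OF x v] borel_measurable_eq[OF x v]
    by (simp_all only:) (intro borel_measurable_sum measurable_If borel_measurable_const; assumption)+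
qed

lemma (in base_measure) measurable_conformal_p:
  assumes s: "s \<in> borel_measurable P0" and t: "1 \<le> t" "enat t \<le> u"
  shows "(\<lambda>\<omega>. conformal_p s \<omega> t) \<in> rand_filtration P0 u \<rightarrow>\<^sub>M unif01"
proof -
  have x: "(\<lambda>\<omega>. s (fst \<omega> i)) \<in> borel_measurable (rand_filtration P0 u)" if "i \<in> {1..t}" for i
  proof (intro measurable_compose[OF measurable_obs s])
    show "1 \<le> i" using that by simp
    have "enat i \<le> enat t" using that by simp
    then show "enat i \<le> u" using t(2) by (rule order.trans)
  qed
  have l: "(\<lambda>\<omega>. snd \<omega> t) \<in> borel_measurable (rand_filtration P0 u)"
    using measurable_compose[OF measurable_randomizer[OF t] measurable_unif01_borel[OF measurable_ident]] by simp
  have xt: "(\<lambda>\<omega>. s (fst \<omega> t)) \<in> borel_measurable (rand_filtration P0 u)"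
    using t by (intro x) auto
  have c: "(\<lambda>\<omega>. real (count_below s (fst \<omega>) t (s (fst \<omega> t)))) \<in> borel_measurable (rand_filtration P0 u)"
    "(\<lambda>\<omega>. real (count_ties s (fst \<omega>) t (s (fst \<omega> t)))) \<in> borel_measurable (rand_filtration P0 u)"
    by (rule measurable_count[where s=s and X=fst and v="\<lambda>\<omega>. s (fst \<omega> t)", OF _ xt], rule x, assumption)+
  have "(\<lambda>\<omega>. conformal_p s \<omega> t) \<in> borel_measurable (rand_filtration P0 u)"
    unfolding conformal_p_eq
    by (intro borel_measurable_divide borel_measurable_add borel_measurable_times borel_measurable_const c l)
  then have "(\<lambda>\<omega>. conformal_p s \<omega> t) \<in> rand_filtration P0 u \<rightarrow>\<^sub>M lborel"
    by (simp only: measurable_lborel1)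
  moreover have "(\<lambda>\<omega>. conformal_p s \<omega> t) \<in> space (rand_filtration P0 u) \<rightarrow> {0..1}"
  proof (rule funcsetI)
    fix \<omega> assume "\<omega> \<in> space (rand_filtration P0 u)"
    then have "snd \<omega> t \<in> {0..1}" using t by (intro randomizer_space) (simp_all only: space_rand_filtration)
    with t(1) show "conformal_p s \<omega> t \<in> {0..1}" by (rule conformal_p_range)
  qed
  ultimately show ?thesis unfolding unif01_def by (intro measurable_restrict_space2)
qed

section \<open>Ranks with randomized ties\<close>

text \<open>Ranks tile \<open>{..<n}\<close>: the tie class with \<open>a\<close> values below it and \<open>b\<close> members covers
  \<open>{a..<a + b}\<close>. Each \<open>m\<close> is covered by at most one class, and the total length is \<open>n\<close>.\<close>

lemma rank_tiling:
  fixes s :: "'a \<Rightarrow> real" and x :: "nat \<Rightarrow> 'a"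
  assumes m: "m < n"
  defines "a \<equiv> \<lambda>j. count_below s x n (s (x j))" and "b \<equiv> \<lambda>j. count_ties s x n (s (x j))"
  shows "(\<Sum>j\<in>{1..n}. if a j \<le> m \<and> m < a j + b j then 1 / real (b j) else 0) = 1"
proof -
  define S where "S m = (\<Sum>j\<in>{1..n}. if a j \<le> m \<and> m < a j + b j then 1 / real (b j) else 0)" for m
  have S_le: "S m \<le> 1" for m
  proof (cases "\<exists>k\<in>{1..n}. a k \<le> m \<and> m < a k + b k")
    case False
    have "S m = 0" unfolding S_def
    proof (intro sum.neutral ballI)
      fix j assume "j \<in> {1..n}"
      with False have "\<not> (a j \<le> m \<and> m < a j + b j)" by blast
      then show "(if a j \<le> m \<and> m < a j + b j then 1 / real (b j) else 0) = 0" by (rule if_not_P)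
    qed
    then show ?thesis by simp
  next
    case True
    then obtain k where k: "k \<in> {1..n}" "a k \<le> m" "m < a k + b k" by blast
    have below: "a j + b j \<le> a i" if "s (x j) < s (x i)" for i j
    proof -
      have "a j + b j = card ({i\<in>{1..n}. s (x i) < s (x j)} \<union> {i\<in>{1..n}. s (x i) = s (x j)})"
        unfolding a_def b_def count_below_def count_ties_def by (subst card_Un_disjoint) auto
      also have "\<dots> \<le> a i" unfolding a_def count_below_def using that by (intro card_mono) auto
      finally show ?thesis .
    qed
    have same: "s (x j) = s (x k)" if "a j \<le> m" "m < a j + b j" for j
      using below[of j k] below[of k j] that k by (cases "s (x j)" "s (x k)" rule: linorder_cases) auto
    have "S m = (\<Sum>j\<in>{1..n}. if s (x j) = s (x k) then 1 / real (b k) else 0)"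
      unfolding S_def
    proof (rule sum.cong[OF refl])
      fix j assume "j \<in> {1..n}"
      show "(if a j \<le> m \<and> m < a j + b j then 1 / real (b j) else 0)
          = (if s (x j) = s (x k) then 1 / real (b k) else 0)"
      proof (cases "s (x j) = s (x k)")
        case True
        then have ab: "a j = a k" "b j = b k" by (simp_all only: a_def b_def)
        have "a k \<le> m \<and> m < a k + b k" using k by blast
        then show ?thesis unfolding ab True by (simp only: if_P refl simp_thms)
      next
        case False
        then have "\<not> (a j \<le> m \<and> m < a j + b j)" using same by blast
        then show ?thesis using False by (simp only: if_False)
      qed
    qed
    also have "\<dots> = real (b k) * (1 / real (b k))"
      by (simp add: sum.If_cases Int_def b_def count_ties_def)
    also have "\<dots> \<le> 1" by simp
    finally show ?thesis .
  qed
  have "(\<Sum>m<n. S m) = (\<Sum>j\<in>{1..n}. \<Sum>m<n. if a j \<le> m \<and> m < a j + b j then 1 / real (b j) else 0)"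
    unfolding S_def by (rule sum.swap)
  also have "\<dots> = (\<Sum>j\<in>{1..n}. 1)"
  proof (rule sum.cong[OF refl])
    fix j assume j: "j \<in> {1..n}"
    have "{..<n} \<inter> {m. a j \<le> m \<and> m < a j + b j} = {a j..<a j + b j}"
      using count_sum_le[of s x n "s (x j)"] unfolding a_def b_def by auto
    then show "(\<Sum>m<n. if a j \<le> m \<and> m < a j + b j then 1 / real (b j) else 0) = (1::real)"
      using count_ties_pos[OF j, of s x] by (simp add: sum.If_cases b_def)
  qed
  finally have "(\<Sum>m<n. 1 - S m) = 0" by (simp add: sum_subtractf)
  then have "1 - S m = 0" using S_le m by (subst (asm) sum_nonneg_eq_0_iff) auto
  then show ?thesis unfolding S_def by simp
qed

text \<open>Conditional probability, given the observations, that the p-value at time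
  \<open>t\<close> falls in \<open>A\<close>, when \<open>a\<close> scores lie strictly below the
  current one and \<open>b\<close> are tied with it.\<close>

definition rank_prob :: "nat \<Rightarrow> real set \<Rightarrow> nat \<Rightarrow> nat \<Rightarrow> ennreal" where
  "rank_prob t A a b = (\<integral>\<^sup>+l. indicator A ((real a + l * real b) / real t) \<partial>unif01)"

lemma nn_integral_unif01:
  "f \<in> borel_measurable borel \<Longrightarrow> (\<integral>\<^sup>+x. f x \<partial>unif01) = (\<integral>\<^sup>+x. f x * indicator {0..1} x \<partial>lborel)"
  unfolding unif01_def by (subst nn_integral_restrict_space) auto

text \<open>Substitution of u = (a + l b) / n: the conditional law is uniform on a cell of length b
  / n, hence has density n / b there. The cell is half-open so that the cells of different tie
  classes do not overlap.\<close>

lemma rank_prob_eq: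
  assumes A: "A \<in> sets borel" and n: "0 < n" and b: "0 < b"
  shows "rank_prob n A a b = (\<integral>\<^sup>+u. ennreal (real n) * (ennreal (1 / real b) * indicator {real a / n..<(real a + b) / n} u) * indicator A u \<partial>lborel)"
proof -
  let ?f = "\<lambda>u. indicator A u * indicator {real a / n..<(real a + b) / n} u :: ennreal"
  have fm: "?f \<in> borel_measurable borel" using A by measurable
  have gm: "(\<lambda>l. indicator A ((real a + l * real b) / real n) :: ennreal) \<in> borel_measurable borel"
    by (rule measurable_compose[where N=borel, OF _ borel_measurable_indicator[OF A]]) measurable
  have "(\<integral>\<^sup>+u. ?f u \<partial>lborel)
      = ennreal \<bar>real b / n\<bar> * (\<integral>\<^sup>+l. ?f (real a / n + real b / n * l) \<partial>lborel)"
    using fm n b by (intro nn_integral_real_affine) auto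
  also have "(\<integral>\<^sup>+l. ?f (real a / n + real b / n * l) \<partial>lborel)
      = (\<integral>\<^sup>+l. indicator A ((real a + l * real b) / real n) * indicator {0..1} l \<partial>lborel)"
  proof (rule nn_integral_cong_AE)
    \<comment> \<open>At l = 1 the p-value is the right end of the cell, which the half-open cell
      omits.\<close>
    have "AE l in lborel. l \<noteq> (1::real)" by (rule AE_lborel_singleton)
    then show "AE l in lborel. ?f (real a / n + real b / n * l)
        = indicator A ((real a + l * real b) / real n) * indicator {0..1} l"
    proof eventually_elim
      case (elim l)
      have "real a / n + real b / n * l = (real a + l * real b) / real n"
        using n by (simp add: field_simps)
      moreover have "real a / n + real b / n * l \<in> {real a / n..<(real a + b) / n} \<longleftrightarrow> l \<in> {0..1}"
      proof -
        have c: "0 < real b / n" using n b by simp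
        have "real a / n + real b / n * l \<in> {real a / n..<(real a + b) / n}
            \<longleftrightarrow> 0 \<le> real b / n * l \<and> real b / n * l < real b / n * 1"
          by (simp add: add_divide_distrib)
        also have "\<dots> \<longleftrightarrow> 0 \<le> l \<and> l < 1"
          using mult_le_cancel_left_pos[OF c, of 0 l] mult_less_cancel_left_pos[OF c, of l 1] by simp
        finally show ?thesis using elim by auto
      qed
      ultimately show ?case by (simp add: indicator_def)
    qed
  qed
  also have "\<dots> = rank_prob n A a b"
    unfolding rank_prob_def by (rule nn_integral_unif01[OF gm, symmetric])
  finally have eq: "(\<integral>\<^sup>+u. ?f u \<partial>lborel) = ennreal (real b / n) * rank_prob n A a b" by simp
  have "(\<integral>\<^sup>+u. ennreal (real n) * (ennreal (1 / real b) * indicator {real a / n..<(real a + b) / n} u) * indicator A u \<partial>lborel)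
      = (\<integral>\<^sup>+u. ennreal (real n / b) * ?f u \<partial>lborel)"
    by (intro nn_integral_cong) (auto simp: indicator_def ennreal_mult[symmetric])
  also have "\<dots> = ennreal (real n / b) * (\<integral>\<^sup>+u. ?f u \<partial>lborel)"
    using fm by (intro nn_integral_cmult) auto
  also have "\<dots> = ennreal (real n / b * (real b / n)) * rank_prob n A a b"
    unfolding eq by (subst ennreal_mult) (auto simp: mult.assoc)
  also have "\<dots> = rank_prob n A a b" using n b by simp
  finally show ?thesis by simp
qed

text \<open>At almost every u in [0,1] the densities of the n conditional laws add up to n, by the
  tiling of ranks. So the average over the position of the current observation is exactly uniform,
  whatever the ties.\<close>

lemma sum_rank_prob:
  assumes A: "A \<in> sets unif01" and n: "0 < n"
  shows "(\<Sum>j\<in>{1..n}. rank_prob n A (count_below s x n (s (x j))) (count_ties s x n (s (x j))))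
    = of_nat n * emeasure unif01 A"
proof -
  define a b where "a j = count_below s x n (s (x j))" and "b j = count_ties s x n (s (x j))" for j
  have Ab[measurable]: "A \<in> sets borel" by (rule sets_unif01D[OF A])
  have A01: "A \<subseteq> {0..1}" using sets.sets_into_space[OF A] by simp
  let ?k = "\<lambda>j u. ennreal (real n) * (ennreal (1 / real (b j)) * indicator {real (a j) / n..<(real (a j) + b j) / n} u) * indicator A u"
  have "(\<Sum>j\<in>{1..n}. rank_prob n A (a j) (b j))
    = (\<Sum>j\<in>{1..n}. \<integral>\<^sup>+u. ?k j u \<partial>lborel)"
    using n count_ties_pos[of _ n s x] by (intro sum.cong rank_prob_eq[OF Ab]) (auto simp: b_def)
  also have "\<dots> = (\<integral>\<^sup>+u. (\<Sum>j\<in>{1..n}. ?k j u) \<partial>lborel)"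
    by (intro nn_integral_sum[symmetric] borel_measurable_times_ennreal borel_measurable_const
        borel_measurable_indicator) (simp_all add: Ab)
  also have "\<dots> = (\<integral>\<^sup>+u. ennreal (real n) * indicator A u \<partial>lborel)"
  proof (rule nn_integral_cong_AE)
    have "AE u in lborel. u \<noteq> (1::real)" by (rule AE_lborel_singleton)
    then show "AE u in lborel. (\<Sum>j\<in>{1..n}. ?k j u)
        = ennreal (real n) * indicator A u"
    proof eventually_elim
      case (elim u)
      show ?case
      proof (cases "u \<in> A")
        case True
        then have u: "0 \<le> u" "u < 1" using A01 elim by force+
        \<comment> \<open>Cell borders are multiples of 1 / n, so membership of u depends only on
          the integer part of n u. It is less than n because u = 1 has been discarded.\<close>
        define m where "m = nat \<lfloor>real n * u\<rfloor>"
        have nu: "0 \<le> real n * u" "real n * u < n" using u n by auto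
        then have mn: "m < n" unfolding m_def by linarith
        have ind: "u \<in> {real (a j) / n..<(real (a j) + b j) / n} \<longleftrightarrow> a j \<le> m \<and> m < a j + b j" for j
        proof -
          have "u \<in> {real (a j) / n..<(real (a j) + b j) / n}
            \<longleftrightarrow> real (a j) \<le> real n * u \<and> real n * u < real (a j + b j)"
            using n by (auto simp: field_simps)
          also have "\<dots> \<longleftrightarrow> a j \<le> m \<and> m < a j + b j"
            unfolding m_def using nu by linarith
          finally show ?thesis .
        qed
        have "(\<Sum>j\<in>{1..n}. ?k j u)
          = (\<Sum>j\<in>{1..n}. ennreal (real n) * ennreal (if a j \<le> m \<and> m < a j + b j then 1 / real (b j) else 0))"
          using True ind by (intro sum.cong) (auto simp: indicator_def)
        also have "\<dots> = ennreal (real n) * ennreal (\<Sum>j\<in>{1..n}. if a j \<le> m \<and> m < a j + b j then 1 / real (b j) else 0)"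
          unfolding sum_distrib_left[symmetric] by (subst sum_ennreal) auto
        also have "\<dots> = ennreal (real n)"
          using rank_tiling[OF mn, of s x] unfolding a_def b_def by simp
        finally show ?thesis using True by simp
      qed simp
    qed
  qed
  also have "\<dots> = of_nat n * emeasure lborel A"
    using Ab by (simp add: nn_integral_cmult ennreal_of_nat_eq_real_of_nat)
  also have "emeasure lborel A = emeasure unif01 A"
    unfolding unif01_def using A01 by (subst emeasure_restrict_space) auto
  finally show ?thesis unfolding a_def b_def .
qed

text \<open>The restriction to indices from 1 on makes the result extensional, as every point of the
  product space is.\<close>

definition swap_seq :: "nat \<Rightarrow> nat \<Rightarrow> (nat \<Rightarrow> 'a) \<Rightarrow> nat \<Rightarrow> 'a" where
  "swap_seq i j x = (\<lambda>n\<in>{1..}. x (Transposition.transpose i j n))"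

lemma count_swap_seq:
  assumes ij: "i \<in> {1..n}" "j \<in> {1..n}"
  shows "count_below s (swap_seq i j x) n v = count_below s x n v"
    and "count_ties s (swap_seq i j x) n v = count_ties s x n v"
proof -
  have bij: "bij_betw (Transposition.transpose i j) {1..n} {1..n}"
    using ij by (intro bij_betwI[where g="Transposition.transpose i j"]) (auto simp: Transposition.transpose_def)
  have *: "card {k\<in>{1..n}. P (swap_seq i j x k)} = card {k\<in>{1..n}. P (x k)}" for P
  proof -
    have "{k\<in>{1..n}. P (swap_seq i j x k)} = {k\<in>{1..n}. P (x (Transposition.transpose i j k))}"
      by (auto simp: swap_seq_def)
    moreover have "bij_betw (Transposition.transpose i j) {k\<in>{1..n}. P (x (Transposition.transpose i j k))} {k\<in>{1..n}. P (x k)}"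
      using ij by (intro bij_betwI[where g="Transposition.transpose i j"]) (auto simp: Transposition.transpose_def)
    ultimately show ?thesis by (simp add: bij_betw_same_card)
  qed
  show "count_below s (swap_seq i j x) n v = count_below s x n v"
    and "count_ties s (swap_seq i j x) n v = count_ties s x n v"
    unfolding count_below_def count_ties_def by (rule *)+
qed

section \<open>Exchangeability and the joint law of the p-values\<close>

context base_measure
begin

lemma transpose_ge_1: "1 \<le> i \<Longrightarrow> 1 \<le> j \<Longrightarrow> 1 \<le> n \<Longrightarrow> 1 \<le> Transposition.transpose i j (n::nat)"
  by (auto simp: Transposition.transpose_def)

lemma measurable_swap_seq: "1 \<le> i \<Longrightarrow> 1 \<le> j \<Longrightarrow> swap_seq i j \<in> PX \<rightarrow>\<^sub>M PX"
  unfolding swap_seq_def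
  by (intro measurable_restrict measurable_component_singleton) (use transpose_ge_1 in auto)

text \<open>This is where exchangeability enters: reindexing an iid product by a transposition
  leaves it unchanged.\<close>

lemma nn_integral_swap_seq:
  assumes ij: "1 \<le> i" "1 \<le> j" and G: "G \<in> borel_measurable PX"
  shows "(\<integral>\<^sup>+x. G (swap_seq i j x) \<partial>PX) = (\<integral>\<^sup>+x. G x \<partial>PX)"
proof -
  have "distr PX PX (swap_seq i j) = PX"
    unfolding swap_seq_def
    using distr_PiM_reindex[of "{1..}" "\<lambda>_. P0" "Transposition.transpose i j" "{1..}"] prob_P0 ij
    by (auto simp: Transposition.transpose_def Pi_iff)
  then have "(\<integral>\<^sup>+x. G x \<partial>PX) = (\<integral>\<^sup>+x. G x \<partial>distr PX PX (swap_seq i j))" by simp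
  also have "\<dots> = (\<integral>\<^sup>+x. G (swap_seq i j x) \<partial>PX)"
    using measurable_swap_seq[OF ij] G by (intro nn_integral_distr) auto
  finally show ?thesis by simp
qed

definition rank_cond :: "('a \<Rightarrow> real) \<Rightarrow> real set \<Rightarrow> nat \<Rightarrow> (nat \<Rightarrow> 'a) \<Rightarrow> ennreal" where
  "rank_cond s A t x = rank_prob t A (count_below s x t (s (x t))) (count_ties s x t (s (x t)))"

lemma measurable_rank_cond:
  assumes s: "s \<in> borel_measurable P0" and t: "1 \<le> t"
  shows "rank_cond s A t \<in> borel_measurable PX"
proof -
  have c: "(\<lambda>x. s (x i)) \<in> borel_measurable PX" if "1 \<le> i" for i
    using that s by (intro measurable_coordinate[where M="\<lambda>_. P0"]) auto
  have r: "(\<lambda>x. real (count_below s x t (s (x t)))) \<in> borel_measurable PX"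
    "(\<lambda>x. real (count_ties s x t (s (x t)))) \<in> borel_measurable PX"
    using measurable_count[where s=s and X="\<lambda>x. x" and v="\<lambda>x. s (x t)" and t=t, OF c c[OF t]] by simp_all
  \<comment> \<open>Passing through \<open>nat\<close> and the floor turns real-valued counts into
    measurable maps to a discrete space. On a countable discrete space every function is measurable,
    so nothing has to be shown about \<open>rank_prob\<close>.\<close>
  have n: "(\<lambda>x. nat \<lfloor>real (count_below s x t (s (x t)))\<rfloor>) \<in> PX \<rightarrow>\<^sub>M count_space UNIV"
    "(\<lambda>x. nat \<lfloor>real (count_ties s x t (s (x t)))\<rfloor>) \<in> PX \<rightarrow>\<^sub>M count_space UNIV"
    using r by measurable
  then have "(\<lambda>x. (count_below s x t (s (x t)), count_ties s x t (s (x t)))) \<in> PX \<rightarrow>\<^sub>M count_space UNIV \<Otimes>\<^sub>M count_space UNIV"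
    by (intro measurable_Pair) simp_all
  then have m: "(\<lambda>x. (count_below s x t (s (x t)), count_ties s x t (s (x t)))) \<in> PX \<rightarrow>\<^sub>M count_space UNIV"
    by (simp add: pair_measure_countable)
  show ?thesis unfolding rank_cond_def
    using measurable_compose[OF m, of "\<lambda>(a, b). rank_prob t A a b" borel] by simp
qed

text \<open>A function invariant under permutations of the first \<open>n\<close> observations is uncorrelated with the
  conditional laws of all the \<open>n\<close> conformal p-values: average over the position of the last
  observation, and note that what is left is invariant under permutations of the first \<open>n - 1\<close>.\<close>

lemma rank_cond_product:
  assumes s: "s \<in> borel_measurable P0" and A: "\<And>t. A t \<in> sets unif01"
  shows "G \<in> borel_measurable PX \<Longrightarrow>
    (\<And>i j x. i \<in> {1..n} \<Longrightarrow> j \<in> {1..n} \<Longrightarrow> x \<in> space PX \<Longrightarrow> G (swap_seq i j x) = G x) \<Longrightarrow>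
    (\<integral>\<^sup>+x. G x * (\<Prod>t\<in>{1..n}. rank_cond s (A t) t x) \<partial>PX) = (\<integral>\<^sup>+x. G x \<partial>PX) * (\<Prod>t\<in>{1..n}. emeasure unif01 (A t))"
proof (induction n arbitrary: G)
  case 0
  then show ?case by simp
next
  case (Suc n)
  let ?r = "rank_cond s (A (Suc n)) (Suc n)" and ?c = "of_nat (Suc n) * emeasure unif01 (A (Suc n))"
  let ?I = "\<integral>\<^sup>+x. G x * ?r x \<partial>PX" and ?s = "\<lambda>j x. ?r (swap_seq j (Suc n) x)"
  have rm: "?r \<in> borel_measurable PX" by (intro measurable_rank_cond s) simp
  have Gr: "(\<lambda>x. G x * ?r x) \<in> borel_measurable PX" using Suc.prems(1) rm by measurable
  have "(\<integral>\<^sup>+x. G x * (\<Prod>t\<in>{1..Suc n}. rank_cond s (A t) t x) \<partial>PX)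
      = (\<integral>\<^sup>+x. (G x * ?r x) * (\<Prod>t\<in>{1..n}. rank_cond s (A t) t x) \<partial>PX)"
    by (simp add: mult_ac)
  also have "\<dots> = ?I * (\<Prod>t\<in>{1..n}. emeasure unif01 (A t))"
  proof (rule Suc.IH[OF Gr])
    fix i j x assume ij: "i \<in> {1..n}" "j \<in> {1..n}" and x: "x \<in> space PX"
    then have "swap_seq i j x (Suc n) = x (Suc n)"
      by (auto simp: swap_seq_def Transposition.transpose_def)
    then show "G (swap_seq i j x) * ?r (swap_seq i j x) = G x * ?r x"
      using Suc.prems(2)[of i j x] ij x by (simp add: rank_cond_def count_swap_seq)
  qed
  also have "?I = (\<integral>\<^sup>+x. G x \<partial>PX) * emeasure unif01 (A (Suc n))"
  proof -
    have each: "?I = (\<integral>\<^sup>+x. G x * ?s j x \<partial>PX)" if j: "j \<in> {1..Suc n}" for j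
    proof -
      have "?I = (\<integral>\<^sup>+x. G (swap_seq j (Suc n) x) * ?s j x \<partial>PX)"
        using j nn_integral_swap_seq[OF _ _ Gr, of j "Suc n"] by simp
      also have "\<dots> = (\<integral>\<^sup>+x. G x * ?s j x \<partial>PX)"
        using j Suc.prems(2)[of j "Suc n"] by (intro nn_integral_cong) auto
      finally show ?thesis .
    qed
    have swm: "(\<lambda>x. G x * ?s j x) \<in> borel_measurable PX" if "j \<in> {1..Suc n}" for j
    proof -
      have [measurable]: "(\<lambda>x. ?s j x) \<in> borel_measurable PX"
        using that by (intro measurable_compose[OF measurable_swap_seq rm]) auto
      note [measurable] = Suc.prems(1)
      show ?thesis by measurable
    qed
    have sw: "?s j x = rank_prob (Suc n) (A (Suc n)) (count_below s x (Suc n) (s (x j))) (count_ties s x (Suc n) (s (x j)))"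
      if "j \<in> {1..Suc n}" for j x
      using that by (simp add: rank_cond_def count_swap_seq) (simp add: swap_seq_def)
    have "of_nat (Suc n) * ?I = (\<Sum>j\<in>{1..Suc n}. \<integral>\<^sup>+x. G x * ?r x \<partial>PX)"
      by simp
    also have "\<dots> = (\<Sum>j\<in>{1..Suc n}. \<integral>\<^sup>+x. G x * ?s j x \<partial>PX)"
      by (intro sum.cong each refl)
    also have "\<dots> = (\<integral>\<^sup>+x. (\<Sum>j\<in>{1..Suc n}. G x * ?s j x) \<partial>PX)"
      using swm by (intro nn_integral_sum[symmetric])
    also have "\<dots> = (\<integral>\<^sup>+x. G x * ?c \<partial>PX)"
    proof (rule nn_integral_cong)
      fix x
      have "(\<Sum>j\<in>{1..Suc n}. ?s j x) = ?c"
        using sum_rank_prob[OF A, where n="Suc n" and s=s and x=x] sw by simp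
      then show "(\<Sum>j\<in>{1..Suc n}. G x * ?s j x) = G x * ?c"
        unfolding sum_distrib_left[symmetric] by simp
    qed
    also have "\<dots> = (\<integral>\<^sup>+x. G x \<partial>PX) * ?c"
      using Suc.prems(1) by (intro nn_integral_multc)
    finally have "of_nat (Suc n) * ?I = of_nat (Suc n) * ((\<integral>\<^sup>+x. G x \<partial>PX) * emeasure unif01 (A (Suc n)))"
      by (simp only: mult_ac)
    then show ?thesis
      by (subst (asm) ennreal_mult_cancel_left) auto
  qed
  finally show ?case by (simp add: mult_ac)
qed

lemma measurable_conformal_p_outcome:
  assumes s: "s \<in> borel_measurable P0" and t: "1 \<le> t"
  shows "(\<lambda>\<omega>. conformal_p s \<omega> t) \<in> \<Omega> \<rightarrow>\<^sub>M unif01"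
  using measurable_conformal_p[OF s t order.refl] rand_filtration_subset[of "enat t"]
  unfolding measurable_def by auto

lemma measurable_conformal_seq:
  assumes s: "s \<in> borel_measurable P0"
  shows "(\<lambda>\<omega>. \<lambda>t\<in>{1..}. conformal_p s \<omega> t) \<in> \<Omega> \<rightarrow>\<^sub>M unifs"
  using measurable_conformal_p_outcome[OF s] by (intro measurable_restrict) auto

text \<open>Given the observations, the p-values are independent because the randomizers are, and
  their conditional probabilities are \<open>rank_cond\<close>. The product is then averaged over
  the observations by \<open>rank_cond_product\<close> with constant \<open>G\<close>.\<close>

lemma conformal_p_joint:
  assumes s: "s \<in> borel_measurable P0" and A: "\<And>t. A t \<in> sets unif01"
  shows "emeasure \<Omega> {\<omega>\<in>space \<Omega>. \<forall>t\<in>{1..n}. conformal_p s \<omega> t \<in> A t} = (\<Prod>t\<in>{1..n}. emeasure unif01 (A t))"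
proof -
  interpret U: prob_space unifs by (rule prob_space_unifs)
  interpret PU: product_prob_space "\<lambda>_. unif01" "{1::nat..}"
    by (rule product_prob_space_unif01)
  interpret X: prob_space PX using prob_P0 by (intro prob_space_PiM) auto
  let ?E = "{\<omega>\<in>space \<Omega>. \<forall>t\<in>{1..n}. conformal_p s \<omega> t \<in> A t}"
  note mp = measurable_conformal_p_outcome[OF s]
  have Es: "?E \<in> sets \<Omega>"
    using mp A by (intro sets.sets_Collect_finite_All' sets.sets_Collect_finite_All)
      (auto intro: measurable_sets_Collect[of _ \<Omega> unif01] simp: pred_def)
  have "emeasure \<Omega> ?E = (\<integral>\<^sup>+x. \<integral>\<^sup>+l. indicator ?E (x, l) \<partial>unifs \<partial>PX)"
    using Es by (intro U.emeasure_pair_measure)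
  also have "\<dots> = (\<integral>\<^sup>+x. (\<Prod>t\<in>{1..n}. rank_cond s (A t) t x) \<partial>PX)"
  proof (rule nn_integral_cong)
    fix x assume x: "x \<in> space PX"
    let ?a = "\<lambda>t. count_below s x t (s (x t))" and ?b = "\<lambda>t. count_ties s x t (s (x t))"
    let ?v = "\<lambda>t l. (real (?a t) + l * real (?b t)) / real t"
    have "(\<integral>\<^sup>+l. indicator ?E (x, l) \<partial>unifs)
        = (\<integral>\<^sup>+l. (\<Prod>t\<in>{1..n}. indicator (A t) (?v t (l t))) \<partial>unifs)"
    proof (rule nn_integral_cong)
      fix l assume "l \<in> space unifs"
      then show "indicator ?E (x, l) = (\<Prod>t\<in>{1..n}. indicator (A t) (?v t (l t)) :: ennreal)"
        using x by (auto simp: indicator_def space_pair_measure conformal_p_eq intro!: prod_zero[symmetric] prod.neutral[symmetric])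
    qed
    also have "\<dots> = (\<Prod>t\<in>{1..n}. rank_cond s (A t) t x)"
      unfolding rank_cond_def rank_prob_def
    proof (rule PU.nn_integral_PiM_prod)
      fix t
      have "(\<lambda>l. ?v t l) \<in> borel \<rightarrow>\<^sub>M borel" by measurable
      then have "(\<lambda>l. ?v t l) \<in> borel_measurable unif01"
        by (rule measurable_unif01_borel)
      then show "(\<lambda>l. indicator (A t) (?v t l)) \<in> borel_measurable unif01"
        using borel_measurable_indicator[OF sets_unif01D[OF A[of t]]]
        by (rule measurable_compose)
    qed auto
    finally show "(\<integral>\<^sup>+l. indicator ?E (x, l) \<partial>unifs) = (\<Prod>t\<in>{1..n}. rank_cond s (A t) t x)" .
  qed
  also have "\<dots> = (\<Prod>t\<in>{1..n}. emeasure unif01 (A t))"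
    using rank_cond_product[where A=A and G="\<lambda>_. 1" and n=n, OF s A] X.emeasure_space_1 by simp
  finally show ?thesis .
qed

theorem conformal_p_uniform:
  assumes s: "s \<in> borel_measurable P0"
  shows "distr \<Omega> unifs (\<lambda>\<omega>. \<lambda>t\<in>{1..}. conformal_p s \<omega> t) = unifs"
proof -
  interpret PU: product_prob_space "\<lambda>_. unif01" "{1::nat..}"
    by (rule product_prob_space_unif01)
  note m = measurable_conformal_seq[OF s]
  show ?thesis
  proof (rule PU.PiM_eq)
    fix J :: "nat set" and F assume J: "finite J" "J \<subseteq> {1..}" and F: "\<And>j. j \<in> J \<Longrightarrow> F j \<in> sets unif01"
    \<comment> \<open>The joint formula concerns initial segments, so the coordinates outside
      \<open>J\<close> are padded with the whole space, of measure 1.\<close>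
    define A where "A t = (if t \<in> J then F t else space unif01)" for t
    obtain n where n: "J \<subseteq> {1..n}"
      using J finite_nat_set_iff_bounded_le[of J] by (force simp: subset_eq)
    have A: "A t \<in> sets unif01" for t using F sets.top[of unif01] by (auto simp: A_def simp del: space_unif01)
    let ?E = "prod_emb {1..} (\<lambda>_. unif01) J (Pi\<^sub>E J F)" and ?p = "\<lambda>\<omega>. \<lambda>t\<in>{1..}. conformal_p s \<omega> t"
    have E: "?E \<in> sets unifs"
      using J F by (intro sets_PiM_I) auto
    have "emeasure (distr \<Omega> unifs ?p) ?E
      = emeasure \<Omega> (?p -` ?E \<inter> space \<Omega>)"
      by (rule emeasure_distr[OF m E])
    also have "?p -` ?E \<inter> space \<Omega>
      = {\<omega>\<in>space \<Omega>. \<forall>t\<in>{1..n}. conformal_p s \<omega> t \<in> A t}" (is "?l = ?r")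
    proof (rule set_eqI)
      fix \<omega>
      show "\<omega> \<in> ?l \<longleftrightarrow> \<omega> \<in> ?r"
      proof (cases "\<omega> \<in> space \<Omega>")
        case True
        have rng: "conformal_p s \<omega> t \<in> {0..1}" if "1 \<le> t" for t
          using randomizer_space[OF True that] that by (intro conformal_p_range)
        have "\<omega> \<in> ?l \<longleftrightarrow> (\<forall>t\<in>J. conformal_p s \<omega> t \<in> F t)"
          using True J rng unfolding prod_emb_def
          by (auto simp: PiE_iff subset_eq simp del: atLeastAtMost_iff)
        also have "\<dots> \<longleftrightarrow> \<omega> \<in> ?r"
          using True n rng by (auto simp: A_def subset_eq simp del: atLeastAtMost_iff) auto
        finally show ?thesis .
      qed auto
    qed
    also have "emeasure \<Omega> \<dots> = (\<Prod>t\<in>{1..n}. emeasure unif01 (A t))"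
      by (rule conformal_p_joint[OF s A])
    also have "\<dots> = (\<Prod>t\<in>J. emeasure unif01 (F t))"
      using n PU.M.emeasure_space_1 by (intro prod.mono_neutral_cong_right) (auto simp: A_def)
    finally show "emeasure (distr \<Omega> unifs ?p) ?E = (\<Prod>t\<in>J. emeasure unif01 (F t))" .
  qed simp
qed

end

section \<open>Ville's inequality for the restart rules\<close>

lemma Inf_enat_le_iff: "Inf {enat t |t. P t} \<le> enat n \<longleftrightarrow> (\<exists>t\<le>n. P t)"
proof
  assume le: "Inf {enat t |t. P t} \<le> enat n"
  then have "{enat t |t. P t} \<noteq> {}" by (metis Inf_enat_def infinity_ileE)
  then have "Inf {enat t |t. P t} \<in> {enat t |t. P t}"
    unfolding Inf_enat_def by (auto intro: LeastI)
  then show "\<exists>t\<le>n. P t" using le by auto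
next
  assume "\<exists>t\<le>n. P t"
  then obtain t where "t \<le> n" "P t" by blast
  then have "Inf {enat t |t. P t} \<le> enat t" by (intro Inf_lower) auto
  also have "enat t \<le> enat n" using \<open>t \<le> n\<close> by simp
  finally show "Inf {enat t |t. P t} \<le> enat n" .
qed

lemma (in base_measure) first_time_in_rand_times:
  assumes C: "\<And>t. 1 \<le> t \<Longrightarrow> {\<omega>\<in>space \<Omega>. C t \<omega>} \<in> sets (rand_filtration P0 (enat t))"
  shows "(\<lambda>\<omega>. Inf {enat t |t. 1 \<le> t \<and> C t \<omega>}) \<in> rand_times P0"
  unfolding rand_times_def
proof (intro CollectI stopping_timeI)
  fix u :: enat
  show "Measurable.pred (rand_filtration P0 u) (\<lambda>\<omega>. Inf {enat t |t. 1 \<le> t \<and> C t \<omega>} \<le> u)"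
  proof (cases u)
    case (enat n)
    have "{\<omega>\<in>space \<Omega>. Inf {enat t |t. 1 \<le> t \<and> C t \<omega>} \<le> u} = (\<Union>t\<in>{1..n}. {\<omega>\<in>space \<Omega>. C t \<omega>})"
      unfolding enat Inf_enat_le_iff by auto
    also have "\<dots> \<in> sets (rand_filtration P0 u)"
    proof (intro sets.finite_UN)
      fix t assume t: "t \<in> {1..n}"
      then have "enat t \<le> u" by (simp add: enat)
      from rand_filtration_mono[OF this] C[of t] t
      show "{\<omega>\<in>space \<Omega>. C t \<omega>} \<in> sets (rand_filtration P0 u)" by auto
    qed simp
    finally show ?thesis by (simp add: pred_def)
  qed simp
qed

section \<open>The restart weights\<close>

lemma ln_exp_1_add_pos: "0 < ln (exp 1 + real k)"
  using exp_gt_one[of "1::real"] by (intro ln_gt_zero) linarith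

text \<open>An integral test by telescoping: \<open>- inverse (ln x)\<close> has derivative
  \<open>inverse (x * (ln x)^2)\<close>, and the mean value theorem compares each term with an
  increment of \<open>\<phi>\<close>. The factor 4 comes from e + (l + 1) being at most 4 (l + 1),
  as e is at most 3.\<close>

lemma nh_terms_summable: "summable (\<lambda>l. inverse (real (Suc l) * (ln (exp 1 + real (Suc l)))\<^sup>2))"
proof (rule summable_comparison_test'[where N=0])
  define \<phi> where "\<phi> l = inverse (ln (exp 1 + real l))" for l
  have e1: "1 < exp 1 + real l" for l
    using exp_gt_one[of "1::real"] by linarith
  have "\<phi> \<longlonglongrightarrow> 0" unfolding \<phi>_def by real_asymp
  from telescope_summable'[OF this] have "summable (\<lambda>l. \<phi> l - \<phi> (Suc l))" .
  then show "summable (\<lambda>l. 4 * (\<phi> l - \<phi> (Suc l)))" by (rule summable_mult)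
  fix l :: nat
  let ?x = "exp 1 + real l" and ?y = "exp 1 + real (Suc l)"
  have deriv: "((\<lambda>x. - inverse (ln x)) has_real_derivative inverse (x * (ln x)\<^sup>2)) (at x)" if "1 < x" for x :: real
    using that by (auto intro!: derivative_eq_intros simp: power2_eq_square field_simps)
  obtain z where z: "?x < z" "z < ?y"
    "- inverse (ln ?y) - (- inverse (ln ?x)) = (?y - ?x) * inverse (z * (ln z)\<^sup>2)"
    using MVT2[of ?x ?y "\<lambda>x. - inverse (ln x)" "\<lambda>x. inverse (x * (ln x)\<^sup>2)"] deriv e1[of l]
    by (auto intro: order.strict_trans1 order.strict_trans2)
  have z1: "1 < z" using e1[of l] z by linarith
  have "(ln z)\<^sup>2 \<le> (ln ?y)\<^sup>2"
    using z z1 by (intro power_mono) auto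
  then have "z * (ln z)\<^sup>2 \<le> ?y * (ln ?y)\<^sup>2"
    using z z1 by (intro mult_mono) auto
  also have "?y \<le> 4 * real (Suc l)"
    using exp_le by simp
  then have "?y * (ln ?y)\<^sup>2 \<le> 4 * (real (Suc l) * (ln ?y)\<^sup>2)"
    using mult_right_mono[of ?y "4 * real (Suc l)" "(ln ?y)\<^sup>2"] by (simp only: mult.assoc zero_le_power2)
  finally have le: "z * (ln z)\<^sup>2 \<le> 4 * (real (Suc l) * (ln ?y)\<^sup>2)" .
  have "0 < ln z" using z1 by simp
  then have "0 < z * (ln z)\<^sup>2" using z1 by simp
  from le_imp_inverse_le[OF le this]
  have "inverse (real (Suc l) * (ln ?y)\<^sup>2) \<le> 4 * inverse (z * (ln z)\<^sup>2)"
    by (simp only: inverse_mult_distrib[of 4]) simp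
  also have "inverse (z * (ln z)\<^sup>2) = \<phi> l - \<phi> (Suc l)" using z(3) unfolding \<phi>_def by simp
  finally show "norm (inverse (real (Suc l) * (ln ?y)\<^sup>2)) \<le> 4 * (\<phi> l - \<phi> (Suc l))"
    by (simp add: abs_mult)
qed

lemma nh_const_pos: "0 < nh_const"
  unfolding nh_const_def
proof (rule positive_imp_inverse_positive, rule suminf_pos[OF nh_terms_summable])
  show "0 < inverse (real (Suc l) * (ln (exp 1 + real (Suc l)))\<^sup>2)" for l
    using ln_exp_1_add_pos[of "Suc l"] by simp
qed

lemma nh_weight_nonneg: "0 \<le> nh_weight k"
  using nh_const_pos by (simp add: nh_weight_def)

lemma nh_weight_sum_le: "(\<Sum>k\<in>{1..n}. nh_weight k) \<le> 1"
proof -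
  let ?g = "\<lambda>l. inverse (real (Suc l) * (ln (exp 1 + real (Suc l)))\<^sup>2)"
  have "(\<Sum>k\<in>{1..n}. nh_weight k) = nh_const * (\<Sum>l<n. ?g l)"
    by (simp add: nh_weight_def sum_distrib_left[symmetric] sum.atLeast1_atMost_eq)
  also have "\<dots> \<le> nh_const * suminf ?g"
    using nh_const_pos by (intro mult_left_mono sum_le_suminf nh_terms_summable) auto
  also have "\<dots> = 1" using nh_const_pos unfolding nh_const_def by (simp del: of_nat_Suc)
  finally show ?thesis .
qed

section \<open>Mixture martingales for independent uniform variables\<close>

locale betting =
  fixes f :: "'b \<Rightarrow> real \<Rightarrow> real" and \<mu> :: "'b measure"
  assumes bp: "betting_pair f \<mu>"
begin

sublocale \<mu>: prob_space \<mu>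
  using bp by (simp add: betting_pair_def)

lemma f_nonneg: "\<theta> \<in> space \<mu> \<Longrightarrow> z \<in> {0..1} \<Longrightarrow> 0 \<le> f \<theta> z"
  and f_density: "\<theta> \<in> space \<mu> \<Longrightarrow> (\<integral>\<^sup>+z. ennreal (f \<theta> z) \<partial>unif01) = 1"
  and f_joint: "(\<lambda>(\<theta>, z). f \<theta> z) \<in> borel_measurable (\<mu> \<Otimes>\<^sub>M unif01)"
  using bp by (auto simp: betting_pair_def)

lemma measurable_f_comp:
  assumes "T \<in> M \<rightarrow>\<^sub>M \<mu>" "Z \<in> M \<rightarrow>\<^sub>M unif01"
  shows "(\<lambda>x. f (T x) (Z x)) \<in> borel_measurable M"
  using measurable_compose[OF measurable_Pair[OF assms] f_joint] by simp

lemma measurable_mixture: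
  assumes p: "\<And>j. j \<in> J \<Longrightarrow> (\<lambda>x. p x j) \<in> M \<rightarrow>\<^sub>M unif01"
  shows "(\<lambda>x. mixture f \<mu> J (p x)) \<in> borel_measurable M"
proof -
  have "(\<lambda>(x, \<theta>). \<Prod>j\<in>J. f \<theta> (p x j)) \<in> borel_measurable (M \<Otimes>\<^sub>M \<mu>)"
    unfolding case_prod_beta'
  proof (intro borel_measurable_prod measurable_f_comp)
    show "(\<lambda>y. p (fst y) j) \<in> M \<Otimes>\<^sub>M \<mu> \<rightarrow>\<^sub>M unif01" if "j \<in> J" for j
      using measurable_compose[OF measurable_fst p[OF that]] .
  qed simp
  then have "(\<lambda>(x, \<theta>). ennreal (\<Prod>j\<in>J. f \<theta> (p x j))) \<in> borel_measurable (M \<Otimes>\<^sub>M \<mu>)"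
    unfolding case_prod_beta' by measurable
  then show ?thesis
    unfolding mixture_def by (rule \<mu>.borel_measurable_nn_integral)
qed

lemma mixture_cong: "(\<And>j. j \<in> J \<Longrightarrow> p j = q j) \<Longrightarrow> mixture f \<mu> J p = mixture f \<mu> J q"
  unfolding mixture_def by (simp cong: prod.cong)

lemma mixture_empty [simp]: "mixture f \<mu> {} p = 1"
  by (simp add: mixture_def \<mu>.emeasure_space_1)

lemma measurable_mixture_unifs:
  "1 \<le> k \<Longrightarrow> (\<lambda>u. mixture f \<mu> {k..t} u) \<in> borel_measurable unifs"
  by (intro measurable_mixture measurable_component_singleton) auto

text \<open>\<open>g\<close> plays the part of a test function known at time t. Integrating out
  coordinate \<open>Suc t\<close> under the mixture removes one factor, as every
  \<open>f \<theta>\<close> has integral 1. Before the restart, for \<open>k > Suc t\<close>, both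
  mixtures are empty products equal to 1.\<close>

lemma mixture_martingale_step:
  assumes k: "1 \<le> k" and g: "g \<in> borel_measurable unifs"
    and indep: "\<And>u v. g (u(Suc t := v)) = g u"
  shows "(\<integral>\<^sup>+u. g u * mixture f \<mu> {k..Suc t} u \<partial>unifs) = (\<integral>\<^sup>+u. g u * mixture f \<mu> {k..t} u \<partial>unifs)"
proof (cases "k \<le> Suc t")
  case False
  then show ?thesis by simp
next
  case True
  let ?R = "PiM ({1..} - {Suc t}) (\<lambda>_. unif01) :: (nat \<Rightarrow> real) measure"
  interpret u: prob_space unif01 by (rule prob_space_unif01)
  interpret pair_sigma_finite unif01 \<mu> ..
  have gM: "(\<lambda>u. g u * mixture f \<mu> {k..s} u) \<in> borel_measurable unifs" for s
    by (intro borel_measurable_times_ennreal g measurable_mixture_unifs k)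
  have inner: "(\<integral>\<^sup>+v. g (X(Suc t := v)) * mixture f \<mu> {k..Suc t} (X(Suc t := v)) \<partial>unif01)
      = (\<integral>\<^sup>+v. g (X(Suc t := v)) * mixture f \<mu> {k..t} (X(Suc t := v)) \<partial>unif01)" if X: "X \<in> space ?R" for X
  proof -
    let ?p = "\<lambda>\<theta>. \<Prod>j\<in>{k..t}. f \<theta> (X j)"
    have Xj: "X j \<in> {0..1}" if "j \<in> {k..t}" for j
      using X that k by (auto simp: space_PiM dest!: PiE_mem[where x=j])
    have m1: "?p \<in> borel_measurable \<mu>"
      using Xj by (intro borel_measurable_prod measurable_f_comp measurable_const measurable_ident_sets) auto
    have split: "mixture f \<mu> {k..Suc t} (X(Suc t := v))
        = (\<integral>\<^sup>+\<theta>. ennreal (?p \<theta>) * ennreal (f \<theta> v) \<partial>\<mu>)" if v: "v \<in> {0..1}" for v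
      unfolding mixture_def
    proof (rule nn_integral_cong)
      fix \<theta> assume \<theta>: "\<theta> \<in> space \<mu>"
      have "{k..Suc t} = insert (Suc t) {k..t}" using True by auto
      then have "(\<Prod>j\<in>{k..Suc t}. f \<theta> ((X(Suc t := v)) j)) = f \<theta> v * ?p \<theta>"
        using prod.cong[of "{k..t}" "{k..t}" "\<lambda>j. f \<theta> ((X(Suc t := v)) j)" "\<lambda>j. f \<theta> (X j)"] by simp
      moreover have "0 \<le> f \<theta> v" "0 \<le> ?p \<theta>"
        using \<theta> v Xj by (auto intro!: prod_nonneg f_nonneg)
      ultimately show "ennreal (\<Prod>j\<in>{k..Suc t}. f \<theta> ((X(Suc t := v)) j))
        = ennreal (?p \<theta>) * ennreal (f \<theta> v)"
        by (simp only: ennreal_mult mult.commute)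
    qed
    have "(\<integral>\<^sup>+v. mixture f \<mu> {k..Suc t} (X(Suc t := v)) \<partial>unif01)
      = (\<integral>\<^sup>+v. \<integral>\<^sup>+\<theta>. ennreal (?p \<theta>) * ennreal (f \<theta> v) \<partial>\<mu> \<partial>unif01)"
      using split by (intro nn_integral_cong) simp
    also have "\<dots> = (\<integral>\<^sup>+\<theta>. \<integral>\<^sup>+v. ennreal (?p \<theta>) * ennreal (f \<theta> v) \<partial>unif01 \<partial>\<mu>)"
    proof (rule Fubini'[symmetric])
      have "(\<lambda>y. ?p (snd y)) \<in> borel_measurable (unif01 \<Otimes>\<^sub>M \<mu>)"
        by (rule measurable_compose[OF measurable_snd m1])
      moreover have "(\<lambda>y. f (snd y) (fst y)) \<in> borel_measurable (unif01 \<Otimes>\<^sub>M \<mu>)"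
        by (intro measurable_f_comp measurable_snd measurable_fst)
      ultimately show "(\<lambda>(v, \<theta>). ennreal (?p \<theta>) * ennreal (f \<theta> v)) \<in> borel_measurable (unif01 \<Otimes>\<^sub>M \<mu>)"
        unfolding case_prod_beta' by measurable
    qed
    also have "\<dots> = (\<integral>\<^sup>+\<theta>. ennreal (?p \<theta>) \<partial>\<mu>)"
    proof (rule nn_integral_cong)
      fix \<theta> assume \<theta>: "\<theta> \<in> space \<mu>"
      have "(\<lambda>v. f \<theta> v) \<in> borel_measurable unif01"
        using \<theta> by (intro measurable_f_comp measurable_const measurable_ident_sets) auto
      then show "(\<integral>\<^sup>+v. ennreal (?p \<theta>) * ennreal (f \<theta> v) \<partial>unif01) = ennreal (?p \<theta>)"
        using f_density[OF \<theta>] by (simp add: nn_integral_cmult)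
    qed
    finally have "(\<integral>\<^sup>+v. mixture f \<mu> {k..Suc t} (X(Suc t := v)) \<partial>unif01) = mixture f \<mu> {k..t} X"
      by (simp add: mixture_def)
    moreover have "mixture f \<mu> {k..t} (X(Suc t := v)) = mixture f \<mu> {k..t} X" for v
      by (rule mixture_cong) auto
    moreover have "(\<lambda>v. mixture f \<mu> {k..Suc t} (X(Suc t := v))) \<in> borel_measurable unif01"
    proof (rule measurable_mixture)
      fix j assume j: "j \<in> {k..Suc t}"
      show "(\<lambda>v. (X(Suc t := v)) j) \<in> unif01 \<rightarrow>\<^sub>M unif01"
        using Xj[of j] j by (cases "j = Suc t") auto
    qed
    ultimately show ?thesis
      unfolding indep by (simp add: nn_integral_cmult u.emeasure_space_1[unfolded space_unif01])
  qed
  show ?thesis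
    using nn_integral_PiM_update(1)[OF prob_space_unif01 _ gM, of "Suc t" "Suc t"]
      nn_integral_PiM_update(1)[OF prob_space_unif01 _ gM, of "Suc t" t]
      nn_integral_cong[OF inner] by simp
qed

lemma mixture_martingale:
  assumes k: "1 \<le> k" and g: "g \<in> borel_measurable unifs" and tn: "t \<le> n"
    and indep: "\<And>i u v. t < i \<Longrightarrow> g (u(i := v)) = g u"
  shows "(\<integral>\<^sup>+u. g u * mixture f \<mu> {k..n} u \<partial>unifs) = (\<integral>\<^sup>+u. g u * mixture f \<mu> {k..t} u \<partial>unifs)"
  using tn
proof (induction n rule: dec_induct)
  case (step n)
  then show ?case using mixture_martingale_step[OF k g, of n] indep by simp
qed simp

definition weighted_sum :: "nat \<Rightarrow> (nat \<Rightarrow> real) \<Rightarrow> ennreal" where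
  "weighted_sum t u = (\<Sum>k=1..t. ennreal (nh_weight k) * mixture f \<mu> {k..t} u)"

lemma measurable_weighted_sum: "weighted_sum t \<in> borel_measurable unifs"
  unfolding weighted_sum_def
  by (intro borel_measurable_sum borel_measurable_times_ennreal borel_measurable_const measurable_mixture_unifs) auto

lemma weighted_sum_cong: "(\<And>j. j \<in> {1..t} \<Longrightarrow> p j = q j) \<Longrightarrow> weighted_sum t p = weighted_sum t q"
  unfolding weighted_sum_def by (intro sum.cong refl arg_cong2[where f="(*)"] mixture_cong) auto

text \<open>Ville's inequality for \<open>\<Sum>k\<le>n. w k * M k t\<close>, a nonnegative martingale in \<open>t \<le> n\<close> with mean at
  most \<open>1\<close> that dominates the weighted sum, because \<open>M k t\<close> is an empty product for \<open>t < k\<close>.\<close>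

lemma weighted_sum_ville:
  assumes b: "0 < b"
  shows "ennreal b * emeasure unifs {u\<in>space unifs. \<exists>t\<in>{1..n}. ennreal b \<le> weighted_sum t u} \<le> 1"
proof -
  interpret prob_space unifs by (rule prob_space_unifs)
  define A where "A t = {u\<in>space unifs. ennreal b \<le> weighted_sum t u \<and> (\<forall>s\<in>{1..<t}. \<not> ennreal b \<le> weighted_sum s u)}" for t
  \<comment> \<open>Unlike the indicator of \<open>A t\<close>, this one does not test membership in
    the space, so changing a later coordinate to an arbitrary value leaves it unchanged.\<close>
  define I where "I t u = (indicator {u. ennreal b \<le> weighted_sum t u \<and> (\<forall>s\<in>{1..<t}. \<not> ennreal b \<le> weighted_sum s u)} u :: ennreal)" for t u
  let ?C = "\<lambda>t. {u\<in>space unifs. ennreal b \<le> weighted_sum t u}"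
  have Cm: "?C t \<in> events" for t
    using measurable_weighted_sum[of t] by measurable
  have Am: "A t \<in> events" for t
  proof -
    have "A t = ?C t - (\<Union>s\<in>{1..<t}. ?C s)"
      unfolding A_def by auto
    then show ?thesis using Cm by auto
  qed
  have IA: "I t u = indicator (A t) u" if "u \<in> space unifs" for t u
    using that by (simp add: I_def A_def indicator_def)
  have Im: "I t \<in> borel_measurable unifs" for t
    using measurable_cong[of unifs "I t" "indicator (A t)" borel] IA Am by auto
  have I_indep: "I t (u(i := v)) = I t u" if "t < i" for t i u v
  proof -
    have "weighted_sum s (u(i := v)) = weighted_sum s u" if "s \<le> t" for s
      using that \<open>t < i\<close> by (intro weighted_sum_cong) auto
    then show ?thesis unfolding I_def indicator_def by auto
  qed
  have union: "{u\<in>space unifs. \<exists>t\<in>{1..n}. ennreal b \<le> weighted_sum t u} = (\<Union>t\<in>{1..n}. A t)"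
  proof (intro subset_antisym subsetI)
    fix u assume u: "u \<in> {u\<in>space unifs. \<exists>t\<in>{1..n}. ennreal b \<le> weighted_sum t u}"
    define t where "t = (LEAST t. t \<in> {1..n} \<and> ennreal b \<le> weighted_sum t u)"
    have ex: "\<exists>t. t \<in> {1..n} \<and> ennreal b \<le> weighted_sum t u" using u by auto
    have t: "t \<in> {1..n} \<and> ennreal b \<le> weighted_sum t u"
      unfolding t_def by (rule LeastI_ex[OF ex])
    have "\<not> ennreal b \<le> weighted_sum s u" if "s \<in> {1..<t}" for s
      using not_less_Least[of s "\<lambda>t. t \<in> {1..n} \<and> ennreal b \<le> weighted_sum t u"] that t
      unfolding t_def[symmetric] by auto
    then show "u \<in> (\<Union>t\<in>{1..n}. A t)" using t u by (auto simp: A_def)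
  qed (auto simp: A_def)
  have disj: "disjoint_family_on A {1..n}"
    unfolding disjoint_family_on_def
  proof (intro ballI impI)
    fix s t assume "s \<in> {1..n}" "t \<in> {1..n}" "s \<noteq> t"
    then show "A s \<inter> A t = {}" unfolding A_def by (cases "s < t") auto
  qed
  let ?J = "\<lambda>t k. \<integral>\<^sup>+u. I t u * mixture f \<mu> {k..n} u \<partial>unifs"
  \<comment> \<open>First passage at t is decided by the first t coordinates, so on
    \<open>A t\<close> the value of each factor at t may be exchanged for its terminal value at n.
    The terminal value no longer depends on t, and the disjoint events can be summed.\<close>
  have w: "(\<integral>\<^sup>+u. I t u * mixture f \<mu> {k..t} u \<partial>unifs) = ?J t k"
    if "t \<in> {1..n}" "k \<in> {1..n}" for t k
    using that I_indep by (intro mixture_martingale[symmetric] Im) auto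
  have IMm: "(\<lambda>u. I t u * mixture f \<mu> {k..s} u) \<in> borel_measurable unifs" if "k \<in> {1..n}" for t k s
    using that by (intro borel_measurable_times_ennreal Im measurable_mixture_unifs) auto
  have "ennreal b * emeasure unifs (\<Union>t\<in>{1..n}. A t) = (\<Sum>t\<in>{1..n}. ennreal b * emeasure unifs (A t))"
    using Am disj by (subst sum_emeasure[symmetric]) (auto simp: sum_distrib_left)
  also have "\<dots> \<le> (\<Sum>t\<in>{1..n}. \<Sum>k\<in>{1..n}. ennreal (nh_weight k) * ?J t k)"
  proof (rule sum_mono)
    fix t assume t: "t \<in> {1..n}"
    have "ennreal b * emeasure unifs (A t) = (\<integral>\<^sup>+u. ennreal b * indicator (A t) u \<partial>unifs)"
      using Am by (simp add: nn_integral_cmult)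
    also have "\<dots> \<le> (\<integral>\<^sup>+u. (\<Sum>k\<in>{1..n}. ennreal (nh_weight k) * (I t u * mixture f \<mu> {k..t} u)) \<partial>unifs)"
    proof (rule nn_integral_mono)
      fix u assume u: "u \<in> space unifs"
      show "ennreal b * indicator (A t) u \<le> (\<Sum>k\<in>{1..n}. ennreal (nh_weight k) * (I t u * mixture f \<mu> {k..t} u))"
      proof (cases "u \<in> A t")
        case True
        then have "ennreal b \<le> weighted_sum t u" by (simp add: A_def)
        also have "\<dots> \<le> (\<Sum>k\<in>{1..n}. ennreal (nh_weight k) * mixture f \<mu> {k..t} u)"
          unfolding weighted_sum_def using t by (intro sum_mono2) auto
        finally show ?thesis using True u by (simp add: IA)
      qed simp
    qed
    also have "\<dots> = (\<Sum>k\<in>{1..n}. ennreal (nh_weight k) * (\<integral>\<^sup>+u. I t u * mixture f \<mu> {k..t} u \<partial>unifs))"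
      using IMm by (subst nn_integral_sum)
        (auto intro!: sum.cong nn_integral_cmult borel_measurable_times_ennreal[OF borel_measurable_const] simp del: One_nat_def)
    also have "\<dots> = (\<Sum>k\<in>{1..n}. ennreal (nh_weight k) * ?J t k)"
      using w[OF t] by (intro sum.cong) auto
    finally show "ennreal b * emeasure unifs (A t) \<le> (\<Sum>k\<in>{1..n}. ennreal (nh_weight k) * ?J t k)" .
  qed
  also have "\<dots> = (\<Sum>k\<in>{1..n}. ennreal (nh_weight k) * (\<Sum>t\<in>{1..n}. ?J t k))"
    by (subst sum.swap) (simp add: sum_distrib_left)
  also have "\<dots> \<le> (\<Sum>k\<in>{1..n}. ennreal (nh_weight k))"
  proof (rule sum_mono)
    fix k assume k: "k \<in> {1..n}"
    have "(\<Sum>t\<in>{1..n}. ?J t k)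
        = (\<integral>\<^sup>+u. (\<Sum>t\<in>{1..n}. I t u * mixture f \<mu> {k..n} u) \<partial>unifs)"
      using IMm[OF k] by (intro nn_integral_sum[symmetric])
    also have "\<dots> \<le> (\<integral>\<^sup>+u. 1 * mixture f \<mu> {k..n} u \<partial>unifs)"
    proof (rule nn_integral_mono)
      fix u assume u: "u \<in> space unifs"
      have "(\<Sum>t\<in>{1..n}. I t u) = (\<Sum>t\<in>{1..n}. indicator (A t) u)"
        by (intro sum.cong refl IA u)
      also have "\<dots> = (indicator (\<Union>t\<in>{1..n}. A t) u :: ennreal)"
        by (rule indicator_UN_disjoint[symmetric, OF finite_atLeastAtMost disj])
      also have "\<dots> \<le> 1" by (simp add: indicator_def)
      finally show "(\<Sum>t\<in>{1..n}. I t u * mixture f \<mu> {k..n} u) \<le> 1 * mixture f \<mu> {k..n} u"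
        unfolding sum_distrib_right[symmetric] by (intro mult_right_mono) auto
    qed
    \<comment> \<open>At time 0 the index set \<open>{k..0}\<close> is empty, so the martingale
      starts at 1.\<close>
    also have "\<dots> = (\<integral>\<^sup>+u. 1 * mixture f \<mu> {k..0} u \<partial>unifs)"
      using k by (intro mixture_martingale) auto
    also have "\<dots> = 1" using k emeasure_space_1 by simp
    finally have "ennreal (nh_weight k) * (\<Sum>t\<in>{1..n}. ?J t k) \<le> ennreal (nh_weight k) * 1"
      by (intro mult_left_mono) auto
    then show "ennreal (nh_weight k) * (\<Sum>t\<in>{1..n}. ?J t k) \<le> ennreal (nh_weight k)"
      by simp
  qed
  also have "\<dots> = ennreal (\<Sum>k\<in>{1..n}. nh_weight k)"
    by (intro sum_ennreal nh_weight_nonneg)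
  also have "\<dots> \<le> ennreal 1" using nh_weight_sum_le by (intro ennreal_leI)
  finally show ?thesis unfolding union by simp
qed

end

section \<open>The two restart rules as stopping times\<close>

locale conformal_rule = base_measure P0 + betting f \<mu>
  for P0 :: "'a measure" and f :: "'b \<Rightarrow> real \<Rightarrow> real" and \<mu> :: "'b measure" +
  fixes s :: "'a \<Rightarrow> real" and b :: real
  assumes s: "s \<in> borel_measurable P0" and b: "0 < b"
begin

abbreviation rules :: "('a outcome \<Rightarrow> enat) set" where
  "rules \<equiv> {restart_max s f \<mu> nh_weight b, restart_sum s f \<mu> nh_weight b}"

lemma measurable_restart_mart:
  assumes "1 \<le> k" "t \<le> n"
  shows "restart_mart s f \<mu> k t \<in> borel_measurable (rand_filtration P0 (enat n))"
  unfolding restart_mart_def using assms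
  by (intro measurable_mixture measurable_conformal_p s) auto

abbreviation weighted_mart :: "nat \<Rightarrow> nat \<Rightarrow> 'a outcome \<Rightarrow> ennreal" where
  "weighted_mart k t \<equiv> \<lambda>\<omega>. ennreal (nh_weight k) * restart_mart s f \<mu> k t \<omega>"

lemma rules_in_rand_times: "rules \<subseteq> rand_times P0"
proof -
  have m: "weighted_mart k t \<in> borel_measurable (rand_filtration P0 (enat t))"
    if "1 \<le> k" for k t
    using that by (intro borel_measurable_times_ennreal borel_measurable_const measurable_restart_mart) auto
  have "restart_max s f \<mu> nh_weight b \<in> rand_times P0"
    unfolding restart_max_def[abs_def]
  proof (rule first_time_in_rand_times)
    fix t :: nat assume t: "1 \<le> t"
    have "{\<omega>\<in>space \<Omega>. ennreal b \<le> (MAX k\<in>{1..t}. weighted_mart k t \<omega>)}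
        = (\<Union>k\<in>{1..t}. {\<omega>\<in>space (rand_filtration P0 (enat t)). ennreal b \<le> weighted_mart k t \<omega>})"
      using t by (subst Max_ge_iff) auto
    also have "\<dots> \<in> sets (rand_filtration P0 (enat t))"
      using m by (intro sets.finite_UN borel_measurable_le) auto
    finally show "{\<omega>\<in>space \<Omega>. ennreal b \<le> (MAX k\<in>{1..t}. weighted_mart k t \<omega>)}
        \<in> sets (rand_filtration P0 (enat t))" .
  qed
  moreover have "restart_sum s f \<mu> nh_weight b \<in> rand_times P0"
    unfolding restart_sum_def[abs_def]
  proof (rule first_time_in_rand_times)
    fix t :: nat assume t: "1 \<le> t"
    have "(\<lambda>\<omega>. \<Sum>k=1..t. weighted_mart k t \<omega>) \<in> borel_measurable (rand_filtration P0 (enat t))"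
      using m by (intro borel_measurable_sum) auto
    then show "{\<omega>\<in>space \<Omega>. ennreal b \<le> (\<Sum>k=1..t. weighted_mart k t \<omega>)}
        \<in> sets (rand_filtration P0 (enat t))"
      unfolding space_rand_filtration[of "enat t", symmetric] by measurable
  qed
  ultimately show ?thesis by auto
qed

text \<open>A maximum of nonnegative terms is at most their sum, so an alarm of either rule lifts
  the weighted sum over the level, and one false alarm bound serves both rules.\<close>

lemma rule_le_imp_sum:
  assumes "\<tau> \<in> rules" "\<tau> \<omega> \<le> enat n"
  shows "\<exists>t\<in>{1..n}. ennreal b \<le> weighted_sum t (conformal_p s \<omega>)"
proof -
  have ws: "weighted_sum t (conformal_p s \<omega>) = (\<Sum>k=1..t. weighted_mart k t \<omega>)" for t
    by (simp add: weighted_sum_def restart_mart_def)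
  have "(MAX k\<in>{1..t}. weighted_mart k t \<omega>) \<le> weighted_sum t (conformal_p s \<omega>)"
    if "1 \<le> t" for t
    unfolding ws using that by (intro Max.boundedI) (auto intro: member_le_sum)
  moreover obtain t where "t \<le> n" "1 \<le> t"
    "ennreal b \<le> (MAX k\<in>{1..t}. weighted_mart k t \<omega>)
     \<or> ennreal b \<le> weighted_sum t (conformal_p s \<omega>)"
    using assms unfolding restart_max_def restart_sum_def ws by (auto simp: Inf_enat_le_iff)
  ultimately show ?thesis by (intro bexI[of _ t]) (auto intro: order.trans)
qed

text \<open>One term above the level stops both rules. The delay bound uses it for the factor
  restarted at \<open>Suc T\<close>.\<close>

lemma rule_leI:
  assumes "\<tau> \<in> rules" "k \<in> {1..t}" "ennreal b \<le> weighted_mart k t \<omega>"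
  shows "\<tau> \<omega> \<le> enat t"
proof -
  have "ennreal b \<le> (MAX k\<in>{1..t}. weighted_mart k t \<omega>)"
    using assms by (subst Max_ge_iff) auto
  moreover have "ennreal b \<le> (\<Sum>k=1..t. weighted_mart k t \<omega>)"
    using assms(2) by (intro order.trans[OF assms(3)] member_le_sum) auto
  ultimately show ?thesis
    using assms(1,2) unfolding restart_max_def restart_sum_def by (auto simp: Inf_enat_le_iff intro!: exI[of _ t])
qed

text \<open>The rules see the data only through the p-values, whose joint law without a change is
  \<open>unifs\<close>. An alarm by time n is thus contained in an event to which
  \<open>weighted_sum_ville\<close> applies, and continuity from below removes the horizon.\<close>

theorem rule_false_alarm:
  assumes \<tau>: "\<tau> \<in> rules"
  shows "measure \<Omega> {\<omega>\<in>space \<Omega>. \<tau> \<omega> < \<infinity>} \<le> 1 / b"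
proof -
  interpret X: prob_space PX using prob_P0 by (intro prob_space_PiM) auto
  interpret U: prob_space unifs by (rule prob_space_unifs)
  interpret pair_prob_space PX unifs ..
  let ?A = "\<lambda>n. {\<omega>\<in>space \<Omega>. \<tau> \<omega> \<le> enat n}"
  let ?p = "\<lambda>\<omega>. \<lambda>t\<in>{1..}. conformal_p s \<omega> t"
  note m = measurable_conformal_seq[OF s]
  have \<tau>m: "?A n \<in> sets \<Omega>" for n
    using rand_time_le[OF _ order.refl] rules_in_rand_times \<tau> rand_filtration_subset by blast
  have fin: "P.prob (?A n) \<le> 1 / b" for n
  proof -
    define B where "B = {u\<in>space unifs. \<exists>t\<in>{1..n}. ennreal b \<le> weighted_sum t u}"
    have Bm: "B \<in> sets unifs"
    proof -
      have "B = (\<Union>t\<in>{1..n}. {u\<in>space unifs. ennreal b \<le> weighted_sum t u})" unfolding B_def by auto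
      then show ?thesis using measurable_weighted_sum by (simp add: sets.finite_UN)
    qed
    have "?A n \<subseteq> ?p -` B \<inter> space \<Omega>"
    proof
      fix \<omega> assume "\<omega> \<in> ?A n"
      then have \<omega>: "\<omega> \<in> space \<Omega>" "\<tau> \<omega> \<le> enat n" by simp_all
      obtain t where t: "t \<in> {1..n}" "ennreal b \<le> weighted_sum t (conformal_p s \<omega>)"
        using rule_le_imp_sum[OF \<tau> \<omega>(2)] by blast
      have "weighted_sum t (?p \<omega>) = weighted_sum t (conformal_p s \<omega>)"
        by (rule weighted_sum_cong) auto
      then have "?p \<omega> \<in> B" using t measurable_space[OF m \<omega>(1)]
        unfolding B_def by (intro CollectI conjI bexI[of _ t]) simp_all
      then show "\<omega> \<in> ?p -` B \<inter> space \<Omega>" using \<omega>(1) by simp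
    qed
    then have "emeasure \<Omega> (?A n) \<le> emeasure \<Omega> (?p -` B \<inter> space \<Omega>)"
      using measurable_sets[OF m Bm] by (intro emeasure_mono)
    also have "\<dots> = emeasure (distr \<Omega> unifs ?p) B"
      by (rule emeasure_distr[OF m Bm, symmetric])
    also have "\<dots> = emeasure unifs B" by (simp only: conformal_p_uniform[OF s])
    finally have "ennreal b * ennreal (P.prob (?A n)) \<le> ennreal b * emeasure unifs B"
      by (intro mult_left_mono) (simp_all only: P.emeasure_eq_measure zero_le)
    also have "\<dots> \<le> 1" unfolding B_def by (rule weighted_sum_ville[OF b])
    finally have "ennreal (b * P.prob (?A n)) \<le> ennreal 1"
      using b by (simp add: ennreal_mult')
    then show ?thesis using b by (simp add: field_simps)
  qed
  have eq: "{\<omega>\<in>space \<Omega>. \<tau> \<omega> < \<infinity>} = (\<Union>n. ?A n)"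
  proof -
    have "x < \<infinity> \<longleftrightarrow> (\<exists>n. x \<le> enat n)" for x :: enat by (cases x) auto
    then show ?thesis by auto
  qed
  have "(\<lambda>n. P.prob (?A n)) \<longlonglongrightarrow> P.prob (\<Union>n. ?A n)"
    using \<tau>m by (intro P.finite_Lim_measure_incseq) (auto simp: incseq_def intro: order.trans)
  then show ?thesis unfolding eq by (rule LIMSEQ_le_const2) (use fin in auto)
qed

end

section \<open>Accuracy of the p-values after the change\<close>

text \<open>The unnormalized rank at t lies between \<open>lo\<close> and \<open>hi\<close> plus the
  number t - T of post-change observations, and dividing by t instead of T costs at most another (t
  - T) / T downwards. Both counts appear because the randomizer may put the p-value anywhere inside
  its tie class.\<close>

lemma rank_approx:
  fixes s :: "'a \<Rightarrow> real" and \<omega> :: "'a outcome"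
  assumes T: "1 \<le> T" "T < t" and l: "snd \<omega> t \<in> {0..1}"
  defines "z \<equiv> s (fst \<omega> t)"
  defines "lo \<equiv> real (count_below s (fst \<omega>) T z)" and "hi \<equiv> real (count_below s (fst \<omega>) T z + count_ties s (fst \<omega>) T z)"
  shows "\<bar>conformal_p s \<omega> t - q\<bar> \<le> \<bar>hi / T - q\<bar> + \<bar>lo / T - q\<bar> + real (t - T) / T"
proof -
  let ?x = "fst \<omega>" and ?l = "snd \<omega> t"
  let ?S = "\<lambda>n. {i\<in>{1..n}. s (?x i) < z} \<union> {i\<in>{1..n}. s (?x i) = z}"
  let ?a = "count_below s ?x t z" and ?b = "count_ties s ?x t z"
  have p: "conformal_p s \<omega> t = (real ?a + ?l * real ?b) / real t"
    by (simp add: conformal_p_eq z_def)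
  have "count_below s ?x T z \<le> ?a"
    unfolding count_below_def using T by (intro card_mono) auto
  then have a: "lo \<le> real ?a" by (simp add: lo_def)
  have lT: "lo \<le> T" using count_sum_le[of s ?x T z] by (simp add: lo_def)
  have "?a + ?b = card (?S t)"
    unfolding count_below_def count_ties_def by (subst card_Un_disjoint) auto
  also have "\<dots> \<le> card (?S T \<union> {T<..t})"
    by (intro card_mono) auto
  also have "\<dots> \<le> card (?S T) + card {T<..t}"
    by (rule card_Un_le)
  also have "card (?S T)
      = count_below s ?x T z + count_ties s ?x T z"
    unfolding count_below_def count_ties_def by (subst card_Un_disjoint) auto
  finally have ab: "real ?a + real ?b \<le> hi + real (t - T)"
    by (simp add: hi_def flip: of_nat_add)
  have "0 \<le> hi" "0 \<le> lo" by (auto simp: hi_def lo_def)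
  have up: "conformal_p s \<omega> t \<le> hi / T + real (t - T) / T"
  proof -
    have "?l * real ?b \<le> 1 * real ?b" using l by (intro mult_right_mono) auto
    then have "conformal_p s \<omega> t \<le> (hi + real (t - T)) / real t"
      unfolding p using ab by (intro divide_right_mono) auto
    also have "\<dots> \<le> (hi + real (t - T)) / real T"
      using T \<open>0 \<le> hi\<close> by (intro divide_left_mono) auto
    finally show ?thesis by (simp add: add_divide_distrib)
  qed
  have low: "lo / T - real (t - T) / T \<le> conformal_p s \<omega> t"
  proof -
    \<comment> \<open>Cross-multiplied form of (lo - (t - T)) / T \<le> lo / t; it holds because lo
      is at most T, hence at most t.\<close>
    have "(lo - real (t - T)) * real t \<le> lo * real T"
    proof -
      have "lo * real (t - T) \<le> real T * real (t - T)" using lT by (intro mult_right_mono) auto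
      also have "\<dots> \<le> real t * real (t - T)" using T by (intro mult_right_mono) auto
      finally show ?thesis using T by (simp add: of_nat_diff algebra_simps)
    qed
    then have "(lo - real (t - T)) / T \<le> lo / t"
      using T by (simp add: divide_simps mult.commute)
    also have "\<dots> \<le> conformal_p s \<omega> t"
      unfolding p using a l by (intro divide_right_mono) (auto intro: add_increasing2)
    finally show ?thesis by (simp add: diff_divide_distrib)
  qed
  have "0 \<le> real (t - T) / real T" by simp
  then show ?thesis using up low by linarith
qed

text \<open>Linearisation of an absolute value, so that the second moment bound can be summed before
  Markov's inequality is applied.\<close>

lemma abs_le_weighted_square:
  fixes y s :: real
  assumes "0 < s"
  shows "\<bar>y\<bar> \<le> s * y\<^sup>2 / 2 + 1 / (2 * s)"
proof -
  have "0 \<le> (s * \<bar>y\<bar> - 1)\<^sup>2" by simp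
  then have "2 * s * \<bar>y\<bar> \<le> s\<^sup>2 * y\<^sup>2 + 1"
    by (simp add: power2_diff power_mult_distrib algebra_simps)
  then have "2 * s * \<bar>y\<bar> / (2 * s) \<le> (s\<^sup>2 * y\<^sup>2 + 1) / (2 * s)"
    using assms by (intro divide_right_mono) auto
  moreover have "2 * s * \<bar>y\<bar> / (2 * s) = \<bar>y\<bar>" using assms by simp
  moreover have "s\<^sup>2 * y\<^sup>2 / (2 * s) = s * y\<^sup>2 / 2" using assms by (simp add: power2_eq_square)
  ultimately show ?thesis by (simp only: add_divide_distrib)
qed

section \<open>Probability integral transform and sufficiency of the likelihood ratio\<close>

locale conformal_detection = change_point_KL P0 P1 L D + betting f \<mu>
  for P0 :: "'a measure" and P1 L D and f :: "'b \<Rightarrow> real \<Rightarrow> real" and \<mu> :: "'b measure" +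
  fixes h :: "real \<Rightarrow> real" and \<beta> :: real
  assumes cdf_cont: "continuous_on UNIV (cdf (distr P0 borel L))"
    and support: "local_KL_support f \<mu> (score_law P0 P1 L) h"
    and \<beta>: "0 < \<beta>"
begin

sublocale rule: conformal_rule P0 f \<mu> L "1 / \<beta>"
  by unfold_locales (use L_meas \<beta> in auto)

sublocale P0: prob_space P0 by (rule prob_P0)
sublocale P1: prob_space P1 by (rule prob_P1)

abbreviation F :: "real \<Rightarrow> real" where "F \<equiv> cdf (distr P0 borel L)"

lemma real_distribution_L: "real_distribution (distr P0 borel L)"
  using L_meas by simp

lemma F_eq: "F z = P0.prob {x\<in>space P0. L x \<le> z}"
proof -
  have "F z = P0.prob (L -` {..z} \<inter> space P0)"
    unfolding cdf_def using L_meas by (subst measure_distr) auto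
  also have "L -` {..z} \<inter> space P0 = {x\<in>space P0. L x \<le> z}" by auto
  finally show ?thesis .
qed

text \<open>A continuous distribution function has no atoms. Thus the strict count \<open>lo\<close>
  and the non-strict count \<open>hi\<close> of the rank approximation are centred at the same
  value.\<close>

lemma F_eq_less: "F z = P0.prob {x\<in>space P0. L x < z}"
proof -
  interpret d: real_distribution "distr P0 borel L" by (rule real_distribution_L)
  have "isCont F z" using cdf_cont by (simp add: continuous_on_eq_continuous_at)
  then have "measure (distr P0 borel L) {z} = 0" by (simp add: d.isCont_cdf)
  then have 0: "P0.prob (L -` {z} \<inter> space P0) = 0"
    using L_meas by (subst (asm) measure_distr) auto
  have "{x\<in>space P0. L x \<le> z} = {x\<in>space P0. L x < z} \<union> (L -` {z} \<inter> space P0)" by auto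
  then have "F z = P0.prob {x\<in>space P0. L x < z} + P0.prob (L -` {z} \<inter> space P0)"
    unfolding F_eq using L_meas by (simp only:) (intro P0.finite_measure_Union; auto)
  then show ?thesis using 0 by simp
qed

lemma F_range: "F z \<in> {0..1}"
  unfolding F_eq by simp

lemma F_mono: "x \<le> y \<Longrightarrow> F x \<le> F y"
  unfolding F_eq using L_meas by (intro P0.finite_measure_mono) auto

lemma F_borel: "F \<in> borel_measurable borel"
  by (rule borel_measurable_continuous_onI[OF cdf_cont])

lemma F_unif01: "F \<in> borel \<rightarrow>\<^sub>M unif01"
proof -
  have "F \<in> borel \<rightarrow>\<^sub>M lborel" using F_borel by (simp only: measurable_lborel1)
  then show ?thesis unfolding unif01_def using F_range by (intro measurable_restrict_space2) auto
qed

lemma F_L_measurable: "(\<lambda>x. F (L x)) \<in> P0 \<rightarrow>\<^sub>M unif01"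
  by (rule measurable_compose[OF L_meas F_unif01])

lemma F_surj:
  assumes "0 < u" "u < 1"
  obtains z where "F z = u"
proof -
  interpret d: real_distribution "distr P0 borel L" by (rule real_distribution_L)
  have "\<forall>\<^sub>F z in at_bot. F z < u" using d.cdf_lim_at_bot assms by (intro order_tendstoD)
  then obtain a where a: "F a < u" by (auto simp: eventually_at_bot_linorder)
  have "\<forall>\<^sub>F z in at_top. u < F z" using d.cdf_lim_at_top_prob assms by (intro order_tendstoD)
  then obtain b where b: "u < F b" by (auto simp: eventually_at_top_linorder)
  have "a \<le> b" using a b F_mono[of b a] by (cases "a \<le> b") auto
  then obtain z where "F z = u"
    using IVT'[of F a u b] a b continuous_on_subset[OF cdf_cont, of "{a..b}"] by auto
  then show thesis by (rule that)
qed

text \<open>\<open>F\<close> may be flat, so the event need not be \<open>L \<le> z\<close> for a z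
  with \<open>F z = u\<close>. It contains that event, and it is contained in
  \<open>L \<le> z\<close> whenever \<open>F z = v > u\<close>; let v decrease to u. For u = 0 the
  value 0 may not be attained, but the lower bound is trivial.\<close>

lemma prob_F_L_le:
  assumes "0 \<le> u" "u \<le> 1"
  shows "P0.prob {x\<in>space P0. F (L x) \<le> u} = u"
proof (cases "u = 1")
  case True
  then have "{x\<in>space P0. F (L x) \<le> u} = space P0" using F_range by auto
  then show ?thesis using True by (simp add: P0.prob_space)
next
  case False
  then have u: "0 \<le> u" "u < 1" using assms by auto
  have meas: "{x\<in>space P0. F (L x) \<le> u} \<in> P0.events"
    using measurable_compose[OF L_meas F_borel] by measurable
  show ?thesis
  proof (rule antisym)
    show "P0.prob {x\<in>space P0. F (L x) \<le> u} \<le> u"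
    proof (rule dense_ge_bounded[OF u(2)])
      fix v assume v: "u < v" "v < 1"
      then obtain z where z: "F z = v" using F_surj[of v] u by auto
      have "{x\<in>space P0. F (L x) \<le> u} \<subseteq> {x\<in>space P0. L x \<le> z}"
      proof safe
        fix x assume "F (L x) \<le> u"
        then show "L x \<le> z" using F_mono[of z "L x"] v z by (cases "L x \<le> z") auto
      qed
      then show "P0.prob {x\<in>space P0. F (L x) \<le> u} \<le> v"
        unfolding z[symmetric] F_eq[of z] using L_meas by (intro P0.finite_measure_mono) auto
    qed
    show "u \<le> P0.prob {x\<in>space P0. F (L x) \<le> u}"
    proof (cases "u = 0")
      case False
      then obtain z where z: "F z = u" using F_surj[of u] u by auto
      have "{x\<in>space P0. L x \<le> z} \<subseteq> {x\<in>space P0. F (L x) \<le> u}"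
        using F_mono z by auto
      then have "F z \<le> P0.prob {x\<in>space P0. F (L x) \<le> u}"
        unfolding F_eq[of z] using meas by (intro P0.finite_measure_mono)
      then show ?thesis using z by simp
    qed simp
  qed
qed

lemma probability_integral_transform: "distr P0 unif01 (\<lambda>x. F (L x)) = unif01"
proof -
  interpret u: prob_space unif01 by (rule prob_space_unif01)
  have Fm: "(\<lambda>x. F (L x)) \<in> borel_measurable P0" by (rule measurable_compose[OF L_meas F_borel])
  have idm: "(\<lambda>x. x) \<in> borel_measurable unif01"
    by (rule measurable_unif01_borel) simp
  have em: "emeasure unif01 A = emeasure lborel A" if "A \<in> sets borel" "A \<subseteq> {0..1}" for A
    unfolding unif01_def using that by (subst emeasure_restrict_space) auto
  \<comment> \<open>Uniqueness by distribution functions concerns laws on the whole line, so both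
    laws are compared there first and then carried back to the space [0,1].\<close>
  have "distr P0 borel (\<lambda>x. F (L x)) = distr unif01 borel (\<lambda>x. x)"
  proof (rule cdf_unique)
    show "real_distribution (distr P0 borel (\<lambda>x. F (L x)))" using Fm by simp
    show "real_distribution (distr unif01 borel (\<lambda>x. x))" using idm by simp
    show "cdf (distr P0 borel (\<lambda>x. F (L x))) = cdf (distr unif01 borel (\<lambda>x. x))"
    proof
      fix u
      have l: "cdf (distr P0 borel (\<lambda>x. F (L x))) u = P0.prob {x\<in>space P0. F (L x) \<le> u}"
        unfolding cdf_def[of "distr P0 borel (\<lambda>x. F (L x))"]
        using Fm by (subst measure_distr) (auto intro!: arg_cong[where f=P0.prob])
      have r: "cdf (distr unif01 borel (\<lambda>x. x)) u = u.prob ({..u} \<inter> {0..1})"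
        unfolding cdf_def using idm by (subst measure_distr) auto
      consider "u < 0" | "0 \<le> u" "u \<le> 1" | "1 < u" by linarith
      then show "cdf (distr P0 borel (\<lambda>x. F (L x))) u = cdf (distr unif01 borel (\<lambda>x. x)) u"
      proof cases
        case 1
        have "\<not> F (L x) \<le> u" for x using F_range[of "L x"] 1 by auto
        then have e: "{x\<in>space P0. F (L x) \<le> u} = {}" "{..u} \<inter> {0..1} = {}" using 1 by auto
        show ?thesis unfolding l r e by simp
      next
        case 2
        then have e: "{..u} \<inter> {0..1} = {0..u}" by auto
        have "u.prob {0..u} = u"
          using em[of "{0..u}"] 2 by (simp add: measure_def)
        then show ?thesis unfolding l r e prob_F_L_le[OF 2] by (rule sym)
      next
        case 3
        have "F (L x) \<le> u" for x using F_range[of "L x"] 3 by auto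
        then have e: "{x\<in>space P0. F (L x) \<le> u} = space P0" "{..u} \<inter> {0..1} = {0..1}"
          using 3 by auto
        show ?thesis unfolding l r e using u.prob_space P0.prob_space by simp
      qed
    qed
  qed
  note eq = this
  show ?thesis
  proof (rule measure_eqI)
    fix A assume "A \<in> sets (distr P0 unif01 (\<lambda>x. F (L x)))"
    then have A: "A \<in> sets unif01" by simp
    note Ab = sets_unif01D[OF A]
    have "emeasure (distr P0 unif01 (\<lambda>x. F (L x))) A = emeasure (distr P0 borel (\<lambda>x. F (L x))) A"
      using A Ab Fm F_L_measurable by (simp add: emeasure_distr)
    also have "\<dots> = emeasure unif01 (A \<inter> space unif01)"
      unfolding eq using Ab idm by (subst emeasure_distr) auto
    also have "A \<inter> space unif01 = A" using sets.sets_into_space[OF A] by auto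
    finally show "emeasure (distr P0 unif01 (\<lambda>x. F (L x))) A = emeasure unif01 A" .
  qed simp
qed

lemma h_meas: "h \<in> borel_measurable unif01"
  and h_pos: "z \<in> {0..1} \<Longrightarrow> 0 < h z"
  and score_law_density: "score_law P0 P1 L = density unif01 (\<lambda>z. ennreal (h z))"
  using support by (auto simp: local_KL_support_def)

lemma h_F_L_meas: "(\<lambda>x. h (F (L x))) \<in> borel_measurable P0"
  by (rule measurable_compose[OF F_L_measurable h_meas])

text \<open>The score is sufficient: \<open>h \<circ> F\<close> and the identity are both densities of the law of the
  likelihood ratio under \<open>P1\<close> with respect to its law under \<open>P0\<close>.\<close>

lemma h_F_L_eq: "AE x in P0. h (F (L x)) = L x"
proof -
  interpret u: prob_space unif01 by (rule prob_space_unif01)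
  let ?F = "\<lambda>z. {x\<in>space P0. F (L x) \<le> F z}" and ?L = "\<lambda>z. {x\<in>space P0. L x \<le> z}"
  let ?Q = "density P0 (\<lambda>x. ennreal (h (F (L x))))"
  have Fm1: "(\<lambda>x. F (L x)) \<in> P1 \<rightarrow>\<^sub>M unif01"
    using F_L_measurable measurable_cong_sets[OF sets_P1 refl] by auto
  have Lm1: "L \<in> borel_measurable P1"
    using L_meas measurable_cong_sets[OF sets_P1 refl] by auto
  have LmQ: "L \<in> borel_measurable ?Q" using L_meas by simp
  \<comment> \<open>By the definition of \<open>h\<close>, the density \<open>h (F (L x))\<close>
    reproduces \<open>P1\<close> on events that depend on \<open>F (L x)\<close> only.\<close>
  have trans: "emeasure ?Q {x\<in>space P0. F (L x) \<in> B} = emeasure P1 {x\<in>space P0. F (L x) \<in> B}"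
    if B: "B \<in> sets unif01" for B
  proof -
    have ev: "{x\<in>space P0. F (L x) \<in> B} \<in> sets P0"
      using measurable_sets[OF F_L_measurable B] by (simp add: vimage_def Int_def conj_commute)
    have "emeasure P1 {x\<in>space P0. F (L x) \<in> B} = emeasure (score_law P0 P1 L) B"
      unfolding score_law_def using Fm1 B
      by (subst emeasure_distr) (auto simp: space_P1 intro!: arg_cong[where f="emeasure P1"])
    also have "\<dots> = (\<integral>\<^sup>+z. ennreal (h z) * indicator B z \<partial>distr P0 unif01 (\<lambda>x. F (L x)))"
      unfolding score_law_density probability_integral_transform using h_meas B
      by (subst emeasure_density) auto
    also have "\<dots> = (\<integral>\<^sup>+x. ennreal (h (F (L x))) * indicator B (F (L x)) \<partial>P0)"
      using F_L_measurable h_meas B by (subst nn_integral_distr) auto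
    also have "\<dots> = emeasure ?Q {x\<in>space P0. F (L x) \<in> B}"
      using h_F_L_meas ev by (subst emeasure_density) (auto intro!: nn_integral_cong simp: indicator_def)
    finally show ?thesis by simp
  qed
  have Q1: "prob_space ?Q"
  proof (rule prob_spaceI)
    have "{x\<in>space P0. F (L x) \<in> {0..1}} = space P0" using F_range by auto
    then show "emeasure ?Q (space ?Q) = 1"
      using trans[OF sets.top, unfolded space_unif01] P1.emeasure_space_1 by (simp add: space_P1)
  qed
  then interpret Q: prob_space ?Q .
  have m1: "?F z \<in> P0.events" for z
    using measurable_compose[OF L_meas F_borel] by measurable
  have m2: "?L z \<in> P0.events" for z using L_meas by measurable
  \<comment> \<open>On flat pieces \<open>F\<close> loses information about \<open>L\<close>, but
    only up to null sets: the event on the right contains the one on the left, and both have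
    probability \<open>F z\<close>. This extends the agreement of \<open>?Q\<close> and
    \<open>P1\<close> to the events \<open>L \<le> z\<close>.\<close>
  have null: "AE x in P0. (L x \<le> z) = (F (L x) \<le> F z)" for z
  proof -
    have sub: "?L z \<subseteq> ?F z" using F_mono by auto
    have "P0.prob (?F z - ?L z) = 0"
      using P0.finite_measure_Diff[OF m1 m2 sub] prob_F_L_le[of "F z"] F_range[of z] F_eq[of z] by simp
    then have "AE x in P0. x \<notin> ?F z - ?L z"
      using m1 m2 by (subst (asm) P0.prob_eq_0) auto
    then show ?thesis using AE_space
    proof eventually_elim
      case (elim x)
      then show ?case using F_mono[of "L x" z] by auto
    qed
  qed
  have le_eq: "emeasure ?Q (?L z) = emeasure P1 (?L z)" for z
  proof -
    have B: "{0..F z} \<in> sets unif01"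
      unfolding unif01_def using F_range[of z] by (subst sets_restrict_space_iff) auto
    have e: "{x\<in>space P0. F (L x) \<in> {0..F z}} = ?F z" using F_range by auto
    have "AE x in ?Q. (L x \<le> z) = (F (L x) \<le> F z)"
      using null[of z] h_F_L_meas by (subst AE_density) (auto elim: eventually_mono)
    then have "emeasure ?Q (?L z) = emeasure ?Q (?F z)"
      using m1 m2 by (intro emeasure_eq_AE) auto
    also have "\<dots> = emeasure P1 (?F z)" using trans[OF B] unfolding e .
    also have "\<dots> = emeasure P1 (?L z)"
    proof (rule emeasure_eq_AE)
      show "AE x in P1. (x \<in> ?F z) = (x \<in> ?L z)"
        unfolding P1_density using null[of z] L_meas by (subst AE_density) auto
    qed (use m1 m2 sets_P1 in auto)
    finally show ?thesis .
  qed
  have eq: "distr ?Q borel L = distr P1 borel L"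
  proof (rule cdf_unique)
    show "real_distribution (distr ?Q borel L)" using LmQ by (rule Q.real_distribution_distr)
    show "real_distribution (distr P1 borel L)" using Lm1 by simp
    show "cdf (distr ?Q borel L) = cdf (distr P1 borel L)"
    proof
      fix z
      have "cdf (distr ?Q borel L) z = measure ?Q (?L z)"
        unfolding cdf_def[of "distr ?Q borel L"] using LmQ
        by (subst measure_distr) (auto intro!: arg_cong[where f="measure ?Q"])
      also have "\<dots> = P1.prob (?L z)" using le_eq by (simp add: measure_def)
      also have "\<dots> = cdf (distr P1 borel L) z"
        unfolding cdf_def using Lm1
        by (subst measure_distr) (auto simp: space_P1 intro!: arg_cong[where f="P1.prob"])
      finally show "cdf (distr ?Q borel L) z = cdf (distr P1 borel L) z" .
    qed
  qed
  define g where "g z = h (F z)" for z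
  have gm: "g \<in> borel_measurable borel"
    unfolding g_def by (rule measurable_compose[OF F_unif01 h_meas])
  have "density (distr P0 borel L) (\<lambda>z. ennreal (g z)) = distr ?Q borel L"
    using L_meas gm by (subst density_distr) (auto simp: g_def intro!: measurable_compose[OF _ measurable_ennreal] gm[unfolded g_def])
  also have "\<dots> = distr (density P0 (\<lambda>x. ennreal (L x))) borel L" unfolding eq P1_density ..
  also have "\<dots> = density (distr P0 borel L) (\<lambda>z. ennreal z)"
    using L_meas by (subst density_distr) auto
  finally have deq: "density (distr P0 borel L) (\<lambda>z. ennreal (g z)) = density (distr P0 borel L) (\<lambda>z. ennreal z)" .
  interpret d: real_distribution "distr P0 borel L" by (rule real_distribution_L)
  have "AE z in distr P0 borel L. ennreal (g z) = ennreal z"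
    using deq gm by (subst (asm) d.density_unique_iff) auto
  then have "AE x in P0. ennreal (g (L x)) = ennreal (L x)"
    using L_meas gm by (subst (asm) AE_distr_iff) auto
  then show ?thesis using AE_space
  proof eventually_elim
    case (elim x)
    have "0 \<le> g (L x)" using h_pos[OF F_range[of "L x"]] by (simp add: g_def)
    then show ?case using elim L_nonneg by (simp add: g_def)
  qed
qed

text \<open>The sign is reversed because the weak law is stated for upper tails, while slow growth
  of the sum of \<open>ln h\<close> is a lower deviation.\<close>

abbreviation loss :: "'a \<Rightarrow> real" where
  "loss \<equiv> \<lambda>x. - ln (h (F (L x)))"

lemma ln_h_integrable: "integrable P1 loss"
  and ln_h_mean: "(\<integral>x. loss x \<partial>P1) = - D"
proof -
  have ae: "AE x in P1. loss x = - ln (L x)"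
    unfolding P1_density using h_F_L_eq L_meas by (subst AE_density) auto
  have m: "loss \<in> borel_measurable P1" "(\<lambda>x. - ln (L x)) \<in> borel_measurable P1"
    using L_meas h_F_L_meas by (simp_all add: measurable_cong_sets[OF sets_P1 refl])
  show "integrable P1 loss"
    using integrable_cong_AE[OF m ae] ln_L_integrable by simp
  show "(\<integral>x. loss x \<partial>P1) = - D"
    using integral_cong_AE[OF m ae] ln_L_mean by simp
qed

text \<open>The deviations of \<open>hi\<close> and \<open>lo\<close> in \<open>rank_approx\<close>,
  multiplied by T and squared: second moments of centred counts.\<close>

definition rank_dev :: "nat \<Rightarrow> (nat \<Rightarrow> 'a) \<Rightarrow> real \<Rightarrow> real" where
  "rank_dev T x z = (real (count_below L x T z + count_ties L x T z) - T * F z)\<^sup>2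
     + (real (count_below L x T z) - T * F z)\<^sup>2"

abbreviation rank_dev_at :: "nat \<Rightarrow> nat \<Rightarrow> (nat \<Rightarrow> 'a) \<Rightarrow> real" where
  "rank_dev_at T t \<equiv> \<lambda>x. rank_dev T x (L (x t))"

lemma rank_dev_nonneg: "0 \<le> rank_dev T x z"
  by (simp add: rank_dev_def)

lemma measurable_rank_dev:
  assumes t: "1 \<le> t"
  shows "rank_dev_at T t \<in> borel_measurable PX"
proof -
  have c: "(\<lambda>x. L (x i)) \<in> borel_measurable PX" if "1 \<le> i" for i
    using that L_meas by (intro measurable_coordinate[where M="\<lambda>_. P0"]) auto
  have c': "(\<lambda>x. L (x i)) \<in> borel_measurable PX" if "i \<in> {1..T}" for i
    using c[of i] that by simp
  have r: "(\<lambda>x. real (count_below L x T (L (x t)))) \<in> borel_measurable PX"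
    "(\<lambda>x. real (count_ties L x T (L (x t)))) \<in> borel_measurable PX"
    using measurable_count[where s=L and X="\<lambda>x. x" and v="\<lambda>x. L (x t)" and t=T, OF c' c[OF t]] by simp_all
  have "(\<lambda>x. F (L (x t))) \<in> borel_measurable PX"
    by (rule measurable_compose[OF c[OF t] F_borel])
  then show ?thesis unfolding rank_dev_def of_nat_add using r by measurable
qed

text \<open>As t > T, the threshold \<open>L (x t)\<close> is independent of the first T
  observations. At a fixed threshold z both counts are sums of T iid indicators of mean
  \<open>F z\<close>, so each square has mean at most T. The bound is uniform in the threshold and
  survives integration over \<open>x t\<close>.\<close>

lemma rank_dev_expectation:
  assumes T: "T < t"
  shows "(\<integral>\<^sup>+x. ennreal (rank_dev_at T t x) \<partial>obs_law (enat T)) \<le> ennreal (2 * real T)"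
proof -
  let ?d = "rank_dev_at T t"
  let ?M = "\<lambda>i. if enat i \<le> enat T then P0 else P1"
  let ?R = "PiM ({1..} - {t}) ?M"
  have M: "prob_space (?M i)" for i using prob_P0 prob_P1 by simp
  interpret PR: product_prob_space ?M "{1..} - {t}" by (rule product_prob_space_mix)
  have t: "1 \<le> t" using T by simp
  have meas: "(\<lambda>x. ennreal (rank_dev_at T t x)) \<in> borel_measurable (obs_law (enat T))"
    unfolding measurable_cong_sets[OF sets_obs_law refl]
    by (intro measurable_compose[OF measurable_rank_dev[OF t] measurable_ennreal])
  have inner: "(\<integral>\<^sup>+X. ennreal (?d (X(t := v))) \<partial>?R) \<le> ennreal (2 * real T)" for v
  proof -
    define z where "z = L v"
    let ?q = "\<lambda>(g :: 'a \<Rightarrow> real) x. ((\<Sum>i\<in>{1..T}. g (x i)) - card {1..T} * F z)\<^sup>2"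
    define g1 g2 :: "'a \<Rightarrow> real" where "g1 a = (if L a \<le> z then 1 else 0)" and "g2 a = (if L a < z then 1 else 0)" for a
    have J: "finite {1..T}" "{1..T} \<subseteq> {1..} - {t}" using T by auto
    have gm: "g1 \<in> borel_measurable P0" "g2 \<in> borel_measurable P0"
      unfolding g1_def g2_def using L_meas by measurable
    have gi: "(\<integral>x. g1 x \<partial>P0) = F z" "(\<integral>x. g2 x \<partial>P0) = F z"
    proof -
      have "(\<integral>x. g1 x \<partial>P0) = (\<integral>x. indicator {x\<in>space P0. L x \<le> z} x \<partial>P0)"
        by (intro Bochner_Integration.integral_cong) (auto simp: g1_def)
      then show "(\<integral>x. g1 x \<partial>P0) = F z" using L_meas by (simp add: F_eq)
      have "(\<integral>x. g2 x \<partial>P0) = (\<integral>x. indicator {x\<in>space P0. L x < z} x \<partial>P0)"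
        by (intro Bochner_Integration.integral_cong) (auto simp: g2_def)
      then show "(\<integral>x. g2 x \<partial>P0) = F z" using L_meas by (simp add: F_eq_less)
    qed
    have gb: "\<bar>g1 a\<bar> \<le> 1" "\<bar>g2 a\<bar> \<le> 1" for a by (simp_all add: g1_def g2_def)
    have s1: "integrable ?R (?q g1)"
      "(\<integral>x. ?q g1 x \<partial>?R) \<le> real (card {1..T}) * 1\<^sup>2"
      using J gm gi gb by (intro PR.second_moment_sum_le[where B=1]; auto)+
    have s2: "integrable ?R (?q g2)"
      "(\<integral>x. ?q g2 x \<partial>?R) \<le> real (card {1..T}) * 1\<^sup>2"
      using J gm gi gb by (intro PR.second_moment_sum_le[where B=1]; auto)+
    have rd: "?d (X(t := v))
      = ?q g1 X + ?q g2 X" for X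
    proof -
      have card: "real (card {i\<in>{1..T}. P i}) = (\<Sum>i\<in>{1..T}. if P i then 1 else 0)" for P
        by (simp add: sum.If_cases Int_def)
      have "count_below L (X(t := v)) T z + count_ties L (X(t := v)) T z
          = card ({i\<in>{1..T}. L ((X(t := v)) i) < z} \<union> {i\<in>{1..T}. L ((X(t := v)) i) = z})"
        unfolding count_below_def count_ties_def by (subst card_Un_disjoint) auto
      also have "{i\<in>{1..T}. L ((X(t := v)) i) < z} \<union> {i\<in>{1..T}. L ((X(t := v)) i) = z} = {i\<in>{1..T}. L (X i) \<le> z}"
        using T by auto
      finally have 1: "real (count_below L (X(t := v)) T z + count_ties L (X(t := v)) T z) = (\<Sum>i\<in>{1..T}. g1 (X i))"
        unfolding g1_def card[symmetric] by (simp only:)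
      have "{i\<in>{1..T}. L ((X(t := v)) i) < z} = {i\<in>{1..T}. L (X i) < z}" using T by auto
      then have 2: "real (count_below L (X(t := v)) T z) = (\<Sum>i\<in>{1..T}. g2 (X i))"
        unfolding g2_def card[symmetric] count_below_def by simp
      show ?thesis unfolding rank_dev_def fun_upd_same z_def[symmetric] 1 2 by simp
    qed
    have "(\<integral>\<^sup>+X. ennreal (?d (X(t := v))) \<partial>?R)
      = ennreal (\<integral>X. ?q g1 X + ?q g2 X \<partial>?R)"
      unfolding rd using s1(1) s2(1) by (intro nn_integral_eq_integral) auto
    also have "\<dots> \<le> ennreal (2 * real T)"
      using s1 s2 by (intro ennreal_leI) simp
    finally show ?thesis .
  qed
  have "(\<integral>\<^sup>+x. ennreal (rank_dev_at T t x) \<partial>obs_law (enat T))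
      = (\<integral>\<^sup>+v. \<integral>\<^sup>+X. ennreal (?d (X(t := v))) \<partial>?R \<partial>?M t)"
    by (rule nn_integral_PiM_update(2)[OF M _ meas]) (use t in simp)
  also have "\<dots> \<le> (\<integral>\<^sup>+v. ennreal (2 * real T) \<partial>?M t)"
    by (intro nn_integral_mono inner)
  also have "\<dots> = ennreal (2 * real T)"
    using prob_space.emeasure_space_1[OF M[of t]] by simp
  finally show ?thesis .
qed

text \<open>The r summands share the pre-change sample and are dependent, but Markov's inequality
  needs only their means, at most 2 T each.\<close>

lemma rank_dev_tail:
  assumes T: "1 \<le> T" and r: "1 \<le> r" and \<epsilon>: "0 < \<epsilon>"
  shows "\<P>(\<omega> in law (enat T). 2 * real T * real r / \<epsilon> \<le> (\<Sum>t\<in>{T<..T+r}. rank_dev_at T t (fst \<omega>))) \<le> \<epsilon>"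
proof -
  interpret p: prob_space "obs_law (enat T)" by (rule prob_obs_law)
  let ?S = "\<lambda>x. \<Sum>t\<in>{T<..T+r}. rank_dev_at T t x"
  have m: "rank_dev_at T t \<in> borel_measurable (obs_law (enat T))" if "t \<in> {T<..T+r}" for t
    unfolding measurable_cong_sets[OF sets_obs_law refl] using that by (intro measurable_rank_dev) auto
  then have meas: "?S \<in> borel_measurable (obs_law (enat T))" by (intro borel_measurable_sum)
  have int: "(\<integral>\<^sup>+x. ennreal (?S x) \<partial>obs_law (enat T)) \<le> ennreal (2 * real T * real r)"
  proof -
    have "(\<integral>\<^sup>+x. ennreal (?S x) \<partial>obs_law (enat T)) = (\<integral>\<^sup>+x. (\<Sum>t\<in>{T<..T+r}. ennreal (rank_dev_at T t x)) \<partial>obs_law (enat T))"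
      by (intro nn_integral_cong) (simp add: sum_ennreal rank_dev_nonneg)
    also have "\<dots> = (\<Sum>t\<in>{T<..T+r}. \<integral>\<^sup>+x. ennreal (rank_dev_at T t x) \<partial>obs_law (enat T))"
      using m by (intro nn_integral_sum) simp
    also have "\<dots> \<le> (\<Sum>t\<in>{T<..T+r}. ennreal (2 * real T))"
      by (intro sum_mono rank_dev_expectation) auto
    also have "\<dots> = ennreal (2 * real T * real r)"
      by (simp add: ennreal_mult'[symmetric] ennreal_of_nat_eq_real_of_nat mult_ac)
    finally show ?thesis .
  qed
  have "\<P>(\<omega> in law (enat T). 2 * real T * real r / \<epsilon> \<le> ?S (fst \<omega>)) = \<P>(x in obs_law (enat T). 2 * real T * real r / \<epsilon> \<le> ?S x)"
    by (rule prob_law_fst) (use meas in measurable)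
  also have "\<dots> \<le> \<epsilon>"
  proof -
    let ?B = "{x\<in>space (obs_law (enat T)). 2 * real T * real r / \<epsilon> \<le> ?S x}"
    have Bm: "?B \<in> p.events" using meas by measurable
    have pos: "0 < 2 * real T * real r / \<epsilon>" using T r \<epsilon> by simp
    have "ennreal (2 * real T * real r / \<epsilon>) * emeasure (obs_law (enat T)) ?B = (\<integral>\<^sup>+x. ennreal (2 * real T * real r / \<epsilon>) * indicator ?B x \<partial>obs_law (enat T))"
      using Bm by (simp add: nn_integral_cmult)
    also have "\<dots> \<le> (\<integral>\<^sup>+x. ennreal (?S x) \<partial>obs_law (enat T))"
      by (intro nn_integral_mono) (auto simp: indicator_def intro!: ennreal_leI)
    also note int
    finally have "ennreal (2 * real T * real r / \<epsilon> * p.prob ?B) \<le> ennreal (2 * real T * real r)"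
      by (simp only: p.emeasure_eq_measure ennreal_mult[OF less_imp_le[OF pos] measure_nonneg])
    then have "2 * real T * real r / \<epsilon> * p.prob ?B \<le> 2 * real T * real r"
      by (subst (asm) ennreal_le_iff) auto
    then have "2 * real T * real r * p.prob ?B \<le> 2 * real T * real r * \<epsilon>" using \<epsilon> by (simp add: field_simps)
    then show ?thesis using T r by (subst (asm) mult_le_cancel_left_pos) auto
  qed
  finally show ?thesis .
qed

end

section \<open>The delay of the restart rules\<close>

lemma elog_geD:
  assumes "ereal y \<le> elog M"
  shows "ennreal (exp y) \<le> M"
proof (cases "M = \<infinity>")
  case False
  then have M: "M \<noteq> 0" "y \<le> ln (enn2real M)"
    using assms by (auto simp: elog_def split: if_splits)
  have pos: "0 < enn2real M" using M(1) False by (simp add: enn2real_positive_iff less_top zero_less_iff_neq_zero)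
  have "exp y \<le> exp (ln (enn2real M))" using M(2) by simp
  then have "exp y \<le> enn2real M" using pos by simp
  then have "ennreal (exp y) \<le> ennreal (enn2real M)" by (rule ennreal_leI)
  also have "\<dots> = M" using False by (intro ennreal_enn2real) (simp add: less_top)
  finally show ?thesis .
qed simp

lemma ln_nh_weight:
  "1 \<le> k \<Longrightarrow> ln (nh_weight k) = ln nh_const - ln (real k) - 2 * ln (ln (exp 1 + real k))"
proof -
  assume "1 \<le> k"
  then show ?thesis
    using ln_exp_1_add_pos[of k] nh_const_pos
    by (simp add: nh_weight_def ln_mult ln_inverse ln_realpow)
qed

lemma nh_weight_pos: "1 \<le> k \<Longrightarrow> 0 < nh_weight k"
  using ln_exp_1_add_pos[of k] nh_const_pos by (simp add: nh_weight_def)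

lemma ln_nh_weight_antimono:
  assumes "1 \<le> k" "k \<le> m"
  shows "ln (nh_weight m) \<le> ln (nh_weight k)"
proof -
  have e: "1 < exp 1 + real k" using exp_gt_one[of "1::real"] by linarith
  have "ln (real k) \<le> ln (real m)" using assms by simp
  moreover have le: "ln (exp 1 + real k) \<le> ln (exp 1 + real m)" using e assms by simp
  moreover have "ln (ln (exp 1 + real k)) \<le> ln (ln (exp 1 + real m))"
    using le ln_exp_1_add_pos by (subst ln_le_cancel_iff) auto
  moreover have "1 \<le> m" using assms by simp
  ultimately show ?thesis unfolding ln_nh_weight[OF assms(1)] ln_nh_weight[OF \<open>1 \<le> m\<close>] by linarith
qed

section \<open>From delay bounds to limits\<close>

abbreviation delay_ratio :: "(nat \<Rightarrow> enat) \<Rightarrow> nat \<Rightarrow> ereal" where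
  "delay_ratio d \<equiv> \<lambda>N. ereal_of_enat (d N) / ereal (ln (real N))"

lemma delay_ratio_tendsto:
  fixes d :: "nat \<Rightarrow> enat"
  assumes low: "ereal q \<le> liminf (delay_ratio d)"
    and up: "\<And>c. q < c \<Longrightarrow> \<forall>\<^sub>F N in sequentially. d N \<le> enat (log_delay c N)"
    and q: "0 < q"
  shows "(delay_ratio d) \<longlonglongrightarrow> ereal q"
proof (rule order_tendstoI)
  fix y assume "y < ereal q"
  then show "\<forall>\<^sub>F N in sequentially. y < delay_ratio d N"
    using low unfolding le_Liminf_iff by blast
next
  fix y assume "ereal q < y"
  then obtain c' where c': "ereal q < ereal c'" "ereal c' < y" using ereal_dense2 by blast
  then obtain c where c: "q < c" "c < c'" using dense[of q c'] by auto
  \<comment> \<open>The ceiling in \<open>log_delay\<close> adds at most 1, that is 1 / ln N after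
    division.\<close>
  have "(\<lambda>N. c + 1 / ln (real N)) \<longlonglongrightarrow> c" by real_asymp
  then have "\<forall>\<^sub>F N in sequentially. c + 1 / ln (real N) < c'" using c(2) by (rule order_tendstoD)
  then show "\<forall>\<^sub>F N in sequentially. delay_ratio d N < y"
    using up[OF c(1)] eventually_gt_at_top[of 1]
  proof eventually_elim
    case (elim N)
    have ln: "0 < ln (real N)" using elim(3) by simp
    have "0 \<le> c * ln (real N)" using c q ln by simp
    then have "real (log_delay c N) \<le> c * ln (real N) + 1" by linarith
    also have "\<dots> = ln (real N) * (c + 1 / ln (real N))" using ln by (simp add: field_simps)
    also have "\<dots> < ln (real N) * c'" using ln elim(1) by (intro mult_strict_left_mono)
    finally have n: "real (log_delay c N) < ln (real N) * c'" .
    have "ereal_of_enat (d N) \<le> ereal (real (log_delay c N))"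
      using elim(2) by (metis ereal_of_enat_le_iff ereal_of_enat_simps(1))
    also have "\<dots> < ereal (ln (real N) * c')" using n by simp
    finally have "ereal_of_enat (d N) < ereal (ln (real N)) * ereal c'" by simp
    then have "delay_ratio d N < ereal c'"
      using ln by (subst ereal_divide_less_pos) auto
    then show ?case using c'(2) by (rule order.strict_trans)
  qed
qed

lemma (in change_point) obs_event_law:
  assumes "{x\<in>space PX. Q x} \<in> sets PX"
  shows "{\<omega>\<in>space (law T). Q (fst \<omega>)} \<in> sets (law T)"
proof -
  have "fst -` {x\<in>space PX. Q x} \<inter> space \<Omega> \<in> sets \<Omega>"
    using assms by (intro measurable_sets[OF measurable_fst])
  also have "fst -` {x\<in>space PX. Q x} \<inter> space \<Omega> = {\<omega>\<in>space (law T). Q (fst \<omega>)}"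
    by (auto simp: space_law space_pair_measure)
  finally show ?thesis unfolding sets_law .
qed

text \<open>Error bound per post-change p-value, averaged over the r of them: the Markov bound on
  the squared deviations, the price of linearizing the absolute values, and the contamination of the
  ranks by post-change observations.\<close>

abbreviation rank_error :: "real \<Rightarrow> nat \<Rightarrow> nat \<Rightarrow> real" where
  "rank_error \<epsilon> T r \<equiv> 1 / (\<epsilon> * sqrt T) + 1 / sqrt T + real r / T"

section \<open>Detection on typical paths\<close>

context conformal_detection
begin

abbreviation late_prob :: "('a outcome \<Rightarrow> enat) \<Rightarrow> nat \<Rightarrow> nat \<Rightarrow> real" where
  "late_prob \<tau> T r \<equiv> \<P>(\<omega> in law (enat T). enat (T + r) < \<tau> \<omega>)"

lemma rank_error_sum:
  assumes \<omega>: "\<omega> \<in> space \<Omega>" and T: "1 \<le> T" and \<epsilon>: "0 < \<epsilon>"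
    and dev: "(\<Sum>t\<in>{T<..T+r}. rank_dev_at T t (fst \<omega>)) \<le> 2 * real T * real r / \<epsilon>"
  shows "(\<Sum>t\<in>{T<..T+r}. \<bar>conformal_p L \<omega> t - F (L (fst \<omega> t))\<bar>)
    \<le> real r * rank_error \<epsilon> T r"
proof -
  let ?F = "\<lambda>t. F (L (fst \<omega> t))"
  let ?e = "\<lambda>t. \<bar>conformal_p L \<omega> t - ?F t\<bar>"
  let ?d = "\<lambda>t. rank_dev_at T t (fst \<omega>)"
  have sT: "0 < sqrt (real T)" "sqrt (real T) * sqrt (real T) = real T" using T by auto
  have lin: "\<bar>y / T - q\<bar> \<le> (y - T * q)\<^sup>2 / (2 * T * sqrt T) + 1 / (2 * sqrt T)" for y q :: real
  proof -
    \<comment> \<open>The weight 1 / sqrt T balances the two terms: the square has mean of order T,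
      so both become of order sqrt T.\<close>
    have "\<bar>y - T * q\<bar> \<le> (1 / sqrt T) * (y - T * q)\<^sup>2 / 2 + 1 / (2 * (1 / sqrt T))"
      using sT by (intro abs_le_weighted_square) auto
    then have "\<bar>y - T * q\<bar> / T \<le> ((y - T * q)\<^sup>2 / (2 * sqrt T) + sqrt T / 2) / T"
      using T by (intro divide_right_mono) (auto simp: field_simps)
    also have "\<dots> = (y - T * q)\<^sup>2 / (2 * T * sqrt T) + 1 / (2 * sqrt T)"
    proof -
      have "sqrt T / 2 / T = 1 / (2 * sqrt T)"
        using sT by (subst sT(2)[symmetric]) (simp add: divide_simps)
      then show ?thesis by (simp add: add_divide_distrib mult_ac)
    qed
    also have "\<bar>y - T * q\<bar> / T = \<bar>y / T - q\<bar>"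
    proof -
      have "y / T - q = (y - T * q) / T" using T by (simp add: diff_divide_distrib)
      then show ?thesis by (simp only: abs_divide abs_of_nat)
    qed
    finally show ?thesis .
  qed
  have each: "?e t \<le> ?d t / (2 * T * sqrt T) + 1 / sqrt T + real r / T"
    if t: "t \<in> {T<..T+r}" for t
  proof -
    have l: "snd \<omega> t \<in> {0..1}" using randomizer_space[OF \<omega>, of t] t by simp
    let ?lo = "real (count_below L (fst \<omega>) T (L (fst \<omega> t)))"
    let ?hi = "real (count_below L (fst \<omega>) T (L (fst \<omega> t)) + count_ties L (fst \<omega>) T (L (fst \<omega> t)))"
    have "?e t
        \<le> \<bar>?hi / T - ?F t\<bar> + \<bar>?lo / T - ?F t\<bar> + real (t - T) / T"
      using rank_approx[where s=L and \<omega>=\<omega> and t=t and T=T, OF T _ l] t by simp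
    also have "\<dots> \<le> ((?hi - T * ?F t)\<^sup>2 / (2 * T * sqrt T) + 1 / (2 * sqrt T))
        + ((?lo - T * ?F t)\<^sup>2 / (2 * T * sqrt T) + 1 / (2 * sqrt T)) + real r / T"
      using t T by (intro add_mono lin divide_right_mono) auto
    also have "\<dots> = ?d t / (2 * T * sqrt T) + 1 / sqrt T + real r / T"
      by (simp add: rank_dev_def add_divide_distrib)
    finally show ?thesis .
  qed
  have "sum ?e {T<..T+r}
      \<le> (\<Sum>t\<in>{T<..T+r}. ?d t / (2 * T * sqrt T) + 1 / sqrt T + real r / T)"
    by (intro sum_mono each)
  also have "\<dots> = sum ?d {T<..T+r} / (2 * T * sqrt T) + r * (1 / sqrt T + real r / T)"
    by (simp add: sum.distrib sum_divide_distrib distrib_left)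
  also have "\<dots> \<le> (2 * real T * real r / \<epsilon>) / (2 * T * sqrt T) + r * (1 / sqrt T + real r / T)"
    using dev T by (intro add_right_mono divide_right_mono) auto
  also have "(2 * real T * real r / \<epsilon>) / (2 * T * sqrt T) = r * (1 / (\<epsilon> * sqrt T))"
    using T \<epsilon> by simp
  finally show ?thesis by (simp add: algebra_simps)
qed

text \<open>A pathwise statement. \<open>good1\<close> makes the sum of
  \<open>ln (h (F (L x)))\<close> grow at rate at least \<open>D - \<eta>\<close>, the Lipschitz
  constant carries this over to the p-values at the cost bounded through \<open>good2\<close>, and
  \<open>mix\<close> passes from \<open>h\<close> to the mixture. \<open>cond\<close> says that the
  factor restarted at \<open>Suc T\<close>, with its weight, then exceeds the threshold.\<close>

lemma rule_le_of_good:
  assumes \<tau>: "\<tau> \<in> rule.rules" and \<omega>: "\<omega> \<in> space \<Omega>" and T: "1 \<le> T" and r: "1 \<le> r" and \<epsilon>: "0 < \<epsilon>"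
    and lip: "C-lipschitz_on {0..1} (\<lambda>z. ln (h z))"
    and mix: "\<And>z. (\<forall>i\<in>{1..r}. z i \<in> {0..1}) \<Longrightarrow>
        ereal ((\<Sum>i=1..r. ln (h (z i))) - a * ln (real r) - c0) \<le> elog (mixture f \<mu> {1..r} z)"
    and good1: "(\<Sum>i\<in>{T<..T+r}. loss (fst \<omega> i)) \<le> r * (- D + \<eta>)"
    and good2: "(\<Sum>t\<in>{T<..T+r}. rank_dev_at T t (fst \<omega>)) \<le> 2 * real T * real r / \<epsilon>"
    and cond: "ln (1 / \<beta>) \<le> ln (nh_weight (Suc T)) + real r * (D - \<eta>)
        - C * (real r * rank_error \<epsilon> T r) - a * ln (real r) - c0"
  shows "\<tau> \<omega> \<le> enat (T + r)"
proof (rule rule.rule_leI[OF \<tau>])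
  let ?p = "conformal_p L \<omega>" and ?F = "\<lambda>t. F (L (fst \<omega> t))"
  let ?e = "\<lambda>t. \<bar>?p t - ?F t\<bar>" and ?M = "restart_mart L f \<mu> (Suc T) (T + r) \<omega>"
  have C: "0 \<le> C" using lip by (rule lipschitz_on_nonneg)
  have p01: "?p t \<in> {0..1}" if "1 \<le> t" for t
    using randomizer_space[OF \<omega> that] that by (intro conformal_p_range)
  have ln_lip: "ln (h (?F t)) - C * ?e t \<le> ln (h (?p t))" if "1 \<le> t" for t
    using lipschitz_onD[OF lip p01[OF that] F_range[of "L (fst \<omega> t)"]] by (simp add: dist_real_def)
  have "real r * (D - \<eta>) - C * (real r * rank_error \<epsilon> T r)
      \<le> (\<Sum>t\<in>{T<..T+r}. ln (h (?F t))) - C * (\<Sum>t\<in>{T<..T+r}. ?e t)"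
    using good1 mult_left_mono[OF rank_error_sum[OF \<omega> T \<epsilon> good2] C]
    by (simp add: sum_negf algebra_simps)
  also have "\<dots> = (\<Sum>t\<in>{T<..T+r}. ln (h (?F t)) - C * ?e t)"
    by (simp add: sum_subtractf sum_distrib_left)
  also have "\<dots> \<le> (\<Sum>t\<in>{T<..T+r}. ln (h (?p t)))"
    using T by (intro sum_mono ln_lip) auto
  also have "{T<..T+r} = {1 + T..r + T}" by auto
  also have "(\<Sum>t\<in>{1 + T..r + T}. ln (h (?p t))) = (\<Sum>i=1..r. ln (h (?p (i + T))))"
    by (rule sum.shift_bounds_cl_nat_ivl)
  finally have lnh: "real r * (D - \<eta>) - C * (real r * rank_error \<epsilon> T r)
      \<le> (\<Sum>i=1..r. ln (h (?p (i + T))))" .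
  let ?y = "(\<Sum>i=1..r. ln (h (?p (i + T)))) - a * ln (real r) - c0"
  have w: "0 < nh_weight (Suc T)" by (rule nh_weight_pos) simp
  \<comment> \<open>The support condition speaks of positions 1 to r, whereas the factor restarted
    at T + 1 reads the p-values T + 1 to T + r.\<close>
  have "?M = mixture f \<mu> {1..r} (\<lambda>i. ?p (i + T))"
    unfolding restart_mart_def mixture_def
    using prod.shift_bounds_cl_nat_ivl[of "\<lambda>j. f \<theta> (?p j)" 1 T r for \<theta>] by (simp add: add.commute)
  also have "ennreal (exp ?y) \<le> \<dots>"
    using p01 by (intro elog_geD mix) auto
  finally have M: "ennreal (exp ?y) \<le> ?M" .
  have "ln (1 / \<beta>) \<le> ln (nh_weight (Suc T)) + ?y" using cond lnh by linarith
  then have "exp (ln (1 / \<beta>)) \<le> exp (ln (nh_weight (Suc T)) + ?y)" by (subst exp_le_cancel_iff)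
  then have "1 / \<beta> \<le> nh_weight (Suc T) * exp ?y" using \<beta> w by (simp add: exp_add)
  then have "ennreal (1 / \<beta>) \<le> ennreal (nh_weight (Suc T)) * ennreal (exp ?y)"
    using w by (simp add: ennreal_mult[symmetric] ennreal_leI)
  also have "\<dots> \<le> ennreal (nh_weight (Suc T)) * ?M"
    using M by (intro mult_left_mono) auto
  finally show "ennreal (1 / \<beta>) \<le> ennreal (nh_weight (Suc T)) * ?M" .
qed (use r in auto)

lemma late_detection_prob:
  assumes \<tau>: "\<tau> \<in> rule.rules" and T: "1 \<le> T" and r: "1 \<le> r" and \<epsilon>: "0 < \<epsilon>"
    and lip: "C-lipschitz_on {0..1} (\<lambda>z. ln (h z))"
    and mix: "\<And>z. (\<forall>i\<in>{1..r}. z i \<in> {0..1}) \<Longrightarrow>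
        ereal ((\<Sum>i=1..r. ln (h (z i))) - a * ln (real r) - c0) \<le> elog (mixture f \<mu> {1..r} z)"
    and tail: "\<P>(\<omega> in law (enat T). r * (- D + \<eta>) \<le> (\<Sum>i\<in>{T<..T+r}. loss (fst \<omega> i))) \<le> \<epsilon>"
    and cond: "ln (1 / \<beta>) \<le> ln (nh_weight (Suc T)) + real r * (D - \<eta>)
        - C * (real r * rank_error \<epsilon> T r) - a * ln (real r) - c0"
  shows "late_prob \<tau> T r \<le> 2 * \<epsilon>"
proof -
  interpret p: prob_space "law (enat T)" by (rule prob_law)
  define B1 where "B1 = {\<omega>\<in>space (law (enat T)). r * (- D + \<eta>) \<le> (\<Sum>i\<in>{T<..T+r}. loss (fst \<omega> i))}"
  define B2 where "B2 = {\<omega>\<in>space (law (enat T)). 2 * real T * real r / \<epsilon> \<le> (\<Sum>t\<in>{T<..T+r}. rank_dev_at T t (fst \<omega>))}"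
  have m1: "(\<lambda>x. \<Sum>i\<in>{T<..T+r}. loss (x i)) \<in> borel_measurable PX"
    using h_F_L_meas
    by (intro borel_measurable_sum measurable_coordinate[where M="\<lambda>_. P0" and g=loss]) auto
  have m2: "(\<lambda>x. \<Sum>t\<in>{T<..T+r}. rank_dev_at T t x) \<in> borel_measurable PX"
    by (intro borel_measurable_sum measurable_rank_dev) auto
  have "B1 \<in> p.events" unfolding B1_def by (rule obs_event_law) (use m1 in measurable)
  moreover have "B2 \<in> p.events" unfolding B2_def by (rule obs_event_law) (use m2 in measurable)
  moreover have "{\<omega>\<in>space (law (enat T)). enat (T + r) < \<tau> \<omega>} \<subseteq> B1 \<union> B2"
  proof
    fix \<omega> assume \<omega>: "\<omega> \<in> {\<omega>\<in>space (law (enat T)). enat (T + r) < \<tau> \<omega>}"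
    show "\<omega> \<in> B1 \<union> B2"
    proof (rule ccontr)
      assume "\<omega> \<notin> B1 \<union> B2"
      then have "\<tau> \<omega> \<le> enat (T + r)"
        using \<omega> by (intro rule_le_of_good[OF \<tau> _ T r \<epsilon> lip mix _ _ cond]) (auto simp: B1_def B2_def space_law)
      then show False using \<omega> by auto
    qed
  qed
  ultimately have "p.prob {\<omega>\<in>space (law (enat T)). enat (T + r) < \<tau> \<omega>} \<le> p.prob B1 + p.prob B2"
    by (meson order.trans p.finite_measure_mono sets.Un measure_Un_le)
  also have "p.prob B1 \<le> \<epsilon>" using tail by (simp add: B1_def)
  also have "p.prob B2 \<le> \<epsilon>" unfolding B2_def by (rule rank_dev_tail[OF T r \<epsilon>])
  finally show ?thesis by simp
qed

lemma eventually_late_detection: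
  assumes \<tau>: "\<tau> \<in> rule.rules" and \<kappa>: "0 < \<kappa>" and c: "1 / D < c" and \<epsilon>: "0 < \<epsilon>"
  shows "\<forall>\<^sub>F N in sequentially. \<forall>T\<in>cp_window \<kappa> N.
    late_prob \<tau> T (log_delay c N) \<le> 2 * \<epsilon>"
proof -
  obtain C where lip: "C-lipschitz_on {0..1} (\<lambda>z. ln (h z))"
    using support by (auto simp: local_KL_support_def)
  have C: "0 \<le> C" using lip by (rule lipschitz_on_nonneg)
  obtain a c0 where a: "0 \<le> a" and mix: "\<And>r z. 1 \<le> r \<Longrightarrow> (\<forall>i\<in>{1..r}. z i \<in> {0..1}) \<Longrightarrow>
      ereal ((\<Sum>i=1..r. ln (h (z i))) - a * ln (real r) - c0) \<le> elog (mixture f \<mu> {1..r} z)"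
    using support unfolding local_KL_support_def by blast
  have c0': "0 < c" using c D_pos by (metis divide_pos_pos order.strict_trans zero_less_one)
  \<comment> \<open>One \<eta> pays for the fluctuation of the loss and one for the rank errors.
    What remains satisfies c (D - 2 \<eta>) = (c D + 1) / 2 > 1.\<close>
  define \<eta> where "\<eta> = (D - 1 / c) / 4"
  have "1 / c < D" using c D_pos c0' by (simp add: field_simps)
  then have \<eta>: "0 < \<eta>" by (simp add: \<eta>_def)
  define q where "q = c * (D - 2 * \<eta>)"
  have q: "1 < q"
  proof -
    have "q = (c * D + 1) / 2" unfolding q_def \<eta>_def using c0' by (simp add: field_simps)
    moreover have "1 < c * D" using c D_pos by (simp add: field_simps)
    ultimately show ?thesis by simp
  qed
  have D2: "0 < D - 2 * \<eta>" 
    using q c0' zero_less_mult_pos[of c "D - 2 * \<eta>"] unfolding q_def by linarith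
  obtain n0 where n0: "0 < n0" "\<And>T m. n0 \<le> m \<Longrightarrow>
      \<P>(\<omega> in law (enat T). m * (- D + \<eta>) \<le> (\<Sum>i\<in>{T<..T+m}. loss (fst \<omega> i))) \<le> \<epsilon>"
    using post_change_sum_tail[OF _ ln_h_integrable ln_h_mean \<eta> \<epsilon>] h_F_L_meas by auto
  have "filterlim (\<lambda>N. c * ln (real N)) at_top sequentially" using c0' by real_asymp
  then have ev1: "\<forall>\<^sub>F N in sequentially. real n0 \<le> c * ln (real N)"
    by (simp add: filterlim_at_top)
  \<comment> \<open>Worst case of C times \<open>rank_error\<close> over the window: the smallest T,
    which is at least \<kappa> N, and the largest r, at most c ln N + 1.\<close>
  define err where "err N = C * (1 / (\<epsilon> * sqrt (\<kappa> * real N)) + 1 / sqrt (\<kappa> * real N) + (c * ln (real N) + 1) / (\<kappa> * real N))" for N :: nat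
  have "err \<longlonglongrightarrow> 0"
    unfolding err_def[abs_def] using \<epsilon> \<kappa> c0' by real_asymp
  then have ev2: "\<forall>\<^sub>F N in sequentially. err N < \<eta>"
    using \<eta> by (rule order_tendstoD)
  \<comment> \<open>Everything the log-likelihood has to overcome: the threshold, the constants of
    the support condition, and the weight at \<open>Suc N\<close>, the smallest one for a change in
    the window. Only \<open>ln (real N + 1)\<close> is of order ln N, hence the limit 1 of the
    ratio.\<close>
  define growth where "growth N = ln (1 / \<beta>) + c0 - ln nh_const + a * ln (c * ln (real N) + 1) + ln (real N + 1)
      + 2 * ln (ln (exp 1 + (real N + 1)))" for N :: nat
  have "(\<lambda>N. growth N / ln (real N)) \<longlonglongrightarrow> 1"
    unfolding growth_def using c0' by real_asymp
  then have "\<forall>\<^sub>F N in sequentially. growth N / ln (real N) < q"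
    using q by (rule order_tendstoD)
  then show ?thesis
    using ev1 ev2 eventually_gt_at_top[of 1]
  proof (eventually_elim, safe)
    fix N T :: nat
    assume grow: "growth N / ln (real N) < q"
      and N0: "real n0 \<le> c * ln (real N)"
      and errN: "err N < \<eta>"
      and N: "1 < N" and Tw: "T \<in> cp_window \<kappa> N"
    have ln: "0 < ln (real N)" using N by simp
    define r where "r = log_delay c N"
    have r: "n0 \<le> r" "1 \<le> r" "c * ln (real N) \<le> r" "real r \<le> c * ln (real N) + 1"
      using N0 n0(1) unfolding r_def by linarith+
    have "\<lceil>\<kappa> * real N\<rceil> \<le> int T" using Tw by (simp add: cp_window_def nat_le_iff)
    then have TN: "\<kappa> * real N \<le> real T" "T \<le> N"
      using Tw by (simp_all add: ceiling_le_iff cp_window_def)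
    have \<kappa>N: "0 < \<kappa> * real N" using \<kappa> N by simp
    then have T: "1 \<le> T" using TN(1) by (cases T) auto
    have "rank_error \<epsilon> T r \<le> 1 / (\<epsilon> * sqrt (\<kappa> * real N)) + 1 / sqrt (\<kappa> * real N) + (c * ln (real N) + 1) / (\<kappa> * real N)"
      using \<kappa>N TN(1) \<epsilon> r(4) by (intro add_mono divide_left_mono frac_le mult_left_mono) auto
    then have "C * rank_error \<epsilon> T r \<le> \<eta>" using errN C unfolding err_def by (meson less_imp_le mult_left_mono order.trans)
    then have e: "C * (real r * rank_error \<epsilon> T r) \<le> real r * \<eta>"
      using mult_left_mono[of "C * rank_error \<epsilon> T r" \<eta> "real r"] by (simp add: mult_ac)
    have "ln (nh_weight (Suc N)) \<le> ln (nh_weight (Suc T))"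
      using TN(2) by (intro ln_nh_weight_antimono) auto
    moreover have "ln (nh_weight (Suc N)) = ln nh_const - ln (real N + 1) - 2 * ln (ln (exp 1 + (real N + 1)))"
      by (subst ln_nh_weight) (simp_all add: add.commute)
    moreover have "growth N < q * ln (real N)"
      using grow ln by (simp add: pos_divide_less_eq)
    moreover have "a * ln (real r) \<le> a * ln (c * ln (real N) + 1)"
      using r a by (intro mult_left_mono) auto
    moreover have "q * ln (real N) \<le> real r * (D - 2 * \<eta>)"
      using mult_right_mono[OF r(3), of "D - 2 * \<eta>"] D2 by (simp add: q_def mult_ac)
    moreover have "real r * (D - 2 * \<eta>) = real r * (D - \<eta>) - real r * \<eta>"
      by (simp add: algebra_simps)
    ultimately have cond: "ln (1 / \<beta>) \<le> ln (nh_weight (Suc T)) + real r * (D - \<eta>)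
        - C * (real r * rank_error \<epsilon> T r) - a * ln (real r) - c0"
      using e unfolding growth_def by linarith
    show "late_prob \<tau> T (log_delay c N) \<le> 2 * \<epsilon>"
      using late_detection_prob[OF \<tau> T r(2) \<epsilon> lip mix[OF r(2)] n0(2)[OF r(1)] cond] by (simp add: r_def)
  qed
qed

lemma late_detection_tendsto:
  assumes \<tau>: "\<tau> \<in> rule.rules" and \<kappa>: "0 < \<kappa>" "\<kappa> < 1" and c: "1 / D < c"
  shows "(\<lambda>N. SUP T\<in>cp_window \<kappa> N. late_prob \<tau> T (log_delay c N)) \<longlonglongrightarrow> 0"
proof (rule order_tendstoI)
  let ?P = "\<lambda>N T. late_prob \<tau> T (log_delay c N)"
  have ne: "cp_window \<kappa> N \<noteq> {}" for N using \<kappa> by (intro cp_window_nonempty) simp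
  {
    fix y :: real assume y: "y < 0"
    have "y < (SUP T\<in>cp_window \<kappa> N. ?P N T)" for N
    proof -
      obtain T where T: "T \<in> cp_window \<kappa> N" using ne[of N] by blast
      have "bdd_above (?P N ` cp_window \<kappa> N)" by (intro bdd_above_finite) (simp add: cp_window_def)
      then have "?P N T \<le> (SUP T\<in>cp_window \<kappa> N. ?P N T)" using T by (intro cSUP_upper)
      moreover have "0 \<le> ?P N T" by simp
      ultimately show ?thesis using y by linarith
    qed
    then show "\<forall>\<^sub>F N in sequentially. y < (SUP T\<in>cp_window \<kappa> N. ?P N T)" by simp
  }
  fix y :: real assume y: "0 < y"
  have "\<forall>\<^sub>F N in sequentially. \<forall>T\<in>cp_window \<kappa> N. ?P N T \<le> 2 * (y / 4)"
    using y by (intro eventually_late_detection[OF \<tau> \<kappa>(1) c]) simp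
  then show "\<forall>\<^sub>F N in sequentially. (SUP T\<in>cp_window \<kappa> N. ?P N T) < y"
  proof eventually_elim
    case (elim N)
    then have "(SUP T\<in>cp_window \<kappa> N. ?P N T) \<le> 2 * (y / 4)" using ne by (intro cSUP_least) auto
    then show ?case using y by simp
  qed
qed

section \<open>False alarms and delay combined\<close>

lemma rule_false_alarm_le:
  assumes "\<tau> \<in> rule.rules"
  shows "false_alarm P0 P1 \<tau> \<le> \<beta>"
  using rule.rule_false_alarm[OF assms] unfolding false_alarm_def law_infinity by simp

text \<open>A failure is an alarm up to T or a missed deadline. The former is decided by time T, so
  its probability equals that without a change, at most \<beta>; the latter has eventually at most
  \<delta> - \<beta>, uniformly over the window.\<close>

lemma eventually_rule_delay_le:
  assumes \<tau>: "\<tau> \<in> rule.rules" and \<kappa>: "0 < \<kappa>" "\<kappa> < 1" and c: "1 / D < c" and \<delta>: "\<beta> < \<delta>"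
  shows "\<forall>\<^sub>F N in sequentially. detection_delay P0 P1 \<delta> \<kappa> N \<tau> \<le> enat (log_delay c N)"
proof -
  have rt: "\<tau> \<in> rand_times P0" using \<tau> rule.rules_in_rand_times by blast
  have "\<forall>\<^sub>F N in sequentially. \<forall>T\<in>cp_window \<kappa> N.
      late_prob \<tau> T (log_delay c N) \<le> 2 * ((\<delta> - \<beta>) / 2)"
    using \<delta> by (intro eventually_late_detection[OF \<tau> \<kappa>(1) c]) simp
  then show ?thesis
  proof eventually_elim
    case (elim N)
    show ?case
    proof (rule detection_delay_leI)
      fix T assume T: "T \<in> cp_window \<kappa> N"
      interpret p: prob_space "law (enat T)" by (rule prob_law)
      interpret p0: prob_space "law \<infinity>" by (rule prob_law)
      let ?r = "log_delay c N"
      define A B E where "A = {\<omega>\<in>space \<Omega>. \<tau> \<omega> \<le> enat T}" and "B = {\<omega>\<in>space \<Omega>. enat (T + ?r) < \<tau> \<omega>}"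
        and "E = {\<omega>\<in>space \<Omega>. enat T < \<tau> \<omega> \<and> \<tau> \<omega> \<le> enat (T + ?r)}"
      have Af: "A \<in> sets (rand_filtration P0 (enat T))"
        unfolding A_def by (rule rand_time_le[OF rt order.refl])
      have As: "A \<in> p.events" by (rule rand_filtration_law[OF Af])
      have Es: "E \<in> p.events"
        unfolding E_def by (rule rand_filtration_law[OF rand_time_between[OF rt]])
      have Beq: "B = space (law (enat T)) - {\<omega>\<in>space \<Omega>. \<tau> \<omega> \<le> enat (T + ?r)}"
        unfolding B_def space_law by auto
      have Bs: "B \<in> p.events"
        unfolding Beq by (intro sets.Diff sets.top rand_filtration_law[OF rand_time_le[OF rt order.refl]])
      have "p.prob A = p0.prob A" by (rule law_eq_before_change[OF Af])
      also have "\<dots> \<le> p0.prob {\<omega>\<in>space \<Omega>. \<tau> \<omega> < \<infinity>}"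
        using rand_time_finite_sets[OF rt] unfolding A_def
        by (intro p0.finite_measure_mono) (auto simp: sets_law dest: enat_ile)
      also have "\<dots> \<le> \<beta>"
        using rule_false_alarm_le[OF \<tau>] by (simp add: false_alarm_def space_law)
      finally have A: "p.prob A \<le> \<beta>" .
      have "p.prob B \<le> 2 * ((\<delta> - \<beta>) / 2)"
        using bspec[OF elim T] by (simp only: B_def space_law)
      then have B: "p.prob B \<le> \<delta> - \<beta>" by simp
      have "space (law (enat T)) = A \<union> B \<union> E" unfolding A_def B_def E_def space_law by auto
      then have "1 = p.prob (A \<union> B \<union> E)" using p.prob_space by simp
      also have "\<dots> \<le> p.prob (A \<union> B) + p.prob E" using As Bs Es by (intro measure_Un_le) auto
      also have "p.prob (A \<union> B) \<le> p.prob A + p.prob B" using As Bs by (intro measure_Un_le)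
      finally show "1 - \<delta> \<le> detect_prob \<tau> T ?r"
        using A B by (simp add: detect_prob_def E_def space_law)
    qed (use \<kappa> in simp)
  qed
qed

lemma rule_delay_tendsto:
  assumes \<tau>: "\<tau> \<in> rule.rules" and \<kappa>: "0 < \<kappa>" "\<kappa> < 1" and \<delta>: "\<beta> < \<delta>" "\<delta> < 1" and \<alpha>: "\<beta> \<le> \<alpha>"
  shows "(delay_ratio (optimal_delay P0 P1 (rand_times P0) \<alpha> \<delta> \<kappa>)) \<longlonglongrightarrow> ereal (1 / D)"
    and "(delay_ratio (\<lambda>N. detection_delay P0 P1 \<delta> \<kappa> N \<tau>)) \<longlonglongrightarrow> ereal (1 / D)"
proof -
  have rt: "\<tau> \<in> rand_times P0" using \<tau> rule.rules_in_rand_times by blast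
  have le: "optimal_delay P0 P1 (rand_times P0) \<alpha> \<delta> \<kappa> N \<le> detection_delay P0 P1 \<delta> \<kappa> N \<tau>" for N
    unfolding optimal_delay_def using rt rule_false_alarm_le[OF \<tau>] \<alpha> by (intro INF_lower) auto
  have low: "ereal (1 / D) \<le> liminf (delay_ratio (optimal_delay P0 P1 (rand_times P0) \<alpha> \<delta> \<kappa>))"
    using \<kappa> \<delta> by (intro liminf_optimal_delay) auto
  \<comment> \<open>The delay of one rule is the optimal delay over the singleton class, so the
    general lower bound applies to it.\<close>
  have "delay_ratio (optimal_delay P0 P1 {\<tau>} \<beta> \<delta> \<kappa>)
      = (delay_ratio (\<lambda>N. detection_delay P0 P1 \<delta> \<kappa> N \<tau>))"
    using rule_false_alarm_le[OF \<tau>] by (simp add: optimal_delay_def cong: conj_cong)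
  then have low': "ereal (1 / D) \<le> liminf (delay_ratio (\<lambda>N. detection_delay P0 P1 \<delta> \<kappa> N \<tau>))"
    using liminf_optimal_delay[of \<delta> \<kappa> "{\<tau>}" \<beta>] \<kappa> \<delta> rt by simp
  have pos: "0 < 1 / D" using D_pos by simp
  note up = eventually_rule_delay_le[OF \<tau> \<kappa> _ \<delta>(1)]
  show "(delay_ratio (\<lambda>N. detection_delay P0 P1 \<delta> \<kappa> N \<tau>)) \<longlonglongrightarrow> ereal (1 / D)"
    by (rule delay_ratio_tendsto[OF low' up pos])
  show "(delay_ratio (optimal_delay P0 P1 (rand_times P0) \<alpha> \<delta> \<kappa>)) \<longlonglongrightarrow> ereal (1 / D)"
  proof (rule delay_ratio_tendsto[OF low _ pos])
    fix c assume "1 / D < c"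
    from up[OF this] show "\<forall>\<^sub>F N in sequentially. optimal_delay P0 P1 (rand_times P0) \<alpha> \<delta> \<kappa> N \<le> enat (log_delay c N)"
      by eventually_elim (rule order.trans[OF le])
  qed
qed

end

theorem theorem3p9:
  fixes P0 P1 :: "'a measure" and L :: "'a \<Rightarrow> real" and \<alpha> \<delta> \<kappa> D :: real
  assumes "0 < \<alpha>" "\<alpha> < 1" "0 < \<delta>" "\<delta> < 1" "0 < \<kappa>" "\<kappa> < 1"
    and "prob_space P0" "prob_space P1" "sets P1 = sets P0"
    and "L \<in> borel_measurable P0" "\<And>x. x \<in> space P0 \<Longrightarrow> 0 \<le> L x"
    and "P1 = density P0 (\<lambda>x. ennreal (L x))"
    and "KL_pos_finite P0 P1"
    and "D = KL_divergence (exp 1) P0 P1"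
  shows
    "liminf (\<lambda>N. ereal_of_enat (optimal_delay P0 P1 (raw_times P0) \<alpha> \<delta> \<kappa> N) / ereal (ln (real N)))
       \<ge> ereal (1 / D) \<and>
     liminf (\<lambda>N. ereal_of_enat (optimal_delay P0 P1 (rand_times P0) \<alpha> \<delta> \<kappa> N) / ereal (ln (real N)))
       \<ge> ereal (1 / D) \<and>
     (\<forall>(f :: 'b \<Rightarrow> real \<Rightarrow> real) \<mu> h \<beta> \<tau>.
        continuous_on UNIV (cdf (distr P0 borel L)) \<longrightarrow>
        betting_pair f \<mu> \<longrightarrow>
        local_KL_support f \<mu> (score_law P0 P1 L) h \<longrightarrow>
        0 < \<beta> \<longrightarrow> \<beta> \<le> \<alpha> \<longrightarrow> \<beta> < \<delta> \<longrightarrow>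
        \<tau> \<in> {restart_max L f \<mu> nh_weight (1 / \<beta>), restart_sum L f \<mu> nh_weight (1 / \<beta>)} \<longrightarrow>
          \<tau> \<in> rand_times P0 \<and>
          false_alarm P0 P1 \<tau> \<le> \<beta> \<and>
          (\<forall>c > 1 / D.
             (\<lambda>N. SUP T\<in>cp_window \<kappa> N.
                \<P>(\<omega> in cp_law P0 P1 (enat T). \<tau> \<omega> > enat (T + nat \<lceil>c * ln (real N)\<rceil>)))
             \<longlonglongrightarrow> 0) \<and>
          (\<lambda>N. ereal_of_enat (optimal_delay P0 P1 (rand_times P0) \<alpha> \<delta> \<kappa> N) / ereal (ln (real N)))
             \<longlonglongrightarrow> ereal (1 / D) \<and>
          (\<lambda>N. ereal_of_enat (detection_delay P0 P1 \<delta> \<kappa> N \<tau>) / ereal (ln (real N)))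
             \<longlonglongrightarrow> ereal (1 / D))"
proof -
  interpret change_point_KL P0 P1 L D
    by (intro change_point_KL.intro change_point.intro base_measure.intro change_point_axioms.intro
        change_point_KL_axioms.intro; fact assms)
  have \<delta>: "\<delta> < 1" and \<kappa>: "0 < \<kappa>" "\<kappa> < 1" using assms by auto
  show ?thesis
  proof (rule conjI[OF _ conjI], goal_cases)
    case 1
    show ?case using \<delta> \<kappa> raw_times_subset by (intro liminf_optimal_delay) auto
  next
    case 2
    show ?case using \<delta> \<kappa> by (intro liminf_optimal_delay) auto
  next
    case 3
    show ?case
    proof (intro allI impI, goal_cases)
      case (1 f \<mu> h \<beta> \<tau>)
      note \<tau> = 1(7)
      interpret conformal_detection P0 P1 L D f \<mu> h \<beta>
        by (intro conformal_detection.intro change_point_KL_axioms betting.intro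
            conformal_detection_axioms.intro; fact 1)
      show ?case
        using \<tau> rule.rules_in_rand_times rule_false_alarm_le[OF \<tau>] late_detection_tendsto[OF \<tau> \<kappa>]
          rule_delay_tendsto[OF \<tau> \<kappa> 1(6) \<delta> 1(5)] by blast
    qed
  qed
qed

end
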